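(* Suppose there is $b_1>0$ with $\sup_x|\ell''(x)|\vee\sup_x|\ell'''(x)|\le b_1$. Suppose there are $q_x,q_y,K_x,K_y\ge1$ with $q_{xy}:=(1/q_x+1/q_y)^{-1}>2$, $\sup_{u\in\mathbb S^{d-1}}\mathbb E|u^\top\Sigma^{-1/2}X|^{q_x}\le K_x^{q_x}$ and $\mathbb E|Y-\ell'(X^\top\theta_0)|^{q_y}\le K_y^{q_y}$. Suppose there are constants $\underline\lambda_\Sigma,\overline\lambda_\Sigma,\underline\lambda_V\in(0,\infty)$ with $\underline\lambda_\Sigma\le\lambda_{\min}(\Sigma)\le\lambda_{\max}(\Sigma)\le\overline\lambda_\Sigma$ and $\lambda_{\min}(\mathbb E[XX^\top\ell''(X^\top\theta_0)])\ge\underline\lambda_V$, where $\Sigma=\mathbb E[XX^\top]$. Then there exist constants $c>0$ and $C>0$, not depending on $n$, $d$ or $\varepsilon$, such that for any $\varepsilon\in(0,1)$, with probability at least $1-\varepsilon$, $$C^{-1}\|\widehat\theta_1-\theta_0\|_2\le\sqrt{\frac{d+\log(2/\varepsilon)}{n}}+\frac{d^{1/2}}{n^{1-1/q_{xy}}\varepsilon^{1/q_{xy}}},$$ provided that the right-hand side is no greater than $c$.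
   Context: Misspecified generalized linear regression. $(X,Y),(X_1,Y_1),\dots,(X_n,Y_n)$ are i.i.d. with $X\in\mathbb R^d$, $Y\in\mathbb R$. $\ell:\mathbb R\to\mathbb R$ is convex and thrice differentiable; the loss is $\mathcal L((y,x),\theta)=\ell(x^\top\theta)-yx^\top\theta$, $\theta\in\mathbb R^d$, with gradient $\psi((y,x),\theta)=-x(y-\ell'(x^\top\theta))$. The target $\theta_0\in\mathbb R^d$ is the solution of $\mathbb E[X(Y-\ell'(X^\top\theta_0))]=0_d$; no parametric model for the data is assumed. $n$ is even; $[n]$ is partitioned into $\mathcal I_1,\mathcal I_2$ of sizes $n_1=n_2=n/2$. $\widehat\theta_1$ is the $Z$-estimator from the first half: $n_1^{-1}\sum_{i\in\mathcal I_1}X_i(Y_i-\ell'(X_i^\top\widehat\theta_1))=0_d$. $\mathbb S^{d-1}$ is the unit sphere in $\mathbb R^d$. *)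

theory Defs
  imports
    "HOL-Probability.Probability"
    "Jordan_Normal_Form.Spectral_Radius"
begin

unbundle no vec_syntax
no_notation inner (infix "\<bullet>" 70)

(* The dimension d is quantified inside the theorem (the constants must not depend on it), so
   R^d is rendered as carrier_vec d, equipped with the Euclidean norm and with the Borel
   sigma-algebra, i.e. the one generated by the d coordinates. *)

definition borel_vec :: "nat \<Rightarrow> real vec measure" where
  "borel_vec d =
     vimage_algebra (carrier_vec d) (\<lambda>v. \<lambda>i\<in>{..<d}. v $ i) (\<Pi>\<^sub>M i\<in>{..<d}. borel)"

definition l2_norm :: "real vec \<Rightarrow> real" where
  "l2_norm v = sqrt (v \<bullet> v)"

definition unit_sphere :: "nat \<Rightarrow> real vec set" where
  "unit_sphere d = {u \<in> carrier_vec d. l2_norm u = 1}"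

(* Only used for symmetric real matrices of positive dimension, whose real spectrum is finite
   and nonempty. *)
definition lambda_min :: "real mat \<Rightarrow> real" where
  "lambda_min A = Min (spectrum A)"

definition lambda_max :: "real mat \<Rightarrow> real" where
  "lambda_max A = Max (spectrum A)"

definition pos_def :: "nat \<Rightarrow> real mat \<Rightarrow> bool" where
  "pos_def d A \<longleftrightarrow> A \<in> carrier_mat d d \<and> transpose_mat A = A \<and>
     (\<forall>v\<in>carrier_vec d. v \<noteq> 0\<^sub>v d \<longrightarrow> v \<bullet> (A *\<^sub>v v) > 0)"

(* A^(-1/2): the unique positive definite square root of the inverse of a positive definite A. *)
definition inv_sqrt_mat :: "nat \<Rightarrow> real mat \<Rightarrow> real mat" where
  "inv_sqrt_mat d A = (THE B. pos_def d B \<and> inverts_mat A (B * B) \<and> inverts_mat (B * B) A)"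

(* E[w x x^T]; the entries are meaningful when they are integrable. *)
definition weighted_second_moment ::
    "'a measure \<Rightarrow> nat \<Rightarrow> ('a \<Rightarrow> real vec) \<Rightarrow> ('a \<Rightarrow> real) \<Rightarrow> real mat" where
  "weighted_second_moment M d x w =
     mat d d (\<lambda>(i, j). \<integral>\<omega>. x \<omega> $ i * x \<omega> $ j * w \<omega> \<partial>M)"

abbreviation second_moment :: "'a measure \<Rightarrow> nat \<Rightarrow> ('a \<Rightarrow> real vec) \<Rightarrow> real mat" where
  "second_moment M d x \<equiv> weighted_second_moment M d x (\<lambda>_. 1)"

(* The gradient in \<theta> of the loss l (x^T \<theta>) - y x^T \<theta>. *)
definition score :: "(real \<Rightarrow> real) \<Rightarrow> real \<Rightarrow> real vec \<Rightarrow> real vec \<Rightarrow> real vec" where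
  "score l y x \<theta> = - (y - deriv l (x \<bullet> \<theta>)) \<cdot>\<^sub>v x"

definition empirical_score ::
    "(real \<Rightarrow> real) \<Rightarrow> nat \<Rightarrow> (nat \<Rightarrow> real) \<Rightarrow> (nat \<Rightarrow> real vec) \<Rightarrow> nat set \<Rightarrow> real vec \<Rightarrow> real vec" where
  "empirical_score l d y x I \<theta> =
     vec d (\<lambda>j. (\<Sum>i\<in>I. score l (y i) (x i) \<theta> $ j) / real (card I))"

(* Index 0 carries the generic copy (X, Y), indices 1, ..., n the sample.
   The Z-estimator solves the estimating equation on the first half whenever that equation is
   solvable: its solvability (which can fail with positive probability, e.g. for separable data
   in logistic regression) is not assumed. *)
locale misspecified_glm = prob_space M for M :: "'a measure" +
  fixes d n :: nat
    and l :: "real \<Rightarrow> real"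
    and X :: "nat \<Rightarrow> 'a \<Rightarrow> real vec"
    and Y :: "nat \<Rightarrow> 'a \<Rightarrow> real"
    and I1 I2 :: "nat set"
    and \<theta>0 :: "real vec"
    and \<theta>hat :: "'a \<Rightarrow> real vec"
  assumes d_pos: "d > 0"
    and n_pos: "n > 0"
    and n_even: "even n"
    and partition: "I1 \<union> I2 = {1..n}" "I1 \<inter> I2 = {}" "card I1 = n div 2" "card I2 = n div 2"
    and l_convex: "convex_on UNIV l"
    and l_thrice_differentiable: "\<And>k t. k < 3 \<Longrightarrow> (deriv ^^ k) l field_differentiable (at t)"
    and indep: "indep_vars (\<lambda>_. borel_vec d \<Otimes>\<^sub>M borel) (\<lambda>i \<omega>. (X i \<omega>, Y i \<omega>)) {0..n}"
    and identically_distributed: "\<And>i. i \<in> {0..n} \<Longrightarrow>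
          distr M (borel_vec d \<Otimes>\<^sub>M borel) (\<lambda>\<omega>. (X i \<omega>, Y i \<omega>)) =
          distr M (borel_vec d \<Otimes>\<^sub>M borel) (\<lambda>\<omega>. (X 0 \<omega>, Y 0 \<omega>))"
    and second_moment_exists: "\<And>i j. i < d \<Longrightarrow> j < d \<Longrightarrow> integrable M (\<lambda>\<omega>. X 0 \<omega> $ i * X 0 \<omega> $ j)"
    and target_carrier: "\<theta>0 \<in> carrier_vec d"
    and target_integrable: "\<And>j. j < d \<Longrightarrow>
          integrable M (\<lambda>\<omega>. X 0 \<omega> $ j * (Y 0 \<omega> - deriv l (X 0 \<omega> \<bullet> \<theta>0)))"
    and target: "vec d (\<lambda>j. expectation (\<lambda>\<omega>. X 0 \<omega> $ j * (Y 0 \<omega> - deriv l (X 0 \<omega> \<bullet> \<theta>0)))) = 0\<^sub>v d"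
    and estimator_measurable: "\<theta>hat \<in> M \<rightarrow>\<^sub>M borel_vec d"
    and estimator: "AE \<omega> in M.
          (\<exists>\<theta>\<in>carrier_vec d. empirical_score l d (\<lambda>i. Y i \<omega>) (\<lambda>i. X i \<omega>) I1 \<theta> = 0\<^sub>v d) \<longrightarrow>
          empirical_score l d (\<lambda>i. Y i \<omega>) (\<lambda>i. X i \<omega>) I1 (\<theta>hat \<omega>) = 0\<^sub>v d"

definition estimation_rate :: "real \<Rightarrow> nat \<Rightarrow> nat \<Rightarrow> real \<Rightarrow> real" where
  "estimation_rate q n d \<epsilon> =
     sqrt ((real d + ln (2 / \<epsilon>)) / real n) +
     sqrt (real d) / (real n powr (1 - 1 / q) * \<epsilon> powr (1 / q))"

end

theory Submission
  imports Defs
begin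

(* By convexity of the empirical loss, it suffices that on the sphere of radius rho around theta0 the
   loss exceeds its value at the centre: then the estimating equation is solvable and all of its
   solutions lie in the ball. Two estimates give this with rho a multiple of the rate.

   (1) The mean of Z = X (Y - l'(X . theta0)) is of the order of the rate. This is a Fuk-Nagaev bound:
   Z has weak moments of order qxy by Young's inequality, and the potential
   exp (lam sqrt (R^2 + |S|^2)) of the partial sums S of the truncated vectors is propagated one
   observation at a time. Taking R of order sqrt (n d) separates the dimension from the deviation.

   (2) The second-order remainder of the loss is at least a multiple of rho^2, uniformly over the
   sphere. The remainder of a bounded part of the data is controlled by Hoeffding's inequality at
   each point of a lattice of mesh eta / sqrt d, which has exponentially many points near the sphere;
   a general point is rounded to the lattice at random, which increases the remainder of the
   observations with |X|^2 <= Mr^2 d only by a small multiple of rho^2. *)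

section \<open>Quadratic forms of symmetric matrices\<close>

text \<open>The covariates have only slightly more than two moments, so neither the empirical
  Hessian nor a third-order remainder is under control from above. The argument therefore asks only
  for a lower bound on a sum of nonnegative remainders: discarding large observations can only
  decrease such a sum, and what is kept is bounded, hence fit for an exponential inequality.
  Discretizing the sphere by a Lipschitz estimate would bring in the largest eigenvalue of the
  sample covariance. Under random rounding the first-order terms cancel and only its trace enters,
  multiplied by the squared mesh \<eta>^2 / d. For the noise a union bound over a net is not an
  option: the polynomial term would be multiplied by a factor exponential in d. Its Euclidean norm
  is handled directly through a radial potential. The smallness of the rate is used twice: it makes
  the third-order term at radius \<open>\<rho>\<close> negligible against \<open>lamV\<close>, and
  it forces n to exceed a multiple of d + log (2 / \<epsilon>), which pays for the union bound over
  the lattice.\<close>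

lemma quadratic_nonneg_imp_discriminant:
  fixes a b c :: real
  assumes "\<And>t. a + 2 * b * t + c * t\<^sup>2 \<ge> 0" and "c \<ge> 0"
  shows "b\<^sup>2 \<le> a * c"
proof (cases "c = 0")
  case True
  have "b = 0"
  proof (rule ccontr)
    assume "b \<noteq> 0"
    \<comment> \<open>At this t the affine function \<open>a + 2 * b * t\<close> takes the value
      -1.\<close>
    then show False using assms(1)[of "- (a + 1) / (2 * b)"] True by simp
  qed
  then show ?thesis using True by simp
next
  case False
  then have "c > 0" using assms(2) by simp
  then show ?thesis using assms(1)[of "- b / c"]
    by (simp add: field_simps power2_eq_square)
qed

lemma scalar_prod_self_nonneg: "(v :: real vec) \<bullet> v \<ge> 0"
  by (simp add: scalar_prod_def sum_nonneg)

lemma scalar_prod_self_pos: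
  fixes v :: "real vec"
  assumes "v \<in> carrier_vec d" "v \<noteq> 0\<^sub>v d"
  shows "v \<bullet> v > 0"
  using assms conjugate_square_greater_0_vec[of v d] by auto

lemma symmetric_scalar_prod:
  fixes A :: "real mat"
  assumes "A \<in> carrier_mat d d" "transpose_mat A = A" "v \<in> carrier_vec d" "w \<in> carrier_vec d"
  shows "(A *\<^sub>v v) \<bullet> w = v \<bullet> (A *\<^sub>v w)"
  using transpose_vec_mult_scalar[OF assms(1) assms(4) assms(3)] assms(2) by simp

text \<open>Along \<open>v + t w\<close> the form is a nonnegative quadratic polynomial in t, so its
  discriminant is nonpositive. It is stated for semidefinite A because it is applied to A shifted by
  its least eigenvalue and to \<open>1 - A / Lam\<close>.\<close>

lemma psd_cauchy_schwarz:
  fixes A :: "real mat"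
  assumes A: "A \<in> carrier_mat d d" "transpose_mat A = A"
    and psd: "\<And>v. v \<in> carrier_vec d \<Longrightarrow> v \<bullet> (A *\<^sub>v v) \<ge> 0"
    and v: "v \<in> carrier_vec d" and w: "w \<in> carrier_vec d"
  shows "(w \<bullet> (A *\<^sub>v v))\<^sup>2 \<le> (v \<bullet> (A *\<^sub>v v)) * (w \<bullet> (A *\<^sub>v w))"
proof (rule quadratic_nonneg_imp_discriminant)
  have c: "v \<bullet> (A *\<^sub>v w) = w \<bullet> (A *\<^sub>v v)"
    using symmetric_scalar_prod[OF A v w] comm_scalar_prod[of "A *\<^sub>v v" d w] A v w by auto
  fix t :: real
  have "0 \<le> (v + t \<cdot>\<^sub>v w) \<bullet> (A *\<^sub>v (v + t \<cdot>\<^sub>v w))"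
    using psd v w by simp
  also have "\<dots> = v \<bullet> (A *\<^sub>v v) + 2 * (w \<bullet> (A *\<^sub>v v)) * t + (w \<bullet> (A *\<^sub>v w)) * t\<^sup>2"
    using A v w c
    by (simp add: mult_add_distrib_mat_vec[of A d d] add_scalar_prod_distrib[of _ d] mult_mat_vec[of A d d]
        scalar_prod_add_distrib[of _ d] power2_eq_square algebra_simps)
  finally show "0 \<le> v \<bullet> (A *\<^sub>v v) + 2 * (w \<bullet> (A *\<^sub>v v)) * t + (w \<bullet> (A *\<^sub>v w)) * t\<^sup>2" .
qed (use psd w in simp)

text \<open>Only the existence of some bound matters, so the sum of the absolute values of all
  entries will do; adding 1 keeps it positive for the zero matrix.\<close>

lemma quadratic_form_abs_le:
  fixes A :: "real mat"
  assumes A: "A \<in> carrier_mat d d"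
  shows "\<exists>K>0. \<forall>v\<in>carrier_vec d. \<bar>v \<bullet> (A *\<^sub>v v)\<bar> \<le> K * (v \<bullet> v)"
proof (intro exI conjI ballI)
  let ?K = "(\<Sum>i<d. \<Sum>j<d. \<bar>A $$ (i, j)\<bar>) + 1"
  show "?K > 0" by (simp add: sum_nonneg add_nonneg_pos)
  fix v :: "real vec" assume v: "v \<in> carrier_vec d"
  have vv: "v \<bullet> v = (\<Sum>i<d. (v $ i)\<^sup>2)"
    using v by (simp add: scalar_prod_def power2_eq_square lessThan_atLeast0)
  have prod: "\<bar>v $ i * v $ j\<bar> \<le> v \<bullet> v" if "i < d" "j < d" for i j
  proof -
    have "\<bar>v $ i * v $ j\<bar> \<le> ((v $ i)\<^sup>2 + (v $ j)\<^sup>2) / 2"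
      using sum_squares_bound[of "\<bar>v $ i\<bar>" "\<bar>v $ j\<bar>"] by (simp add: abs_mult)
    moreover have *: "(v $ i)\<^sup>2 \<le> v \<bullet> v" "(v $ j)\<^sup>2 \<le> v \<bullet> v"
      unfolding vv using that by (auto intro!: member_le_sum)
    from * have "((v $ i)\<^sup>2 + (v $ j)\<^sup>2) / 2 \<le> v \<bullet> v" by simp
    with calculation show ?thesis by (rule order_trans)
  qed
  have "v \<bullet> (A *\<^sub>v v) = (\<Sum>i<d. \<Sum>j<d. A $$ (i, j) * (v $ i * v $ j))"
    using A v by (simp add: scalar_prod_def lessThan_atLeast0 sum_distrib_left algebra_simps)
  also have "\<bar>\<dots>\<bar> \<le> (\<Sum>i<d. \<Sum>j<d. \<bar>A $$ (i, j) * (v $ i * v $ j)\<bar>)"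
    by (intro sum_abs[THEN order_trans] sum_mono) simp
  also have "\<dots> \<le> (\<Sum>i<d. \<Sum>j<d. \<bar>A $$ (i, j)\<bar> * (v \<bullet> v))"
    by (intro sum_mono) (auto simp: abs_mult intro!: mult_left_mono prod[unfolded abs_mult])
  also have "\<dots> = (\<Sum>i<d. \<Sum>j<d. \<bar>A $$ (i, j)\<bar>) * (v \<bullet> v)"
    by (simp add: sum_distrib_right)
  also have "\<dots> \<le> ?K * (v \<bullet> v)"
    by (intro mult_right_mono) (simp_all add: scalar_prod_self_nonneg)
  finally show "\<bar>v \<bullet> (A *\<^sub>v v)\<bar> \<le> ?K * (v \<bullet> v)" .
qed

lemma smult_mat_mult_vec:
  fixes A :: "real mat"
  assumes "A \<in> carrier_mat n m" "v \<in> carrier_vec m"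
  shows "(k \<cdot>\<^sub>m A) *\<^sub>v v = k \<cdot>\<^sub>v (A *\<^sub>v v)"
  using assms by (intro eq_vecI) (auto simp: scalar_prod_def sum_distrib_left mult.assoc intro!: sum.cong)

(* By Cauchy-Schwarz for the form of A, (v.v)^2 = (A^-1 v . A v)^2 <= (v . A v) (A^-1 v . v). *)
lemma psd_nonsingular_bounded_below:
  fixes A :: "real mat"
  assumes A: "A \<in> carrier_mat d d" "transpose_mat A = A"
    and psd: "\<And>v. v \<in> carrier_vec d \<Longrightarrow> v \<bullet> (A *\<^sub>v v) \<ge> 0"
    and det: "det A \<noteq> 0"
  shows "\<exists>k>0. \<forall>v\<in>carrier_vec d. v \<bullet> (A *\<^sub>v v) \<ge> k * (v \<bullet> v)"
proof -
  obtain B where B: "B \<in> carrier_mat d d" "A * B = 1\<^sub>m d"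
    using det_non_zero_imp_unit[OF A(1) det] unfolding Units_def by (auto simp: ring_mat_def)
  obtain K where K: "K > 0" "\<And>v. v \<in> carrier_vec d \<Longrightarrow> \<bar>v \<bullet> (B *\<^sub>v v)\<bar> \<le> K * (v \<bullet> v)"
    using quadratic_form_abs_le[OF B(1)] by blast
  show ?thesis
  proof (intro exI conjI ballI)
    show "1 / K > 0" using K by simp
    fix v :: "real vec" assume v: "v \<in> carrier_vec d"
    let ?w = "B *\<^sub>v v"
    have w: "?w \<in> carrier_vec d" using B v by simp
    have Aw: "A *\<^sub>v ?w = v"
      using assoc_mult_mat_vec[OF A(1) B(1) v] B(2) v by simp
    have "?w \<bullet> (A *\<^sub>v v) = v \<bullet> v"
      using symmetric_scalar_prod[OF A w v] Aw by simp
    moreover have "?w \<bullet> (A *\<^sub>v ?w) = v \<bullet> ?w"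
      unfolding Aw using comm_scalar_prod[OF w v] .
    ultimately have "(v \<bullet> v)\<^sup>2 \<le> (v \<bullet> (A *\<^sub>v v)) * (v \<bullet> ?w)"
      using psd_cauchy_schwarz[OF A psd v w] by simp
    also have "\<dots> \<le> (v \<bullet> (A *\<^sub>v v)) * (K * (v \<bullet> v))"
      using K(2)[OF v] psd[OF v] by (intro mult_left_mono) auto
    finally have "(v \<bullet> v) * (v \<bullet> v) \<le> (K * (v \<bullet> (A *\<^sub>v v))) * (v \<bullet> v)"
      by (simp add: power2_eq_square algebra_simps)
    then have "v \<bullet> v \<le> K * (v \<bullet> (A *\<^sub>v v))"
    proof (cases "v \<bullet> v = 0")
      case True then show ?thesis using psd[OF v] K(1) by simp
    next
      case False
      then have "v \<bullet> v > 0" using scalar_prod_self_nonneg[of v] by linarith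
      then show ?thesis using \<open>(v \<bullet> v) * (v \<bullet> v) \<le> _\<close> by simp
    qed
    then show "v \<bullet> (A *\<^sub>v v) \<ge> 1 / K * (v \<bullet> v)" using K(1) by (simp add: field_simps)
  qed
qed

text \<open>Let k be the supremum of all t for which A - t is positive semidefinite. If A - k were
  nonsingular, its form would be bounded below by some c > 0, and k + c would qualify as well. Hence
  A - k is singular, and a vector of its kernel is the eigenvector.\<close>

lemma symmetric_least_eigenvalue:
  fixes A :: "real mat"
  assumes A: "A \<in> carrier_mat d d" "transpose_mat A = A" and d: "d > 0"
  shows "\<exists>k. eigenvalue A k \<and> (\<forall>v\<in>carrier_vec d. k * (v \<bullet> v) \<le> v \<bullet> (A *\<^sub>v v))"
proof -
  define S where "S = {t. \<forall>v\<in>carrier_vec d. t * (v \<bullet> v) \<le> v \<bullet> (A *\<^sub>v v)}"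
  obtain K where K: "K > 0" "\<And>v. v \<in> carrier_vec d \<Longrightarrow> \<bar>v \<bullet> (A *\<^sub>v v)\<bar> \<le> K * (v \<bullet> v)"
    using quadratic_form_abs_le[OF A(1)] by blast
  have ne: "- K \<in> S" unfolding S_def using K(2) abs_le_D2 by force
  have e: "unit_vec d 0 \<in> carrier_vec d" "(unit_vec d 0 :: real vec) \<bullet> unit_vec d 0 = 1" using d by auto
  have bdd: "bdd_above S"
    unfolding bdd_above_def S_def using e by (intro exI[of _ "unit_vec d 0 \<bullet> (A *\<^sub>v unit_vec d 0)"]) fastforce
  define k where "k = Sup S"
  have kS: "k * (v \<bullet> v) \<le> v \<bullet> (A *\<^sub>v v)" if v: "v \<in> carrier_vec d" for v
  proof (cases "v \<bullet> v = 0")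
    case True
    then show ?thesis using K(2)[OF v] by simp
  next
    case False
    then have vv: "v \<bullet> v > 0" using scalar_prod_self_nonneg[of v] by linarith
    have "k \<le> (v \<bullet> (A *\<^sub>v v)) / (v \<bullet> v)"
      unfolding k_def
    proof (rule cSup_least)
      show "S \<noteq> {}" using ne by auto
      fix t assume "t \<in> S"
      then show "t \<le> (v \<bullet> (A *\<^sub>v v)) / (v \<bullet> v)" using v vv unfolding S_def by (simp add: pos_le_divide_eq)
    qed
    then show ?thesis using vv by (simp add: pos_le_divide_eq)
  qed
  let ?B = "A - k \<cdot>\<^sub>m 1\<^sub>m d"
  have B: "?B \<in> carrier_mat d d" "transpose_mat ?B = ?B"
    using A by (auto simp: transpose_minus[of _ d d])
  have Bv: "?B *\<^sub>v v = A *\<^sub>v v - k \<cdot>\<^sub>v v" if v: "v \<in> carrier_vec d" for v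
  proof -
    have "(k \<cdot>\<^sub>m 1\<^sub>m d) *\<^sub>v v = k \<cdot>\<^sub>v v" using v by (simp add: smult_mat_mult_vec[of _ d d])
    then show ?thesis using A v by (simp add: minus_mult_distrib_mat_vec[of _ d d])
  qed
  have form: "v \<bullet> (?B *\<^sub>v v) = v \<bullet> (A *\<^sub>v v) - k * (v \<bullet> v)" if v: "v \<in> carrier_vec d" for v
    unfolding Bv[OF v] using A v by (simp add: scalar_prod_minus_distrib[of _ d])
  have "det ?B = 0"
  proof (rule ccontr)
    assume "det ?B \<noteq> 0"
    then obtain c where c: "c > 0" "\<And>v. v \<in> carrier_vec d \<Longrightarrow> c * (v \<bullet> v) \<le> v \<bullet> (?B *\<^sub>v v)"
      using psd_nonsingular_bounded_below[OF B] kS form by auto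
    have "k + c \<in> S" unfolding S_def using c(2) form by (auto simp: algebra_simps)
    then have "k + c \<le> k" unfolding k_def by (rule cSup_upper[OF _ bdd])
    then show False using c by simp
  qed
  then obtain v where v: "v \<in> carrier_vec d" "v \<noteq> 0\<^sub>v d" "?B *\<^sub>v v = 0\<^sub>v d"
    using det_0_iff_vec_prod_zero[OF B(1)] by auto
  have "A *\<^sub>v v = k \<cdot>\<^sub>v v"
  proof -
    have "A *\<^sub>v v - k \<cdot>\<^sub>v v = 0\<^sub>v d" using Bv[OF v(1)] v(3) by simp
    moreover have "(A *\<^sub>v v - k \<cdot>\<^sub>v v) + k \<cdot>\<^sub>v v = A *\<^sub>v v" using A v(1) by (intro eq_vecI) auto
    ultimately show ?thesis using v(1) by simp
  qed
  then have "eigenvalue A k" unfolding eigenvalue_def eigenvector_def using A v by auto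
  then show ?thesis using kS by blast
qed

lemma eigenvalue_uminus:
  fixes A :: "real mat"
  assumes "A \<in> carrier_mat d d" "eigenvalue (- A) k"
  shows "eigenvalue A (- k)"
proof -
  obtain v where v: "v \<in> carrier_vec d" "v \<noteq> 0\<^sub>v d" "(- A) *\<^sub>v v = k \<cdot>\<^sub>v v"
    using assms unfolding eigenvalue_def eigenvector_def by auto
  have "A *\<^sub>v v = - ((- A) *\<^sub>v v)" using assms(1) v(1) by (simp add: uminus_mult_mat_vec)
  also have "\<dots> = (- k) \<cdot>\<^sub>v v" unfolding v(3) using v(1) by (intro eq_vecI) auto
  finally show ?thesis using assms(1) v unfolding eigenvalue_def eigenvector_def by auto
qed

lemma symmetric_greatest_eigenvalue:
  fixes A :: "real mat"
  assumes A: "A \<in> carrier_mat d d" "transpose_mat A = A" and d: "d > 0"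
  shows "\<exists>k. eigenvalue A k \<and> (\<forall>v\<in>carrier_vec d. v \<bullet> (A *\<^sub>v v) \<le> k * (v \<bullet> v))"
proof -
  have t: "transpose_mat (- A) = - A" using A by (intro eq_matI) (auto, metis A carrier_matD index_transpose_mat(1))
  obtain k where k: "eigenvalue (- A) k" "\<And>v. v \<in> carrier_vec d \<Longrightarrow> k * (v \<bullet> v) \<le> v \<bullet> ((- A) *\<^sub>v v)"
    using symmetric_least_eigenvalue[of "- A" d] A t d by auto
  have "v \<bullet> ((- A) *\<^sub>v v) = - (v \<bullet> (A *\<^sub>v v))" if "v \<in> carrier_vec d" for v
    using A that by (simp add: uminus_mult_mat_vec)
  then show ?thesis using k eigenvalue_uminus[OF A(1) k(1)] by (intro exI[of _ "- k"]) fastforce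
qed

lemma lambda_min_le_quadratic_form:
  assumes "A \<in> carrier_mat d d" "transpose_mat A = A" "d > 0" "v \<in> carrier_vec d"
  shows "lambda_min A * (v \<bullet> v) \<le> v \<bullet> (A *\<^sub>v v)"
proof -
  obtain k where k: "eigenvalue A k" "k * (v \<bullet> v) \<le> v \<bullet> (A *\<^sub>v v)"
    using symmetric_least_eigenvalue[OF assms(1-3)] assms(4) by blast
  have "lambda_min A \<le> k" unfolding lambda_min_def
    using k(1) card_finite_spectrum(1)[OF assms(1)] by (intro Min_le) (auto simp: spectrum_def)
  then have "lambda_min A * (v \<bullet> v) \<le> k * (v \<bullet> v)" by (intro mult_right_mono scalar_prod_self_nonneg)
  then show ?thesis using k(2) by linarith
qed

lemma quadratic_form_le_lambda_max:
  assumes "A \<in> carrier_mat d d" "transpose_mat A = A" "d > 0" "v \<in> carrier_vec d"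
  shows "v \<bullet> (A *\<^sub>v v) \<le> lambda_max A * (v \<bullet> v)"
proof -
  obtain k where k: "eigenvalue A k" "v \<bullet> (A *\<^sub>v v) \<le> k * (v \<bullet> v)"
    using symmetric_greatest_eigenvalue[OF assms(1-3)] assms(4) by blast
  have "k \<le> lambda_max A" unfolding lambda_max_def
    using k(1) card_finite_spectrum(1)[OF assms(1)] by (intro Max_ge) (auto simp: spectrum_def)
  then have "k * (v \<bullet> v) \<le> lambda_max A * (v \<bullet> v)" by (intro mult_right_mono scalar_prod_self_nonneg)
  then show ?thesis using k(2) by linarith
qed

section \<open>Inverse square roots of matrices\<close>

lemma index_mult_mat_sum:
  fixes A B :: "real mat"
  assumes "A \<in> carrier_mat n m" "B \<in> carrier_mat m k" "i < n" "j < k"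
  shows "(A * B) $$ (i, j) = (\<Sum>l<m. A $$ (i, l) * B $$ (l, j))"
  using assms by (simp add: scalar_prod_def lessThan_atLeast0)

lemma pow_mat_add:
  assumes "(A :: real mat) \<in> carrier_mat d d"
  shows "A ^\<^sub>m (p + q) = A ^\<^sub>m p * A ^\<^sub>m q"
proof (induction q)
  case (Suc q)
  then show ?case using assms assoc_mult_mat[of "A ^\<^sub>m p" d d "A ^\<^sub>m q" d A d] by simp
qed (use assms in simp)

lemma pow_mat_Suc_left:
  assumes "(A :: real mat) \<in> carrier_mat d d"
  shows "A ^\<^sub>m Suc k = A * A ^\<^sub>m k"
  using pow_mat_add[OF assms, of 1 k] assms by simp

lemma transpose_mat_smult: "transpose_mat (k \<cdot>\<^sub>m (A :: real mat)) = k \<cdot>\<^sub>m transpose_mat A"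
  by (rule eq_matI) auto

text \<open>Cauchy-Schwarz for the form of N, applied to v and N v, gives |N v|^4 <= (v . N v) (N v
  . N N v), and both factors are bounded by the form.\<close>

lemma psd_norm_bound:
  fixes N :: "real mat"
  assumes N: "N \<in> carrier_mat d d" "transpose_mat N = N"
    and psd: "\<And>v. v \<in> carrier_vec d \<Longrightarrow> v \<bullet> (N *\<^sub>v v) \<ge> 0"
    and le: "\<And>v. v \<in> carrier_vec d \<Longrightarrow> v \<bullet> (N *\<^sub>v v) \<le> r * (v \<bullet> v)"
    and r: "r \<ge> 0" and v: "v \<in> carrier_vec d"
  shows "(N *\<^sub>v v) \<bullet> (N *\<^sub>v v) \<le> r\<^sup>2 * (v \<bullet> v)"
proof (cases "(N *\<^sub>v v) \<bullet> (N *\<^sub>v v) = 0")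
  case True
  then show ?thesis by (simp add: scalar_prod_self_nonneg)
next
  case False
  let ?x = "N *\<^sub>v v"
  have x: "?x \<in> carrier_vec d" using N v by simp
  have pos: "?x \<bullet> ?x > 0" using False scalar_prod_self_nonneg[of ?x] by linarith
  have "(?x \<bullet> ?x)\<^sup>2 \<le> (v \<bullet> ?x) * (?x \<bullet> (N *\<^sub>v ?x))"
    using psd_cauchy_schwarz[OF N psd v x] .
  also have "\<dots> \<le> (r * (v \<bullet> v)) * (r * (?x \<bullet> ?x))"
    using le[OF v] le[OF x] psd[OF v] psd[OF x] by (intro mult_mono) auto
  finally have "(?x \<bullet> ?x) * (?x \<bullet> ?x) \<le> (r\<^sup>2 * (v \<bullet> v)) * (?x \<bullet> ?x)"
    by (simp add: power2_eq_square algebra_simps)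
  then show ?thesis using pos by simp
qed

text \<open>Positivity passes from k to k + 2, because v . N^(k+2) v = (N v) . N^k (N v); hence the
  induction with two base cases. The entrywise bound makes power series in N converge absolutely
  when r < 1.\<close>

lemma psd_pow_mat_bounds:
  fixes N :: "real mat"
  assumes N: "N \<in> carrier_mat d d" "transpose_mat N = N"
    and psd: "\<And>v. v \<in> carrier_vec d \<Longrightarrow> v \<bullet> (N *\<^sub>v v) \<ge> 0"
    and le: "\<And>v. v \<in> carrier_vec d \<Longrightarrow> v \<bullet> (N *\<^sub>v v) \<le> r * (v \<bullet> v)"
    and r: "r \<ge> 0"
  shows "transpose_mat (N ^\<^sub>m k) = N ^\<^sub>m k"
    and "v \<in> carrier_vec d \<Longrightarrow> v \<bullet> (N ^\<^sub>m k *\<^sub>v v) \<ge> 0"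
    and "v \<in> carrier_vec d \<Longrightarrow> (N ^\<^sub>m k *\<^sub>v v) \<bullet> (N ^\<^sub>m k *\<^sub>v v) \<le> (r ^ k)\<^sup>2 * (v \<bullet> v)"
    and "i < d \<Longrightarrow> j < d \<Longrightarrow> \<bar>(N ^\<^sub>m k) $$ (i, j)\<bar> \<le> r ^ k"
proof -
  have Nk: "N ^\<^sub>m k \<in> carrier_mat d d" for k using N by simp
  show "transpose_mat (N ^\<^sub>m k) = N ^\<^sub>m k"
  proof (induction k)
    case (Suc k)
    have "transpose_mat (N ^\<^sub>m Suc k) = transpose_mat N * transpose_mat (N ^\<^sub>m k)"
      using transpose_mult[OF Nk N(1), of k] by simp
    then show ?case unfolding Suc N(2) using pow_mat_Suc_left[OF N(1), of k] by simp
  qed (use N in simp)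
  show "v \<in> carrier_vec d \<Longrightarrow> v \<bullet> (N ^\<^sub>m k *\<^sub>v v) \<ge> 0"
  proof (induction k arbitrary: v rule: induct_nat_012)
    case 0
    then show ?case using N by (simp add: scalar_prod_self_nonneg)
  next
    case 1
    then show ?case using N psd by simp
  next
    case (ge2 k)
    have Nv: "N *\<^sub>v v \<in> carrier_vec d" using N ge2.prems by simp
    have "N ^\<^sub>m Suc (Suc k) = N * N ^\<^sub>m k * N"
      using pow_mat_Suc_left[OF N(1), of k] by simp
    then have "N ^\<^sub>m Suc (Suc k) *\<^sub>v v = N *\<^sub>v (N ^\<^sub>m k *\<^sub>v (N *\<^sub>v v))"
      using N Nk Nv ge2.prems by (simp add: assoc_mult_mat_vec[of _ d d _ d])
    then have "v \<bullet> (N ^\<^sub>m Suc (Suc k) *\<^sub>v v) = (N *\<^sub>v v) \<bullet> (N ^\<^sub>m k *\<^sub>v (N *\<^sub>v v))"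
      using symmetric_scalar_prod[OF N ge2.prems, of "N ^\<^sub>m k *\<^sub>v (N *\<^sub>v v)"] Nk Nv
      by (metis mult_mat_vec_carrier)
    then show ?case using ge2.IH(1)[OF Nv] by simp
  qed
  show norm: "(N ^\<^sub>m k *\<^sub>v v) \<bullet> (N ^\<^sub>m k *\<^sub>v v) \<le> (r ^ k)\<^sup>2 * (v \<bullet> v)" if v: "v \<in> carrier_vec d" for v
  proof (induction k)
    case 0
    then show ?case using N v by simp
  next
    case (Suc k)
    let ?w = "N ^\<^sub>m k *\<^sub>v v"
    have w: "?w \<in> carrier_vec d" using Nk v by (meson mult_mat_vec_carrier)
    have e: "N ^\<^sub>m Suc k *\<^sub>v v = N *\<^sub>v ?w"
      unfolding pow_mat_Suc_left[OF N(1)] using assoc_mult_mat_vec[OF N(1) Nk v] .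
    have "(N *\<^sub>v ?w) \<bullet> (N *\<^sub>v ?w) \<le> r\<^sup>2 * (?w \<bullet> ?w)"
      by (rule psd_norm_bound[OF N psd le r w])
    moreover have "r\<^sup>2 * (?w \<bullet> ?w) \<le> r\<^sup>2 * ((r ^ k)\<^sup>2 * (v \<bullet> v))"
      using Suc by (intro mult_left_mono) auto
    moreover have "r\<^sup>2 * ((r ^ k)\<^sup>2 * (v \<bullet> v)) = (r ^ Suc k)\<^sup>2 * (v \<bullet> v)"
      by (simp add: power_mult_distrib)
    ultimately show ?case unfolding e by linarith
  qed
  show "\<bar>(N ^\<^sub>m k) $$ (i, j)\<bar> \<le> r ^ k" if ij: "i < d" "j < d"
  proof -
    let ?w = "N ^\<^sub>m k *\<^sub>v unit_vec d j"
    have w: "?w \<in> carrier_vec d" using Nk by (meson mult_mat_vec_carrier unit_vec_carrier)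
    have wi: "?w $ i = (N ^\<^sub>m k) $$ (i, j)"
    proof -
      have dims: "dim_row (N ^\<^sub>m k) = d" "dim_col (N ^\<^sub>m k) = d" using Nk[of k] by auto
      then have "?w $ i = row (N ^\<^sub>m k) i \<bullet> unit_vec d j" using ij by (simp del: pow_mat_dim)
      also have "\<dots> = row (N ^\<^sub>m k) i $ j" using ij by (rule_tac scalar_prod_right_unit)
      also have "\<dots> = (N ^\<^sub>m k) $$ (i, j)" using dims ij by (simp del: pow_mat_dim)
      finally show ?thesis .
    qed
    have "(?w $ i)\<^sup>2 \<le> (\<Sum>m<d. (?w $ m)\<^sup>2)" using ij by (intro member_le_sum) auto
    also have "\<dots> = ?w \<bullet> ?w" using w N by (simp add: scalar_prod_def power2_eq_square lessThan_atLeast0 del: index_mult_mat_vec)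
    also have "\<dots> \<le> (r ^ k)\<^sup>2 * ((unit_vec d j :: real vec) \<bullet> unit_vec d j)" by (rule norm) simp
    also have "\<dots> = (r ^ k)\<^sup>2" using ij by simp
    finally show ?thesis using wi r by (simp add: abs_le_square_iff[symmetric])
  qed
qed

text \<open>The Taylor coefficients of (1 - x)^(-1/2), also equal to binom(2k, k) / 4^k.\<close>

definition inv_sqrt_coeff :: "nat \<Rightarrow> real" where
  "inv_sqrt_coeff k = pochhammer (1 / 2) k / fact k"

lemma inv_sqrt_coeff_0 [simp]: "inv_sqrt_coeff 0 = 1"
  by (simp add: inv_sqrt_coeff_def)

lemma inv_sqrt_coeff_nonneg: "inv_sqrt_coeff k \<ge> 0"
  by (simp add: inv_sqrt_coeff_def pochhammer_nonneg)

lemma inv_sqrt_coeff_le_1: "inv_sqrt_coeff k \<le> 1"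
proof (induction k)
  case (Suc k)
  have "inv_sqrt_coeff (Suc k) = inv_sqrt_coeff k * ((1 / 2 + real k) / (1 + real k))"
    by (simp add: inv_sqrt_coeff_def pochhammer_Suc mult.commute)
  also have "\<dots> \<le> 1 * 1" using Suc inv_sqrt_coeff_nonneg by (intro mult_mono) auto
  finally show ?case by simp
qed simp

text \<open>The square of (1 - x)^(-1/2) is the geometric series. On coefficients this is
  Vandermonde's identity for rising factorials, with the rising factorial of 1 equal to
  \<open>fact k\<close>.\<close>

lemma inv_sqrt_coeff_convolution: "(\<Sum>i\<le>k. inv_sqrt_coeff i * inv_sqrt_coeff (k - i)) = 1"
proof -
  have "(\<Sum>i\<le>k. inv_sqrt_coeff i * inv_sqrt_coeff (k - i)) =
      (\<Sum>i\<le>k. of_nat (k choose i) * pochhammer (1 / 2) i * pochhammer (1 / 2) (k - i)) / fact k"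
    unfolding sum_divide_distrib
    by (intro sum.cong) (auto simp: inv_sqrt_coeff_def binomial_fact field_simps)
  also have "\<dots> = pochhammer (1 / 2 + 1 / 2 :: real) k / fact k"
    by (simp only: pochhammer_binomial_sum)
  also have "\<dots> = 1" by (simp flip: pochhammer_fact)
  finally show ?thesis .
qed

(* The power series of (1 - x)^(-1/2), evaluated at the contraction N = 1 - A / Lam. *)
lemma inv_sqrt_exists:
  fixes A :: "real mat"
  assumes A: "A \<in> carrier_mat d d" "transpose_mat A = A"
    and lower: "\<And>v. v \<in> carrier_vec d \<Longrightarrow> lam * (v \<bullet> v) \<le> v \<bullet> (A *\<^sub>v v)"
    and upper: "\<And>v. v \<in> carrier_vec d \<Longrightarrow> v \<bullet> (A *\<^sub>v v) \<le> Lam * (v \<bullet> v)"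
    and lam: "0 < lam" "lam \<le> Lam"
  shows "\<exists>B. pos_def d B \<and> A * (B * B) = 1\<^sub>m d \<and> (B * B) * A = 1\<^sub>m d"
proof -
  define N where "N = 1\<^sub>m d - (1 / Lam) \<cdot>\<^sub>m A"
  define r where "r = 1 - lam / Lam"
  have r: "0 \<le> r" "r < 1" using lam by (auto simp: r_def)
  have N: "N \<in> carrier_mat d d" "transpose_mat N = N"
    using A by (auto simp: N_def transpose_minus[of _ d d] transpose_mat_smult)
  have Nv: "v \<bullet> (N *\<^sub>v v) = v \<bullet> v - (v \<bullet> (A *\<^sub>v v)) / Lam" if v: "v \<in> carrier_vec d" for v
    unfolding N_def using A v
    by (simp add: minus_mult_distrib_mat_vec[of _ d d] smult_mat_mult_vec[of _ d d]
        scalar_prod_minus_distrib[of _ d])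
  have psd: "v \<bullet> (N *\<^sub>v v) \<ge> 0" if "v \<in> carrier_vec d" for v
  proof -
    have "(v \<bullet> (A *\<^sub>v v)) / Lam \<le> v \<bullet> v"
      using upper[OF that] lam by (simp add: pos_divide_le_eq mult.commute)
    then show ?thesis unfolding Nv[OF that] by simp
  qed
  have le: "v \<bullet> (N *\<^sub>v v) \<le> r * (v \<bullet> v)" if "v \<in> carrier_vec d" for v
  proof -
    have "lam * (v \<bullet> v) / Lam \<le> (v \<bullet> (A *\<^sub>v v)) / Lam"
      using lower[OF that] lam by (intro divide_right_mono) auto
    then show ?thesis unfolding Nv[OF that] r_def by (simp add: left_diff_distrib)
  qed
  have pow_sym: "transpose_mat (N ^\<^sub>m k) = N ^\<^sub>m k" for k
    by (rule psd_pow_mat_bounds(1)[OF N psd le r(1)]) auto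
  have pow_psd: "v \<bullet> (N ^\<^sub>m k *\<^sub>v v) \<ge> 0" if "v \<in> carrier_vec d" for k v
    by (rule psd_pow_mat_bounds(2)[OF N psd le r(1)]) (use that in auto)
  have pow_le: "\<bar>(N ^\<^sub>m k) $$ (i, j)\<bar> \<le> r ^ k" if "i < d" "j < d" for i j k
    by (rule psd_pow_mat_bounds(4)[OF N psd le r(1)]) (use that in auto)
  have Nk: "N ^\<^sub>m k \<in> carrier_mat d d" for k using N by simp
  define b where "b = inv_sqrt_coeff"
  have b: "0 \<le> b k" "b k \<le> 1" "b 0 = 1" for k
    by (simp_all add: b_def inv_sqrt_coeff_nonneg inv_sqrt_coeff_le_1)
  have sumr: "summable (\<lambda>k. r ^ k)" using r by (simp add: summable_geometric)
  have summ: "summable (\<lambda>k. norm (b k * (N ^\<^sub>m k) $$ (i, j)))" if "i < d" "j < d" for i j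
  proof (rule summable_norm_comparison_test)
    show "\<exists>n0. \<forall>k\<ge>n0. norm (b k * (N ^\<^sub>m k) $$ (i, j)) \<le> r ^ k"
    proof (intro exI[of _ 0] allI impI)
      fix k
      have "norm (b k * (N ^\<^sub>m k) $$ (i, j)) \<le> 1 * r ^ k"
        unfolding norm_mult using b(1,2)[of k] pow_le[OF that, of k] by (intro mult_mono) auto
      then show "norm (b k * (N ^\<^sub>m k) $$ (i, j)) \<le> r ^ k" by simp
    qed
  qed (rule sumr)
  define B where "B = mat d d (\<lambda>(i, j). \<Sum>k. b k * (N ^\<^sub>m k) $$ (i, j))"
  have B: "B \<in> carrier_mat d d" by (simp add: B_def)
  have Bij: "(\<lambda>k. b k * (N ^\<^sub>m k) $$ (i, j)) sums B $$ (i, j)" if "i < d" "j < d" for i j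
    using summable_sums[OF summable_norm_cancel[OF summ[OF that]]] that by (simp add: B_def)
  have symk: "(N ^\<^sub>m k) $$ (i, j) = (N ^\<^sub>m k) $$ (j, i)" if "i < d" "j < d" for i j k
    using pow_sym[of k] Nk[of k] that by (metis carrier_matD index_transpose_mat(1))
  have Bt: "transpose_mat B = B"
    by (rule eq_matI) (auto simp: B_def symk)
  \<comment> \<open>All terms of the series for v . B v are nonnegative and the zeroth one is v . v,
    so B is even bounded below by the identity.\<close>
  have Bform: "v \<bullet> v \<le> v \<bullet> (B *\<^sub>v v)" if v: "v \<in> carrier_vec d" for v
  proof -
    have form: "v \<bullet> (C *\<^sub>v v) = (\<Sum>i<d. \<Sum>j<d. v $ i * (C $$ (i, j) * v $ j))"
      if "C \<in> carrier_mat d d" for C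
      using that v by (simp add: scalar_prod_def lessThan_atLeast0 sum_distrib_left)
    have "(\<lambda>k. \<Sum>i<d. \<Sum>j<d. v $ i * ((b k * (N ^\<^sub>m k) $$ (i, j)) * v $ j)) sums (v \<bullet> (B *\<^sub>v v))"
      unfolding form[OF B] by (intro sums_sum sums_mult sums_mult2 Bij) auto
    moreover have "(\<Sum>i<d. \<Sum>j<d. v $ i * ((b k * (N ^\<^sub>m k) $$ (i, j)) * v $ j)) =
        b k * (v \<bullet> (N ^\<^sub>m k *\<^sub>v v))" for k
      unfolding form[OF Nk] by (simp add: sum_distrib_left algebra_simps)
    ultimately have s: "(\<lambda>k. b k * (v \<bullet> (N ^\<^sub>m k *\<^sub>v v))) sums (v \<bullet> (B *\<^sub>v v))" by simp
    have "(\<Sum>k\<in>{0}. b k * (v \<bullet> (N ^\<^sub>m k *\<^sub>v v))) \<le> v \<bullet> (B *\<^sub>v v)"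
      unfolding sums_unique[OF s]
      by (rule sum_le_suminf) (use sums_summable[OF s] b pow_psd[OF v] in auto)
    then show ?thesis using N v b by simp
  qed
  \<comment> \<open>The Cauchy product of the series with itself collapses by
    \<open>inv_sqrt_coeff_convolution\<close>: B B is the Neumann series of N, that is, the inverse
    of 1 - N = A / Lam.\<close>
  have prod: "(\<lambda>k. (N ^\<^sub>m k) $$ (i, j)) sums (B * B) $$ (i, j)" if ij: "i < d" "j < d" for i j
  proof -
    have "(\<lambda>k. \<Sum>m<d. \<Sum>p\<le>k. (b p * (N ^\<^sub>m p) $$ (i, m)) * (b (k - p) * (N ^\<^sub>m (k - p)) $$ (m, j)))
        sums (\<Sum>m<d. B $$ (i, m) * B $$ (m, j))"
    proof (rule sums_sum)
      fix m assume "m \<in> {..<d}"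
      then have m: "m < d" by simp
      show "(\<lambda>k. \<Sum>p\<le>k. (b p * (N ^\<^sub>m p) $$ (i, m)) * (b (k - p) * (N ^\<^sub>m (k - p)) $$ (m, j)))
        sums (B $$ (i, m) * B $$ (m, j))"
        using Cauchy_product_sums[OF summ[OF ij(1) m] summ[OF m ij(2)]]
          sums_unique[OF Bij[OF ij(1) m]] sums_unique[OF Bij[OF m ij(2)]] by simp
    qed
    also have "(\<lambda>k. \<Sum>m<d. \<Sum>p\<le>k. (b p * (N ^\<^sub>m p) $$ (i, m)) * (b (k - p) * (N ^\<^sub>m (k - p)) $$ (m, j)))
      = (\<lambda>k. (N ^\<^sub>m k) $$ (i, j))"
    proof
      fix k
      have *: "(\<Sum>m<d. (N ^\<^sub>m p) $$ (i, m) * (N ^\<^sub>m (k - p)) $$ (m, j)) = (N ^\<^sub>m k) $$ (i, j)" if "p \<le> k" for p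
        using pow_mat_add[OF N(1), of p "k - p"] that index_mult_mat_sum[OF Nk Nk ij, of p "k - p"] by simp
      have "(\<Sum>m<d. \<Sum>p\<le>k. (b p * (N ^\<^sub>m p) $$ (i, m)) * (b (k - p) * (N ^\<^sub>m (k - p)) $$ (m, j)))
        = (\<Sum>p\<le>k. b p * b (k - p) * (\<Sum>m<d. (N ^\<^sub>m p) $$ (i, m) * (N ^\<^sub>m (k - p)) $$ (m, j)))"
        by (subst sum.swap) (simp add: sum_distrib_left mult_ac)
      also have "\<dots> = (\<Sum>p\<le>k. b p * b (k - p) * (N ^\<^sub>m k) $$ (i, j))"
        by (intro sum.cong) (auto simp: *)
      also have "\<dots> = (N ^\<^sub>m k) $$ (i, j)"
        unfolding sum_distrib_right[symmetric] by (simp add: b_def inv_sqrt_coeff_convolution)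
      finally show "(\<Sum>m<d. \<Sum>p\<le>k. (b p * (N ^\<^sub>m p) $$ (i, m)) * (b (k - p) * (N ^\<^sub>m (k - p)) $$ (m, j)))
        = (N ^\<^sub>m k) $$ (i, j)" .
    qed
    also have "(\<Sum>m<d. B $$ (i, m) * B $$ (m, j)) = (B * B) $$ (i, j)"
      by (rule index_mult_mat_sum[OF B B ij, symmetric])
    finally show ?thesis .
  qed
  have BB: "B * B \<in> carrier_mat d d" using B by simp
  \<comment> \<open>Multiplying the Neumann series by N shifts it by one term, which removes the
    identity.\<close>
  have "(B * B) * N = B * B - 1\<^sub>m d"
  proof (rule eq_matI)
    fix i j assume "i < dim_row (B * B - 1\<^sub>m d)" "j < dim_col (B * B - 1\<^sub>m d)"
    then have ij: "i < d" "j < d" using B by auto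
    have "(\<lambda>k. \<Sum>m<d. (N ^\<^sub>m k) $$ (i, m) * N $$ (m, j)) sums (\<Sum>m<d. (B * B) $$ (i, m) * N $$ (m, j))"
      using ij by (intro sums_sum sums_mult2 prod) auto
    moreover have "(\<Sum>m<d. (N ^\<^sub>m k) $$ (i, m) * N $$ (m, j)) = (N ^\<^sub>m Suc k) $$ (i, j)" for k
      using index_mult_mat_sum[OF Nk N(1) ij, of k] by simp
    moreover have "(\<Sum>m<d. (B * B) $$ (i, m) * N $$ (m, j)) = ((B * B) * N) $$ (i, j)"
      by (rule index_mult_mat_sum[OF BB N(1) ij, symmetric])
    ultimately have "(\<lambda>k. (N ^\<^sub>m Suc k) $$ (i, j)) sums ((B * B) * N) $$ (i, j)" by simp
    then have "(\<lambda>k. (N ^\<^sub>m k) $$ (i, j)) sums (((B * B) * N) $$ (i, j) + (N ^\<^sub>m 0) $$ (i, j))"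
      by (rule sums_Suc[of "\<lambda>k. (N ^\<^sub>m k) $$ (i, j)"])
    then have "((B * B) * N) $$ (i, j) + (N ^\<^sub>m 0) $$ (i, j) = (B * B) $$ (i, j)"
      using prod[OF ij] sums_unique2 by blast
    then show "((B * B) * N) $$ (i, j) = (B * B - 1\<^sub>m d) $$ (i, j)" using N B ij by simp
  qed (use B N in auto)
  then have "(B * B) * ((1 / Lam) \<cdot>\<^sub>m A) = 1\<^sub>m d"
  proof -
    assume e: "(B * B) * N = B * B - 1\<^sub>m d"
    have "(B * B) * N = (B * B) * 1\<^sub>m d - (B * B) * ((1 / Lam) \<cdot>\<^sub>m A)"
      unfolding N_def using BB A by (intro mult_minus_distrib_mat[of _ d d]) auto
    then have "B * B - (B * B) * ((1 / Lam) \<cdot>\<^sub>m A) = B * B - 1\<^sub>m d"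
      unfolding e using right_mult_one_mat[OF BB] by simp
    then have *: "(B * B - (B * B) * ((1 / Lam) \<cdot>\<^sub>m A)) $$ (i, j) = (B * B - 1\<^sub>m d) $$ (i, j)" for i j by simp
    show ?thesis
    proof (rule eq_matI)
      fix i j assume "i < dim_row (1\<^sub>m d :: real mat)" "j < dim_col (1\<^sub>m d :: real mat)"
      then have "i < d" "j < d" by auto
      then show "((B * B) * ((1 / Lam) \<cdot>\<^sub>m A)) $$ (i, j) = 1\<^sub>m d $$ (i, j)"
        using *[of i j] A B by (simp del: index_mult_mat(1))
    qed (use A B in auto)
  qed
  \<comment> \<open>B B inverts A / Lam, so B is rescaled by 1 / sqrt Lam to invert A
    itself.\<close>
  define C where "C = (1 / sqrt Lam) \<cdot>\<^sub>m B"
  have C: "C \<in> carrier_mat d d" using B by (simp add: C_def)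
  have CC: "C * C = (1 / Lam) \<cdot>\<^sub>m (B * B)"
  proof -
    have "C * C = (1 / sqrt Lam) \<cdot>\<^sub>m ((1 / sqrt Lam) \<cdot>\<^sub>m (B * B))"
      unfolding C_def using B by (simp add: mult_smult_assoc_mat[of _ d d] mult_smult_distrib[of _ d d])
    also have "\<dots> = (1 / Lam) \<cdot>\<^sub>m (B * B)"
      using lam by (intro eq_matI) (auto simp del: index_mult_mat(1))
    finally show ?thesis .
  qed
  have "(C * C) * A = (B * B) * ((1 / Lam) \<cdot>\<^sub>m A)"
    unfolding CC using BB A by (simp add: mult_smult_assoc_mat[of _ d d] mult_smult_distrib[of _ d d])
  then have right: "(C * C) * A = 1\<^sub>m d" using \<open>(B * B) * ((1 / Lam) \<cdot>\<^sub>m A) = 1\<^sub>m d\<close> by simp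
  have left: "A * (C * C) = 1\<^sub>m d"
    using mat_mult_left_right_inverse[OF _ A(1) right] C by simp
  have "pos_def d C"
    unfolding pos_def_def
  proof (intro conjI ballI impI)
    show "transpose_mat C = C" unfolding C_def using Bt by (simp add: transpose_mat_smult)
    fix v :: "real vec" assume v: "v \<in> carrier_vec d" "v \<noteq> 0\<^sub>v d"
    have "v \<bullet> (C *\<^sub>v v) = (v \<bullet> (B *\<^sub>v v)) / sqrt Lam"
      unfolding C_def using B v by (simp add: smult_mat_mult_vec[of _ d d])
    moreover have "v \<bullet> (B *\<^sub>v v) > 0" using Bform[OF v(1)] scalar_prod_self_pos[OF v] by linarith
    ultimately show "v \<bullet> (C *\<^sub>v v) > 0" using lam by simp
  qed (rule C)
  then show ?thesis using left right by blast
qed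

text \<open>The extreme eigenvalues enclose the quadratic form, which therefore vanishes;
  Cauchy-Schwarz then makes the bilinear form vanish, and its values on unit vectors are the
  entries.\<close>

lemma symmetric_zero_spectrum_imp_zero:
  fixes D :: "real mat"
  assumes D: "D \<in> carrier_mat d d" "transpose_mat D = D" and d: "d > 0"
    and ev: "\<And>k. eigenvalue D k \<Longrightarrow> k = 0"
  shows "D = 0\<^sub>m d d"
proof -
  have form: "v \<bullet> (D *\<^sub>v v) = 0" if "v \<in> carrier_vec d" for v
    using symmetric_least_eigenvalue[OF D d] symmetric_greatest_eigenvalue[OF D d] ev that
    by (metis mult_zero_left order_antisym)
  have "w \<bullet> (D *\<^sub>v v) = 0" if "v \<in> carrier_vec d" "w \<in> carrier_vec d" for v w
    using psd_cauchy_schwarz[OF D _ that] form that by simp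
  note * = this
  show ?thesis
  proof (rule eq_matI)
    fix i j assume "i < dim_row (0\<^sub>m d d :: real mat)" "j < dim_col (0\<^sub>m d d :: real mat)"
    then have ij: "i < d" "j < d" by auto
    have "D $$ (i, j) = unit_vec d i \<bullet> (D *\<^sub>v unit_vec d j)"
      using D ij by (simp add: scalar_prod_left_unit[of _ d] scalar_prod_right_unit[of _ d])
    then show "D $$ (i, j) = 0\<^sub>m d d $$ (i, j)" using *[of "unit_vec d j" "unit_vec d i"] ij by simp
  qed (use D in auto)
qed

(* An eigenvector v of B - C with eigenvalue k gives 0 = v . (B^2 - C^2) v = k (v . B v + v . C v). *)
lemma pos_def_sqrt_unique:
  assumes B: "pos_def d B" and C: "pos_def d C" and d: "d > 0" and eq: "B * B = C * C"
  shows "B = C"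
proof -
  have Bc: "B \<in> carrier_mat d d" "transpose_mat B = B" and Cc: "C \<in> carrier_mat d d" "transpose_mat C = C"
    using B C by (auto simp: pos_def_def)
  let ?D = "B - C"
  have D: "?D \<in> carrier_mat d d" "transpose_mat ?D = ?D"
    using Bc Cc by (auto simp: transpose_minus[of _ d d])
  have "k = 0" if "eigenvalue ?D k" for k
  proof -
    obtain v where v: "v \<in> carrier_vec d" "v \<noteq> 0\<^sub>v d" "?D *\<^sub>v v = k \<cdot>\<^sub>v v"
      using \<open>eigenvalue ?D k\<close> D unfolding eigenvalue_def eigenvector_def by auto
    let ?Bv = "B *\<^sub>v v" and ?Cv = "C *\<^sub>v v"
    have c: "?Bv \<in> carrier_vec d" "?Cv \<in> carrier_vec d" using Bc Cc v by auto
    have diff: "?Bv - ?Cv = k \<cdot>\<^sub>v v" using v Bc Cc by (simp add: minus_mult_distrib_mat_vec[of _ d d])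
    have BB: "?Bv \<bullet> ?Bv = v \<bullet> ((B * B) *\<^sub>v v)"
      using symmetric_scalar_prod[OF Bc v(1) c(1)] assoc_mult_mat_vec[OF Bc(1) Bc(1) v(1)] by simp
    have CC: "?Cv \<bullet> ?Cv = v \<bullet> ((C * C) *\<^sub>v v)"
      using symmetric_scalar_prod[OF Cc v(1) c(2)] assoc_mult_mat_vec[OF Cc(1) Cc(1) v(1)] by simp
    have "0 = ?Bv \<bullet> ?Bv - ?Cv \<bullet> ?Cv" using BB CC eq by simp
    also have "\<dots> = (?Bv + ?Cv) \<bullet> (?Bv - ?Cv)"
      using c comm_scalar_prod[OF c] by (simp add: scalar_prod_minus_distrib[of _ d] add_scalar_prod_distrib[of _ d])
    also have "\<dots> = k * ((v \<bullet> ?Bv) + (v \<bullet> ?Cv))"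
      unfolding diff using c v(1) comm_scalar_prod[OF c(1) v(1)] comm_scalar_prod[OF c(2) v(1)]
      by (simp add: add_scalar_prod_distrib[of _ d] distrib_left)
    finally have "k * ((v \<bullet> ?Bv) + (v \<bullet> ?Cv)) = 0" by simp
    moreover have "(v \<bullet> ?Bv) + (v \<bullet> ?Cv) > 0" using B C v unfolding pos_def_def by (auto intro: add_pos_pos)
    ultimately show "k = 0" by simp
  qed
  then have D0: "?D = 0\<^sub>m d d" by (rule symmetric_zero_spectrum_imp_zero[OF D d])
  show ?thesis
  proof (rule eq_matI)
    fix i j assume ij: "i < dim_row C" "j < dim_col C"
    have "?D $$ (i, j) = 0" using D0 ij Cc by simp
    then show "B $$ (i, j) = C $$ (i, j)" using ij by simp
  qed (use Bc Cc in auto)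
qed

text \<open>The definite description in \<open>inv_sqrt_mat\<close> is meaningful only once
  existence and uniqueness are both known; this lemma combines them.\<close>

lemma inv_sqrt_mat:
  fixes A :: "real mat"
  assumes A: "A \<in> carrier_mat d d" "transpose_mat A = A" and d: "d > 0"
    and lower: "\<And>v. v \<in> carrier_vec d \<Longrightarrow> lam * (v \<bullet> v) \<le> v \<bullet> (A *\<^sub>v v)"
    and upper: "\<And>v. v \<in> carrier_vec d \<Longrightarrow> v \<bullet> (A *\<^sub>v v) \<le> Lam * (v \<bullet> v)"
    and lam: "0 < lam" "lam \<le> Lam"
  shows "pos_def d (inv_sqrt_mat d A)" "A * (inv_sqrt_mat d A * inv_sqrt_mat d A) = 1\<^sub>m d"
proof -
  let ?P = "\<lambda>B. pos_def d B \<and> inverts_mat A (B * B) \<and> inverts_mat (B * B) A"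
  obtain B where B: "pos_def d B" "A * (B * B) = 1\<^sub>m d" "(B * B) * A = 1\<^sub>m d"
    using inv_sqrt_exists[OF A lower upper lam] by blast
  have PB: "?P B" using B A by (auto simp: inverts_mat_def pos_def_def)
  have uniq: "C = B" if C: "?P C" for C
  proof (rule pos_def_sqrt_unique[OF _ B(1) d])
    have c: "B * B \<in> carrier_mat d d" "C * C \<in> carrier_mat d d" using C B by (auto simp: pos_def_def)
    \<comment> \<open>Inverses are unique, so two candidates have the same square, and the square
      root is unique among positive definite matrices.\<close>
    have "C * C = (C * C) * (A * (B * B))" unfolding B(2) using right_mult_one_mat[OF c(2)] by simp
    also have "\<dots> = ((C * C) * A) * (B * B)" using c A by (simp add: assoc_mult_mat[of _ d d _ d _ d])
    also have "(C * C) * A = 1\<^sub>m d" using C carrier_matD(1)[OF c(2)] by (simp add: inverts_mat_def)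
    finally show "C * C = B * B" using left_mult_one_mat[OF c(1)] by simp
  qed (use C in simp)
  have "?P (inv_sqrt_mat d A)"
    unfolding inv_sqrt_mat_def using PB uniq by (rule theI)
  then show "pos_def d (inv_sqrt_mat d A)" "A * (inv_sqrt_mat d A * inv_sqrt_mat d A) = 1\<^sub>m d"
    using A by (auto simp: inverts_mat_def)
qed

text \<open>This turns moment bounds for A^(-1/2) X into moment bounds for X. The vector w is
  A^(1/2) u, written as A A^(-1/2) u so that only the root already at hand occurs; its squared norm
  is u . A u.\<close>

lemma inv_sqrt_mat_preimage:
  fixes A :: "real mat"
  assumes A: "A \<in> carrier_mat d d" "transpose_mat A = A" and d: "d > 0"
    and lower: "\<And>v. v \<in> carrier_vec d \<Longrightarrow> lam * (v \<bullet> v) \<le> v \<bullet> (A *\<^sub>v v)"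
    and upper: "\<And>v. v \<in> carrier_vec d \<Longrightarrow> v \<bullet> (A *\<^sub>v v) \<le> Lam * (v \<bullet> v)"
    and lam: "0 < lam" "lam \<le> Lam"
    and u: "u \<in> carrier_vec d"
  shows "\<exists>w\<in>carrier_vec d. w \<bullet> w \<le> Lam * (u \<bullet> u) \<and>
    (\<forall>x\<in>carrier_vec d. w \<bullet> (inv_sqrt_mat d A *\<^sub>v x) = u \<bullet> x)"
proof -
  define B where "B = inv_sqrt_mat d A"
  have "pos_def d B" and ABB: "A * (B * B) = 1\<^sub>m d"
    using inv_sqrt_mat[OF A d lower upper lam] by (auto simp: B_def)
  then have B: "B \<in> carrier_mat d d" "transpose_mat B = B" by (auto simp: pos_def_def)
  have AB: "A * B \<in> carrier_mat d d" using A B by simp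
  have "(A * B) * B = 1\<^sub>m d" using ABB A B by (simp add: assoc_mult_mat[of _ d d _ d _ d])
  then have inv: "B * (A * B) = 1\<^sub>m d" by (rule mat_mult_left_right_inverse[OF AB B(1)])
  define w where "w = (A * B) *\<^sub>v u"
  have w: "w \<in> carrier_vec d" unfolding w_def by (rule mult_mat_vec_carrier[OF AB u])
  have Bw: "B *\<^sub>v w = u"
    unfolding w_def using assoc_mult_mat_vec[OF B(1) AB u] inv u by simp
  have Au: "A *\<^sub>v u \<in> carrier_vec d" using A u by simp
  have BAu: "B *\<^sub>v (A *\<^sub>v u) = w"
  proof -
    have "B *\<^sub>v (A *\<^sub>v u) = B *\<^sub>v (A *\<^sub>v (B *\<^sub>v w))" unfolding Bw ..
    also have "\<dots> = (B * (A * B)) *\<^sub>v w"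
      using assoc_mult_mat_vec[OF B(1) AB w] assoc_mult_mat_vec[OF A(1) B(1) w] by simp
    finally show ?thesis using inv w by simp
  qed
  have "w \<bullet> w = w \<bullet> (B *\<^sub>v (A *\<^sub>v u))" unfolding BAu ..
  also have "\<dots> = u \<bullet> (A *\<^sub>v u)" using symmetric_scalar_prod[OF B w Au] Bw by simp
  also have "\<dots> \<le> Lam * (u \<bullet> u)" by (rule upper[OF u])
  finally have "w \<bullet> w \<le> Lam * (u \<bullet> u)" .
  moreover have "w \<bullet> (B *\<^sub>v x) = u \<bullet> x" if "x \<in> carrier_vec d" for x
    using symmetric_scalar_prod[OF B w that] Bw by simp
  ultimately show ?thesis using w unfolding B_def by blast
qed

section \<open>A Fuk--Nagaev inequality for vectors\<close>

lemma exp_le_quadratic: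
  fixes w :: real
  assumes "w \<le> 1"
  shows "exp w \<le> 1 + w + w\<^sup>2"
proof (cases "w \<ge> 0")
  case True
  then show ?thesis using exp_bound assms by simp
next
  case False
  have "exp w = 1 / exp (- w)" by (simp add: exp_minus field_simps)
  also have "\<dots> \<le> 1 / (1 - w)" using False exp_ge_add_one_self[of "- w"] by (intro divide_left_mono) auto
  also have "\<dots> \<le> 1 + w + w\<^sup>2"
  proof -
    have "(1 + w + w\<^sup>2) * (1 - w) = 1 + w\<^sup>2 * (- w)" by (simp add: algebra_simps power2_eq_square)
    also have "\<dots> \<ge> 1" using False by (simp add: mult_nonneg_nonpos)
    finally show ?thesis using False by (simp add: pos_divide_le_eq)
  qed
  finally show ?thesis .
qed

text \<open>For t <= 1/2 the exponent is below 1 and a second-order expansion holds. For larger t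
  the exponent is at most 3 t / 2 <= L / 2, while \<open>(2 * t) powr q\<close> is at least 1. Big
  increments are thus charged to the q-th moment, at the price \<open>exp (L / 2)\<close>.\<close>

lemma exp_le_quadratic_plus_power:
  fixes x y t L q :: real
  assumes x: "\<bar>x\<bar> \<le> t" and y: "0 \<le> y" "y \<le> t / 2" and t: "t \<le> L / 4" and q: "q \<ge> 0"
  shows "exp (x + y) \<le> 1 + x + 2 * x\<^sup>2 + 2 * y + exp (L / 2) * (2 * t) powr q"
proof (cases "t \<le> 1 / 2")
  case True
  have "exp (x + y) \<le> 1 + (x + y) + (x + y)\<^sup>2" using True x y by (intro exp_le_quadratic) linarith
  also have "(x + y)\<^sup>2 \<le> 2 * x\<^sup>2 + 2 * y\<^sup>2"
    using sum_squares_bound[of x y] by (simp add: power2_sum)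
  also have "y\<^sup>2 \<le> y / 4" using y True mult_left_mono[of y "1/4" y] by (simp add: power2_eq_square)
  finally have "exp (x + y) \<le> 1 + x + 2 * x\<^sup>2 + 2 * y" using y by simp
  moreover have "0 \<le> exp (L / 2) * (2 * t) powr q" by simp
  ultimately show ?thesis by linarith
next
  case False
  have "exp (x + y) \<le> exp (L / 2)" using x y t False by (subst exp_le_cancel_iff) linarith
  also have "\<dots> \<le> exp (L / 2) * (2 * t) powr q" using False q by (simp add: ge_one_powr_ge_zero)
  finally have "exp (x + y) \<le> exp (L / 2) * (2 * t) powr q" .
  moreover have "0 \<le> 1 + x + 2 * x\<^sup>2"
    using zero_le_power2[of "x + 1 / 4"] by (simp add: power2_eq_square algebra_simps)
  ultimately show ?thesis using y by linarith
qed

lemma sqrt_le_linearization: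
  fixes A b :: real
  assumes "A > 0" "A\<^sup>2 + b \<ge> 0"
  shows "sqrt (A\<^sup>2 + b) \<le> A + b / (2 * A)"
proof (rule real_le_lsqrt)
  have "A + b / (2 * A) = (A\<^sup>2 + (A\<^sup>2 + b)) / (2 * A)" using assms by (simp add: field_simps power2_eq_square)
  also have "\<dots> \<ge> 0" using assms zero_le_power2[of A] by (intro divide_nonneg_pos) linarith+
  finally show "0 \<le> A + b / (2 * A)" .
  have "(A + b / (2 * A))\<^sup>2 = A\<^sup>2 + b + (b / (2 * A))\<^sup>2"
    using assms by (simp add: power2_sum)
  then show "A\<^sup>2 + b \<le> (A + b / (2 * A))\<^sup>2" by simp
qed

lemma square_powr_half: "((x :: real)\<^sup>2) powr (q / 2) = \<bar>x\<bar> powr q"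
proof -
  have "x\<^sup>2 = \<bar>x\<bar> powr 2" by (simp add: powr_numeral)
  then show ?thesis by (simp only: powr_powr) simp
qed

text \<open>Young's inequality x a^(p-1) <= x^p / p + (1 - 1/p) a^p, with a the average of the x j,
  sums up to d a^p <= sum of the x j^p.\<close>

lemma power_mean_ineq:
  fixes x :: "nat \<Rightarrow> real"
  assumes x: "\<And>j. j < d \<Longrightarrow> x j \<ge> 0" and p: "p > 1" and d: "d > 0"
  shows "(\<Sum>j<d. x j) powr p \<le> real d powr (p - 1) * (\<Sum>j<d. x j powr p)"
proof -
  define a where "a = (\<Sum>j<d. x j) / real d"
  have a: "a \<ge> 0" using x by (auto simp: a_def intro!: divide_nonneg_nonneg sum_nonneg)
  have da: "(\<Sum>j<d. x j) = real d * a" using d by (simp add: a_def)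
  have young: "x j * a powr (p - 1) \<le> x j powr p / p + a powr p * (1 - 1 / p)" if "j < d" for j
  proof -
    have "x j * a powr (p - 1) \<le> x j powr p / p + (a powr (p - 1)) powr (p / (p - 1)) / (p / (p - 1))"
      using x[OF that] p by (intro Youngs_inequality) (auto simp: field_simps)
    also have "(a powr (p - 1)) powr (p / (p - 1)) = a powr p" using p by (simp add: powr_powr)
    finally show ?thesis using p by (simp add: field_simps)
  qed
  have "real d * a powr p = (\<Sum>j<d. x j) * a powr (p - 1)"
    unfolding da using a p by (cases "a = 0") (auto simp: powr_diff)
  also have "\<dots> = (\<Sum>j<d. x j * a powr (p - 1))" by (simp add: sum_distrib_right)
  also have "\<dots> \<le> (\<Sum>j<d. x j powr p / p + a powr p * (1 - 1 / p))" using young by (intro sum_mono) auto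
  also have "\<dots> = (\<Sum>j<d. x j powr p) / p + real d * a powr p * (1 - 1 / p)"
    by (simp add: sum.distrib sum_divide_distrib)
  finally have "real d * a powr p \<le> (\<Sum>j<d. x j powr p)"
    using p by (simp add: field_simps)
  then have "real d powr (p - 1) * (real d * a powr p) \<le> real d powr (p - 1) * (\<Sum>j<d. x j powr p)"
    by (intro mult_left_mono) auto
  moreover have "real d powr (p - 1) * (real d * a powr p) = (real d * a) powr p"
    using d a by (simp add: powr_mult powr_diff)
  ultimately show ?thesis unfolding da by simp
qed

text \<open>The locale is used twice: for the covariates with exponent \<open>qx\<close>, and for
  the noise vectors X (Y - l'(X . \<theta>0)) with exponent \<open>qxy\<close>. The bound K is on
  the q-th moment itself, not on its root. Directions range over the unit ball rather than the
  sphere, so that \<open>s / A\<close> with |s| <= A is admissible in the potential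
  argument.\<close>

locale weak_moments = prob_space P for P :: "'b measure" +
  fixes d :: nat and z :: "'b \<Rightarrow> nat \<Rightarrow> real" and q K :: real
  assumes d: "d > 0" and q: "q > 2" and K: "K \<ge> 1"
    and z_measurable [measurable]: "\<And>j. j < d \<Longrightarrow> (\<lambda>p. z p j) \<in> borel_measurable P"
    and moment_integrable: "\<And>u. (\<Sum>j<d. (u j)\<^sup>2) \<le> 1 \<Longrightarrow> integrable P (\<lambda>p. \<bar>\<Sum>j<d. u j * z p j\<bar> powr q)"
    and moment_le: "\<And>u. (\<Sum>j<d. (u j)\<^sup>2) \<le> 1 \<Longrightarrow> (\<integral>p. \<bar>\<Sum>j<d. u j * z p j\<bar> powr q \<partial>P) \<le> K"
begin

definition sqn :: "'b \<Rightarrow> real" where "sqn p = (\<Sum>j<d. (z p j)\<^sup>2)"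

lemma sqn_nonneg: "sqn p \<ge> 0" by (simp add: sqn_def sum_nonneg)

lemma sqn_measurable [measurable]: "sqn \<in> borel_measurable P"
  unfolding sqn_def by measurable

lemma
  assumes u: "(\<Sum>j<d. (u j)\<^sup>2) \<le> 1"
  shows square_integrable: "integrable P (\<lambda>p. (\<Sum>j<d. u j * z p j)\<^sup>2)"
    and square_le: "(\<integral>p. (\<Sum>j<d. u j * z p j)\<^sup>2 \<partial>P) \<le> 1 + K"
proof -
  have le: "a\<^sup>2 \<le> 1 + \<bar>a\<bar> powr q" for a :: real
  proof (cases "\<bar>a\<bar> \<le> 1")
    case True
    then have "a\<^sup>2 \<le> 1" by (simp add: abs_square_le_1)
    then show ?thesis by (simp add: add_increasing2)
  next
    case False
    have "a\<^sup>2 = \<bar>a\<bar> powr 2" using False by (simp add: powr_numeral)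
    also have "\<dots> \<le> \<bar>a\<bar> powr q" using False q by (intro powr_mono) auto
    finally show ?thesis by simp
  qed
  have int: "integrable P (\<lambda>p. 1 + \<bar>\<Sum>j<d. u j * z p j\<bar> powr q)" using moment_integrable[OF u] by simp
  show I: "integrable P (\<lambda>p. (\<Sum>j<d. u j * z p j)\<^sup>2)"
    by (rule Bochner_Integration.integrable_bound[OF int]) (use le in \<open>auto intro!: AE_I2\<close>)
  have "(\<integral>p. (\<Sum>j<d. u j * z p j)\<^sup>2 \<partial>P) \<le> (\<integral>p. 1 + \<bar>\<Sum>j<d. u j * z p j\<bar> powr q \<partial>P)"
    by (intro integral_mono I int le)
  also have "\<dots> = 1 + (\<integral>p. \<bar>\<Sum>j<d. u j * z p j\<bar> powr q \<partial>P)"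
    using moment_integrable[OF u] by (simp add: prob_space)
  finally show "(\<integral>p. (\<Sum>j<d. u j * z p j)\<^sup>2 \<partial>P) \<le> 1 + K" using moment_le[OF u] by linarith
qed

lemma coordinate_form:
  assumes "i < d"
  shows "(\<Sum>j<d. (if j = i then 1 else 0) * z p j) = z p i"
    "(\<Sum>j<d. (if j = i then 1 else 0 :: real)\<^sup>2) \<le> 1"
  using assms by (simp_all add: if_distrib if_distribR cong: if_cong)

lemma coordinate_integrable: "i < d \<Longrightarrow> integrable P (\<lambda>p. z p i)"
proof (rule Bochner_Integration.integrable_bound)
  assume i: "i < d"
  show "integrable P (\<lambda>p. 1 + (z p i)\<^sup>2)"
    using square_integrable[OF coordinate_form(2)[OF i]] coordinate_form(1)[OF i] by simp
  show "AE p in P. norm (z p i) \<le> norm (1 + (z p i)\<^sup>2)"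
  proof (rule AE_I2)
    fix p
    have "\<bar>z p i\<bar> \<le> 1 + (z p i)\<^sup>2" using sum_squares_bound[of 1 "\<bar>z p i\<bar>"] by simp
    then show "norm (z p i) \<le> norm (1 + (z p i)\<^sup>2)" by simp
  qed
qed (use z_measurable in simp)

lemma sqn_integrable: "integrable P sqn" and sqn_le: "(\<integral>p. sqn p \<partial>P) \<le> d * (1 + K)"
proof -
  have 1: "integrable P (\<lambda>p. (z p i)\<^sup>2)" "(\<integral>p. (z p i)\<^sup>2 \<partial>P) \<le> 1 + K" if "i < d" for i
    using square_integrable[OF coordinate_form(2)[OF that]] square_le[OF coordinate_form(2)[OF that]]
      coordinate_form(1)[OF that] by simp_all
  show "integrable P sqn" unfolding sqn_def using 1 by (intro Bochner_Integration.integrable_sum) auto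
  have "(\<integral>p. sqn p \<partial>P) = (\<Sum>j<d. \<integral>p. (z p j)\<^sup>2 \<partial>P)"
    unfolding sqn_def using 1 by (intro Bochner_Integration.integral_sum) auto
  also have "\<dots> \<le> (\<Sum>j<d. 1 + K)" using 1 by (intro sum_mono) auto
  finally show "(\<integral>p. sqn p \<partial>P) \<le> d * (1 + K)" by simp
qed

text \<open>The power mean over the d coordinates turns weak moments into a moment of the norm; the
  factor d^(q/2) is the source of sqrt d in the polynomial term of the rate.\<close>

lemma norm_moment_integrable: "integrable P (\<lambda>p. sqn p powr (q / 2))"
  and norm_moment_le: "(\<integral>p. sqn p powr (q / 2) \<partial>P) \<le> real d powr (q / 2) * K"
proof -
  have 1: "integrable P (\<lambda>p. \<bar>z p i\<bar> powr q)" "(\<integral>p. \<bar>z p i\<bar> powr q \<partial>P) \<le> K" if "i < d" for i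
    using moment_integrable[OF coordinate_form(2)[OF that]] moment_le[OF coordinate_form(2)[OF that]]
      coordinate_form(1)[OF that] by simp_all
  have pw: "sqn p powr (q / 2) \<le> real d powr (q / 2 - 1) * (\<Sum>j<d. \<bar>z p j\<bar> powr q)" for p
    unfolding sqn_def using power_mean_ineq[of d "\<lambda>j. (z p j)\<^sup>2" "q / 2"] q d by (simp add: square_powr_half)
  have sum1: "integrable P (\<lambda>p. \<Sum>j<d. \<bar>z p j\<bar> powr q)"
    using 1 by (intro Bochner_Integration.integrable_sum) auto
  have int: "integrable P (\<lambda>p. real d powr (q / 2 - 1) * (\<Sum>j<d. \<bar>z p j\<bar> powr q))"
    using sum1 by (rule integrable_mult_right)
  show I: "integrable P (\<lambda>p. sqn p powr (q / 2))"
    by (rule Bochner_Integration.integrable_bound[OF int]) (use pw in \<open>auto intro!: AE_I2 order_trans[OF _ abs_ge_self]\<close>)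
  have "(\<integral>p. sqn p powr (q / 2) \<partial>P) \<le> (\<integral>p. real d powr (q / 2 - 1) * (\<Sum>j<d. \<bar>z p j\<bar> powr q) \<partial>P)"
    by (intro integral_mono I int pw)
  also have "\<dots> = real d powr (q / 2 - 1) * (\<integral>p. (\<Sum>j<d. \<bar>z p j\<bar> powr q) \<partial>P)"
    using sum1 by simp
  also have "(\<integral>p. (\<Sum>j<d. \<bar>z p j\<bar> powr q) \<partial>P) = (\<Sum>j<d. \<integral>p. \<bar>z p j\<bar> powr q \<partial>P)"
    using 1 by (intro Bochner_Integration.integral_sum) auto
  also have "real d powr (q / 2 - 1) * (\<Sum>j<d. \<integral>p. \<bar>z p j\<bar> powr q \<partial>P) \<le> real d powr (q / 2 - 1) * (\<Sum>j<d. K)" using 1 by (intro mult_left_mono sum_mono) auto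
  also have "\<dots> = real d powr (q / 2) * K" using d by (simp add: powr_diff)
  finally show "(\<integral>p. sqn p powr (q / 2) \<partial>P) \<le> real d powr (q / 2) * K" .
qed

lemma norm_tail:
  assumes T: "T > 0"
  shows "measure P {p \<in> space P. T\<^sup>2 < sqn p} \<le> real d powr (q / 2) * K / T powr q"
proof -
  have T2: "(T\<^sup>2) powr (q / 2) = T powr q"
    using T by (simp add: square_powr_half)
  have "measure P {p \<in> space P. T\<^sup>2 < sqn p} \<le> measure P {p \<in> space P. T powr q \<le> sqn p powr (q / 2)}"
    unfolding T2[symmetric] using q by (intro finite_measure_mono) (auto intro!: powr_mono2)
  also have "\<dots> \<le> (\<integral>p. sqn p powr (q / 2) \<partial>P) / T powr q"
    using T by (intro integral_Markov_inequality_measure[where A = "{}"] norm_moment_integrable) auto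
  also have "\<dots> \<le> real d powr (q / 2) * K / T powr q"
    using norm_moment_le by (intro divide_right_mono) auto
  finally show ?thesis .
qed

end

locale centered_weak_moments = weak_moments P d z q K for P :: "'b measure" and d z q K +
  assumes centered: "\<And>j. j < d \<Longrightarrow> (\<integral>p. z p j \<partial>P) = 0"
begin

text \<open>A long vector is replaced by 0 rather than shortened. The truncated vector is no longer
  centered, and the resulting bias has to be absorbed by the drift.\<close>

definition trunc :: "real \<Rightarrow> 'b \<Rightarrow> nat \<Rightarrow> real" where
  "trunc T p j = (if sqn p \<le> T\<^sup>2 then z p j else 0)"

lemma trunc_measurable [measurable]: "j < d \<Longrightarrow> (\<lambda>p. trunc T p j) \<in> borel_measurable P"
  unfolding trunc_def by measurable

text \<open>The growth of the logarithm of the potential per observation. The four terms come from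
  the truncation bias, the variance in the direction of s, the trace of the covariance divided by R,
  and the large increments. The argument m enters through the bound 1 / m on the probability of
  truncation.\<close>

definition drift :: "real \<Rightarrow> real \<Rightarrow> real \<Rightarrow> real \<Rightarrow> real" where
  "drift m L R lam = lam * (2 + K) / (2 * sqrt m) + 2 * lam\<^sup>2 * (1 + K) + lam * d * (1 + K) / R
     + exp (L / 2) * (2 * lam) powr q * (real d powr (q / 2) * K)"

(* The potential exp (lam sqrt (R^2 + |s|^2)) has curvature lam^2 in the direction of s but only
   lam / R in the orthogonal directions, so that the full trace of the covariance is divided by R. *)
lemma potential_step:
  assumes T: "0 < T" "T \<le> R" and lam: "0 < lam" "lam * T \<le> L / 4"
    and m: "m > 0" "measure P {p \<in> space P. T\<^sup>2 < sqn p} \<le> 1 / m"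
  shows "(\<integral>\<^sup>+p. ennreal (exp (lam * sqrt (R\<^sup>2 + (\<Sum>j<d. (s j + trunc T p j)\<^sup>2)))) \<partial>P)
    \<le> ennreal (exp (lam * sqrt (R\<^sup>2 + (\<Sum>j<d. (s j)\<^sup>2))) * exp (drift m L R lam))"
proof -
  define A where "A = sqrt (R\<^sup>2 + (\<Sum>j<d. (s j)\<^sup>2))"
  have A2: "A\<^sup>2 = R\<^sup>2 + (\<Sum>j<d. (s j)\<^sup>2)" by (simp add: A_def sum_nonneg)
  have R: "R > 0" using T by simp
  have RA: "R \<le> A" unfolding A_def by (intro real_le_rsqrt) (simp add: sum_nonneg)
  have A: "A > 0" using R RA by simp
  define u where "u = (\<lambda>j. s j / A)"
  have u: "(\<Sum>j<d. (u j)\<^sup>2) \<le> 1"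
  proof -
    have "(\<Sum>j<d. (u j)\<^sup>2) = (\<Sum>j<d. (s j)\<^sup>2) / A\<^sup>2" by (simp add: u_def power_divide sum_divide_distrib)
    also have "\<dots> \<le> 1"
    proof -
      have "(\<Sum>j<d. (s j)\<^sup>2) \<le> A\<^sup>2" using A2 zero_le_power2[of R] by linarith
      then show ?thesis using A by (simp add: divide_le_eq_1)
    qed
    finally show ?thesis .
  qed
  define f where "f = (\<lambda>p. \<Sum>j<d. u j * z p j)"
  have f_le: "(f p)\<^sup>2 \<le> sqn p" for p
  proof -
    have "(f p)\<^sup>2 \<le> (\<Sum>j<d. (u j)\<^sup>2) * sqn p"
      unfolding f_def sqn_def by (rule Cauchy_Schwarz_ineq_sum)
    also have "\<dots> \<le> 1 * sqn p" using u by (intro mult_right_mono sqn_nonneg)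
    finally show ?thesis by simp
  qed
  let ?big = "{p \<in> space P. T\<^sup>2 < sqn p}"
  \<comment> \<open>\<open>G\<close> contains the linear form \<open>f\<close> without truncation,
    so that centering annihilates its mean. The price is paid on \<open>?big\<close>, where the
    potential does not move although \<open>f\<close> may be very negative: there the
    arithmetic-geometric mean bound |f| <= (f^2 / sqrt m + sqrt m) / 2 restores
    \<open>1 \<le> G p\<close>. The expectation of this compensation is of order lam / sqrt m, since
    \<open>?big\<close> has probability at most 1 / m.\<close>
  define G where "G = (\<lambda>p. 1 + lam * f p + lam / 2 * ((f p)\<^sup>2 / sqrt m + sqrt m * indicator ?big p)
      + 2 * lam\<^sup>2 * (f p)\<^sup>2 + lam / R * sqn p + exp (L / 2) * (2 * lam) powr q * sqn p powr (q / 2))"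
  have amgm: "2 * \<bar>a\<bar> \<le> a\<^sup>2 / sqrt m + sqrt m" for a :: real
  proof -
    have "0 \<le> (\<bar>a\<bar> - sqrt m)\<^sup>2 / sqrt m" using m by simp
    also have "\<dots> = a\<^sup>2 / sqrt m + sqrt m - 2 * \<bar>a\<bar>"
      using m by (simp add: power2_diff diff_divide_distrib add_divide_distrib real_div_sqrt)
    finally show ?thesis by simp
  qed
  have pw: "exp (lam * sqrt (R\<^sup>2 + (\<Sum>j<d. (s j + trunc T p j)\<^sup>2))) \<le> exp (lam * A) * G p"
    if p: "p \<in> space P" for p
  proof (cases "sqn p \<le> T\<^sup>2")
    case False
    then have "p \<in> ?big" using p by simp
    moreover have "0 \<le> lam * f p + lam / 2 * ((f p)\<^sup>2 / sqrt m + sqrt m)"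
    proof -
      have "0 \<le> lam * (f p + ((f p)\<^sup>2 / sqrt m + sqrt m) / 2)"
        using amgm[of "f p"] abs_ge_minus_self[of "f p"] lam by (intro mult_nonneg_nonneg) (simp_all add: field_simps)
      moreover have "lam * (a + b / 2) = lam * a + lam / 2 * b" for a b by (simp add: distrib_left)
      ultimately show ?thesis by simp
    qed
    moreover have "0 \<le> 2 * lam\<^sup>2 * (f p)\<^sup>2 + lam / R * sqn p + exp (L / 2) * (2 * lam) powr q * sqn p powr (q / 2)"
      using lam R sqn_nonneg[of p] by (intro add_nonneg_nonneg) auto
    ultimately have "1 \<le> G p" unfolding G_def by simp
    then have "exp (lam * A) * 1 \<le> exp (lam * A) * G p" by (intro mult_left_mono) auto
    then show ?thesis using False by (simp add: trunc_def A_def)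
  next
    case True
    then have tr: "trunc T p j = z p j" for j by (simp add: trunc_def)
    have sum_eq: "R\<^sup>2 + (\<Sum>j<d. (s j + trunc T p j)\<^sup>2) = A\<^sup>2 + (2 * A * f p + sqn p)"
    proof -
      have "(\<Sum>j<d. (s j + z p j)\<^sup>2) = (\<Sum>j<d. (s j)\<^sup>2) + 2 * (\<Sum>j<d. s j * z p j) + sqn p"
        by (simp add: sqn_def power2_sum sum.distrib sum_distrib_left mult.assoc)
      moreover have "(\<Sum>j<d. s j * z p j) = A * f p"
        using A by (simp add: f_def u_def sum_distrib_left)
      ultimately show ?thesis using A2 tr by simp
    qed
    have "sqrt (R\<^sup>2 + (\<Sum>j<d. (s j + trunc T p j)\<^sup>2)) \<le> A + (2 * A * f p + sqn p) / (2 * A)"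
      unfolding sum_eq by (rule sqrt_le_linearization[OF A]) (simp add: sum_eq[symmetric] sum_nonneg)
    also have "\<dots> = A + (f p + sqn p / (2 * A))" using A by (simp add: field_simps)
    finally have "lam * sqrt (R\<^sup>2 + (\<Sum>j<d. (s j + trunc T p j)\<^sup>2)) \<le> lam * (A + (f p + sqn p / (2 * A)))"
      using lam by (intro mult_left_mono) auto
    then have e1: "exp (lam * sqrt (R\<^sup>2 + (\<Sum>j<d. (s j + trunc T p j)\<^sup>2)))
        \<le> exp (lam * A) * exp (lam * f p + lam * sqn p / (2 * A))"
      by (simp add: exp_add[symmetric] algebra_simps)
    define t where "t = lam * sqrt (sqn p)"
    have sT: "sqrt (sqn p) \<le> T" using True T by (simp add: real_le_lsqrt sqn_nonneg)
    \<comment> \<open>With t = lam |z|, the linear part is at most t by Cauchy-Schwarz, and the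
      quadratic part is at most t / 2 because |z| <= T <= R <= A.\<close>
    have "exp (lam * f p + lam * sqn p / (2 * A)) \<le> 1 + lam * f p + 2 * (lam * f p)\<^sup>2
        + 2 * (lam * sqn p / (2 * A)) + exp (L / 2) * (2 * t) powr q"
    proof (rule exp_le_quadratic_plus_power)
      have "\<bar>f p\<bar> \<le> sqrt (sqn p)" using f_le[of p] by (intro real_le_rsqrt) simp
      then show "\<bar>lam * f p\<bar> \<le> t" unfolding t_def abs_mult using lam by (intro mult_mono) auto
      show "0 \<le> lam * sqn p / (2 * A)" using lam A sqn_nonneg[of p] by simp
      have "sqn p = sqrt (sqn p) * sqrt (sqn p)" using sqn_nonneg[of p] by simp
      also have "\<dots> \<le> sqrt (sqn p) * A" using sT T RA by (intro mult_left_mono) (auto simp: sqn_nonneg)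
      finally have "lam * sqn p \<le> t * A" unfolding t_def using lam by (simp add: mult.assoc)
      then show "lam * sqn p / (2 * A) \<le> t / 2" using A by (simp add: field_simps)
      show "t \<le> L / 4" unfolding t_def using sT lam mult_left_mono[OF sT, of lam] by linarith
    qed (use q in simp)
    also have "(2 * t) powr q = (2 * lam) powr q * sqn p powr (q / 2)"
      unfolding t_def using lam sqn_nonneg[of p] by (simp add: powr_mult powr_powr powr_half_sqrt[symmetric])
    also have "2 * (lam * sqn p / (2 * A)) \<le> lam / R * sqn p"
      using lam A R RA sqn_nonneg[of p] by (simp add: frac_le)
    finally have e2: "exp (lam * f p + lam * sqn p / (2 * A)) \<le> 1 + lam * f p + 2 * (lam * f p)\<^sup>2
        + lam / R * sqn p + exp (L / 2) * ((2 * lam) powr q * sqn p powr (q / 2))" by simp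
    have "0 \<le> lam / 2 * ((f p)\<^sup>2 / sqrt m + sqrt m * indicator ?big p)" using lam m by simp
    then have "exp (lam * f p + lam * sqn p / (2 * A)) \<le> G p"
      using e2 unfolding G_def power_mult_distrib mult.assoc by linarith
    then have "exp (lam * A) * exp (lam * f p + lam * sqn p / (2 * A)) \<le> exp (lam * A) * G p"
      by (intro mult_left_mono) auto
    then show ?thesis using e1 by linarith
  qed
  have big: "?big \<in> sets P" by measurable
  have f2: "integrable P (\<lambda>p. (f p)\<^sup>2)" "(\<integral>p. (f p)\<^sup>2 \<partial>P) \<le> 1 + K"
    unfolding f_def using square_integrable[OF u] square_le[OF u] by auto
  have f1: "integrable P f" "(\<integral>p. f p \<partial>P) = 0"
    unfolding f_def using coordinate_integrable centered by auto
  have ind: "integrable P (indicator ?big :: _ \<Rightarrow> real)" using big by (simp add: emeasure_eq_measure)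
  have G_int: "integrable P G" unfolding G_def
    using f1 f2 ind sqn_integrable norm_moment_integrable by auto
  have G_integral: "(\<integral>p. G p \<partial>P) = 1 + lam / 2 * ((\<integral>p. (f p)\<^sup>2 \<partial>P) / sqrt m + sqrt m * measure P ?big)
      + 2 * lam\<^sup>2 * (\<integral>p. (f p)\<^sup>2 \<partial>P) + lam / R * (\<integral>p. sqn p \<partial>P)
      + exp (L / 2) * (2 * lam) powr q * (\<integral>p. sqn p powr (q / 2) \<partial>P)"
    unfolding G_def using f1 f2 ind sqn_integrable norm_moment_integrable big
    by (simp add: prob_space)
  have mt: "sqrt m * measure P ?big \<le> 1 / sqrt m"
  proof -
    have "sqrt m * measure P ?big \<le> sqrt m * (1 / m)" using m by (intro mult_left_mono) auto
    also have "\<dots> = 1 / sqrt m" using m by (simp add: real_sqrt_divide[symmetric] field_simps)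
    finally show ?thesis .
  qed
  have "(\<integral>p. G p \<partial>P) \<le> 1 + lam / 2 * ((1 + K) / sqrt m + 1 / sqrt m)
      + 2 * lam\<^sup>2 * (1 + K) + lam / R * (d * (1 + K))
      + exp (L / 2) * (2 * lam) powr q * (real d powr (q / 2) * K)"
    unfolding G_integral using f2 sqn_le norm_moment_le mt lam R m
    by (intro add_mono mult_left_mono divide_right_mono order_refl) auto
  also have "\<dots> = 1 + drift m L R lam"
  proof -
    have "lam / 2 * ((1 + K) / sqrt m + 1 / sqrt m) = lam * (2 + K) / (2 * sqrt m)"
      using m by (simp add: field_simps)
    moreover have "lam / R * (d * (1 + K)) = lam * d * (1 + K) / R" by simp
    ultimately show ?thesis unfolding drift_def by linarith
  qed
  also have "\<dots> \<le> exp (drift m L R lam)" by (rule exp_ge_add_one_self)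
  finally have G_le: "(\<integral>p. G p \<partial>P) \<le> exp (drift m L R lam)" .
  have "(\<integral>\<^sup>+p. ennreal (exp (lam * sqrt (R\<^sup>2 + (\<Sum>j<d. (s j + trunc T p j)\<^sup>2)))) \<partial>P)
      \<le> (\<integral>\<^sup>+p. ennreal (exp (lam * A) * G p) \<partial>P)"
    using pw by (intro nn_integral_mono ennreal_leI) auto
  also have "\<dots> = ennreal (\<integral>p. exp (lam * A) * G p \<partial>P)"
    using G_int pw by (intro nn_integral_eq_integral) (auto intro!: AE_I2 order_trans[OF exp_ge_zero])
  also have "\<dots> \<le> ennreal (exp (lam * A) * exp (drift m L R lam))"
    using G_le by (intro ennreal_leI) simp
  finally show ?thesis unfolding A_def .
qed

text \<open>Fubini with one observation integrated out at a time: \<open>potential_step\<close> is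
  uniform in the partial sum s of the others. The empty sum has potential exp (lam R).\<close>

lemma potential_bound:
  assumes T: "0 < T" "T \<le> R" and lam: "0 < lam" "lam * T \<le> L / 4"
    and m: "m > 0" "measure P {p \<in> space P. T\<^sup>2 < sqn p} \<le> 1 / m" and I: "finite (I :: 'i set)"
  shows "(\<integral>\<^sup>+x. ennreal (exp (lam * sqrt (R\<^sup>2 + (\<Sum>j<d. (\<Sum>i\<in>I. trunc T (x i) j)\<^sup>2)))) \<partial>PiM I (\<lambda>_. P))
    \<le> ennreal (exp (lam * R + card I * drift m L R lam))"
  using I
proof (induction I)
  case empty
  interpret E: prob_space "PiM {} (\<lambda>_::'i. P)" by (intro prob_space_PiM) unfold_locales
  show ?case using T by (simp add: E.emeasure_space_1)
next
  case (insert i I)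
  interpret product_sigma_finite "\<lambda>_::'i. P" by unfold_locales
  let ?F = "\<lambda>I x. ennreal (exp (lam * sqrt (R\<^sup>2 + (\<Sum>j<d. (\<Sum>i\<in>I. trunc T (x i) j)\<^sup>2))))"
  have meas: "?F J \<in> borel_measurable (PiM J (\<lambda>_. P))" for J :: "'i set"
    by measurable
  have "(\<integral>\<^sup>+x. ?F (insert i I) x \<partial>PiM (insert i I) (\<lambda>_. P))
      = (\<integral>\<^sup>+x. (\<integral>\<^sup>+p. ?F (insert i I) (x(i := p)) \<partial>P) \<partial>PiM I (\<lambda>_. P))"
    using insert meas by (intro product_nn_integral_insert) auto
  also have "\<dots> \<le> (\<integral>\<^sup>+x. ?F I x * ennreal (exp (drift m L R lam)) \<partial>PiM I (\<lambda>_. P))"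
  proof (rule nn_integral_mono)
    fix x
    have "(\<Sum>k\<in>insert i I. trunc T ((x(i := p)) k) j) = (\<Sum>k\<in>I. trunc T (x k) j) + trunc T p j" for p j
    proof -
      have "(\<Sum>k\<in>I. trunc T ((x(i := p)) k) j) = (\<Sum>k\<in>I. trunc T (x k) j)"
        using insert by (intro sum.cong) auto
      then show ?thesis using insert by simp
    qed
    then have "(\<integral>\<^sup>+p. ?F (insert i I) (x(i := p)) \<partial>P)
      = (\<integral>\<^sup>+p. ennreal (exp (lam * sqrt (R\<^sup>2 + (\<Sum>j<d. ((\<Sum>k\<in>I. trunc T (x k) j) + trunc T p j)\<^sup>2)))) \<partial>P)"
      by simp
    also have "\<dots> \<le> ennreal (exp (lam * sqrt (R\<^sup>2 + (\<Sum>j<d. (\<Sum>k\<in>I. trunc T (x k) j)\<^sup>2))) * exp (drift m L R lam))"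
      by (rule potential_step[OF T lam m])
    also have "\<dots> = ?F I x * ennreal (exp (drift m L R lam))" by (simp add: ennreal_mult)
    finally show "(\<integral>\<^sup>+p. ?F (insert i I) (x(i := p)) \<partial>P) \<le> ?F I x * ennreal (exp (drift m L R lam))" .
  qed
  also have "\<dots> = (\<integral>\<^sup>+x. ?F I x \<partial>PiM I (\<lambda>_. P)) * ennreal (exp (drift m L R lam))"
    using meas by (intro nn_integral_multc) auto
  also have "\<dots> \<le> ennreal (exp (lam * R + card I * drift m L R lam)) * ennreal (exp (drift m L R lam))"
    using insert.IH by (intro mult_right_mono) auto
  also have "\<dots> = ennreal (exp (lam * R + card (insert i I) * drift m L R lam))"
    using insert by (simp add: ennreal_mult[symmetric] exp_add[symmetric] algebra_simps)
  finally show ?case .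
qed

text \<open>Either some observation exceeds the level T, which a union bound controls, or the
  truncated sum equals the original one and Markov's inequality applies to the potential, which
  dominates exp (lam |S|).\<close>

lemma sum_norm_tail:
  assumes T: "0 < T" "T \<le> R" and lam: "0 < lam" "lam * T \<le> L / 4"
    and m: "m > 0" "measure P {p \<in> space P. T\<^sup>2 < sqn p} \<le> 1 / m" and I: "finite (I :: 'i set)"
  shows "measure (PiM I (\<lambda>_. P)) {x \<in> space (PiM I (\<lambda>_. P)). r < sqrt (\<Sum>j<d. (\<Sum>i\<in>I. z (x i) j)\<^sup>2)}
    \<le> exp (lam * R + card I * drift m L R lam - lam * r) + card I * measure P {p \<in> space P. T\<^sup>2 < sqn p}"
proof -
  let ?Q = "PiM I (\<lambda>_. P)"
  interpret Q: prob_space ?Q by (intro prob_space_PiM) unfold_locales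
  interpret PP: product_prob_space "\<lambda>_. P" I by unfold_locales
  let ?g = "\<lambda>x. lam * sqrt (R\<^sup>2 + (\<Sum>j<d. (\<Sum>i\<in>I. trunc T (x i) j)\<^sup>2))"
  let ?E1 = "{x \<in> space ?Q. ennreal (exp (lam * r)) \<le> ennreal (exp (?g x))}"
  let ?E2 = "\<lambda>i. {x \<in> space ?Q. T\<^sup>2 < sqn (x i)}"
  have sub: "{x \<in> space ?Q. r < sqrt (\<Sum>j<d. (\<Sum>i\<in>I. z (x i) j)\<^sup>2)} \<subseteq> ?E1 \<union> (\<Union>i\<in>I. ?E2 i)"
  proof
    fix x assume x: "x \<in> {x \<in> space ?Q. r < sqrt (\<Sum>j<d. (\<Sum>i\<in>I. z (x i) j)\<^sup>2)}"
    show "x \<in> ?E1 \<union> (\<Union>i\<in>I. ?E2 i)"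
    proof (cases "\<exists>i\<in>I. T\<^sup>2 < sqn (x i)")
      case True
      then show ?thesis using x by auto
    next
      case False
      then have "(\<Sum>i\<in>I. trunc T (x i) j) = (\<Sum>i\<in>I. z (x i) j)" for j
        by (intro sum.cong) (auto simp: trunc_def not_less)
      then have "r \<le> sqrt (\<Sum>j<d. (\<Sum>i\<in>I. trunc T (x i) j)\<^sup>2)" using x by simp
      also have "\<dots> \<le> sqrt (R\<^sup>2 + (\<Sum>j<d. (\<Sum>i\<in>I. trunc T (x i) j)\<^sup>2))" by simp
      finally have "lam * r \<le> ?g x" using lam by simp
      then show ?thesis using x by auto
    qed
  qed
  have E2: "measure ?Q (?E2 i) = measure P {p \<in> space P. T\<^sup>2 < sqn p}" if "i \<in> I" for i
  proof -
    have "measure P {p \<in> space P. T\<^sup>2 < sqn p} = measure (distr ?Q P (\<lambda>x. x i)) {p \<in> space P. T\<^sup>2 < sqn p}"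
      using PP.PiM_component[OF that] by simp
    also have "\<dots> = measure ?Q ((\<lambda>x. x i) -` {p \<in> space P. T\<^sup>2 < sqn p} \<inter> space ?Q)"
      using that by (intro measure_distr) auto
    also have "(\<lambda>x. x i) -` {p \<in> space P. T\<^sup>2 < sqn p} \<inter> space ?Q = ?E2 i"
      using that by (auto simp: space_PiM)
    finally show ?thesis by simp
  qed
  have meas1: "?E1 \<in> sets ?Q" by measurable
  have meas2: "?E2 i \<in> sets ?Q" if "i \<in> I" for i using that by measurable
  have measU: "(\<Union>i\<in>I. ?E2 i) \<in> sets ?Q" by (rule sets.finite_UN[OF I meas2])
  have "emeasure ?Q ?E1 \<le> ennreal (exp (lam * R + card I * drift m L R lam - lam * r))"
  proof -
    let ?E3 = "{x \<in> space ?Q. 1 \<le> ennreal (exp (- lam * r)) * ennreal (exp (?g x))}"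
    have "?E1 \<subseteq> ?E3"
    proof safe
      fix x assume "ennreal (exp (lam * r)) \<le> ennreal (exp (?g x))"
      then have "exp (lam * r) \<le> exp (?g x)" by (simp only: ennreal_le_iff[OF exp_ge_zero])
      then have "1 \<le> exp (- lam * r) * exp (?g x)" by (simp only: exp_le_cancel_iff exp_add[symmetric] one_le_exp_iff)
      then show "1 \<le> ennreal (exp (- lam * r)) * ennreal (exp (?g x))"
        by (simp only: ennreal_mult[symmetric, OF exp_ge_zero exp_ge_zero] ennreal_ge_1)
    qed
    moreover have "?E3 \<in> sets ?Q" by measurable
    ultimately have "emeasure ?Q ?E1 \<le> emeasure ?Q ?E3" by (rule emeasure_mono)
    also have "\<dots> \<le> ennreal (exp (- lam * r)) * (\<integral>\<^sup>+x. ennreal (exp (?g x)) * indicator (space ?Q) x \<partial>?Q)"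
      by (rule nn_integral_Markov_inequality) measurable
    also have "(\<integral>\<^sup>+x. ennreal (exp (?g x)) * indicator (space ?Q) x \<partial>?Q) = (\<integral>\<^sup>+x. ennreal (exp (?g x)) \<partial>?Q)"
      by (intro nn_integral_cong) auto
    also have "ennreal (exp (- lam * r)) * \<dots> \<le> ennreal (exp (- lam * r)) * ennreal (exp (lam * R + card I * drift m L R lam))"
      using potential_bound[OF T lam m I] by (intro mult_left_mono) auto
    also have "\<dots> = ennreal (exp (lam * R + card I * drift m L R lam - lam * r))"
      by (simp add: ennreal_mult[symmetric] exp_add[symmetric] algebra_simps)
    finally show ?thesis .
  qed
  then have E1: "measure ?Q ?E1 \<le> exp (lam * R + card I * drift m L R lam - lam * r)"
    unfolding Q.emeasure_eq_measure by (simp only: ennreal_le_iff[OF exp_ge_zero])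
  have "measure ?Q {x \<in> space ?Q. r < sqrt (\<Sum>j<d. (\<Sum>i\<in>I. z (x i) j)\<^sup>2)} \<le> measure ?Q (?E1 \<union> (\<Union>i\<in>I. ?E2 i))"
    by (rule Q.finite_measure_mono[OF sub sets.Un[OF meas1 measU]])
  also have "\<dots> \<le> measure ?Q ?E1 + measure ?Q (\<Union>i\<in>I. ?E2 i)"
    by (rule measure_Un_le[OF meas1 measU])
  also have "measure ?Q (\<Union>i\<in>I. ?E2 i) \<le> (\<Sum>i\<in>I. measure ?Q (?E2 i))"
    by (rule measure_UNION_le[OF I meas2])
  also have "(\<Sum>i\<in>I. measure ?Q (?E2 i)) = card I * measure P {p \<in> space P. T\<^sup>2 < sqn p}"
    using E2 by simp
  finally show ?thesis using E1 by linarith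
qed

end

text \<open>From x <= exp x at x = u / q. It lets powers of log (2 / \<epsilon>) be absorbed into
  powers of 1 / \<epsilon>.\<close>

lemma powr_le_exp:
  fixes u q :: real
  assumes "u \<ge> 0" "q > 0"
  shows "u powr q \<le> q powr q * exp u"
proof -
  have "u / q \<le> exp (u / q)" using exp_ge_add_one_self[of "u / q"] by linarith
  then have "(u / q) powr q \<le> exp (u / q) powr q" using assms by (intro powr_mono2) auto
  also have "exp (u / q) powr q = exp u" using assms by (simp add: powr_def)
  finally have "u powr q / q powr q \<le> exp u" using assms by (simp add: powr_divide)
  then show ?thesis using assms by (simp add: pos_divide_le_eq mult.commute)
qed

text \<open>The first summand is the coefficient obtained for the term sqrt ((d + L) / m), with L =
  ln (2 / \<epsilon>), the second that for the polynomial term; their sum serves for both.\<close>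

definition fuk_nagaev_const :: "real \<Rightarrow> real \<Rightarrow> real" where
  "fuk_nagaev_const q K = (8 + 4 * K + 2 * q powr q) + (9 + 8 * q powr q) * (4 * K) powr (1 / q)"

lemma fuk_nagaev_const_pos: "K \<ge> 1 \<Longrightarrow> fuk_nagaev_const q K > 0"
  unfolding fuk_nagaev_const_def by (intro add_pos_nonneg) auto

(* With T and lam chosen to balance the terms of sum_norm_tail, lam T <= L / 4 keeps the factor
   exp (L / 2) below eps^(-1/2), which the tail probability eps absorbs. *)
lemma (in centered_weak_moments) fuk_nagaev:
  fixes I :: "'i set"
  assumes I: "finite I" "I \<noteq> {}" and eps: "0 < eps" "eps < 1"
  defines "m \<equiv> real (card I)"
  defines "C \<equiv> fuk_nagaev_const q K"
  shows "measure (PiM I (\<lambda>_. P)) {x \<in> space (PiM I (\<lambda>_. P)).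
      m * (C * (sqrt ((d + ln (2 / eps)) / m) + sqrt d / (m powr (1 - 1 / q) * eps powr (1 / q))))
        < sqrt (\<Sum>j<d. (\<Sum>i\<in>I. z (x i) j)\<^sup>2)} \<le> eps / 2"
proof -
  define L where "L = ln (2 / eps)"
  define D where "D = (4 * K) powr (1 / q)"
  define Cq where "Cq = q powr q"
  define a where "a = sqrt ((d + L) / m)"
  define b where "b = sqrt d / (m powr (1 - 1 / q) * eps powr (1 / q))"
  \<comment> \<open>\<open>D powr q\<close> is 4 K, so that T^q = 4 K m d^(q/2) / eps, and the
    moment bound on the norm makes the probability of exceeding T at most eps / (4 m).\<close>
  define T where "T = D * b * m"
  \<comment> \<open>The potential step needs R >= T; the trace term d / R becomes sqrt (d / m) once
    R >= sqrt (m d).\<close>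
  define R where "R = sqrt (m * d) + T"
  \<comment> \<open>The value a balances lam m against L / lam, since m a^2 = d + L; the other value
    is the largest one with lam T <= L / 4.\<close>
  define lam where "lam = min a (L / (4 * T))"
  let ?kap = "drift m L R lam"
  \<comment> \<open>Chosen to make the exponent in \<open>sum_norm_tail\<close> equal to -2 L, which
    leaves (eps / 2)^2.\<close>
  define r where "r = R + (m * ?kap + 2 * L) / lam"
  have m: "m \<ge> 1" unfolding m_def using I by (simp add: Suc_le_eq card_gt_0_iff)
  have "ln 2 < L" unfolding L_def using eps by (subst ln_less_cancel_iff) (auto simp: field_simps)
  then have L: "L > 1 / 2" using ln2_ge_two_thirds by linarith
  have expL: "exp (- L) = eps / 2" unfolding L_def using eps by (simp add: exp_minus)
  have d1: "real d \<ge> 1" using d by simp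
  have D: "D \<ge> 1" unfolding D_def using K q by (intro ge_one_powr_ge_zero) auto
  have Cq: "Cq \<ge> 1" unfolding Cq_def using q by (intro ge_one_powr_ge_zero) auto
  have a: "a > 0" unfolding a_def using L m d1 by simp
  have b: "b > 0" unfolding b_def using m d1 eps by (intro divide_pos_pos mult_pos_pos) auto
  have T: "T > 0" unfolding T_def using D b m by simp
  have R: "T \<le> R" "sqrt (m * d) \<le> R" unfolding R_def using T m by auto
  have lam: "lam > 0" "lam \<le> a" "lam \<le> L / (4 * T)" unfolding lam_def using a L T by auto
  have lamT: "lam * T \<le> L / 4" using lam(3) T by (simp add: field_simps)
  have Tq: "T powr q = real d powr (q / 2) * (4 * K * m / eps)"
  proof -
    have mm: "m / m powr (1 - 1 / q) = m powr (1 / q)" using m by (simp add: powr_diff)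
    have "T = D * sqrt d * (m / m powr (1 - 1 / q)) / eps powr (1 / q)" unfolding T_def b_def by simp
    then have "T = D * sqrt d * m powr (1 / q) / eps powr (1 / q)" unfolding mm .
    then have "T powr q = D powr q * sqrt d powr q * (m powr (1 / q)) powr q / (eps powr (1 / q)) powr q"
      using D m eps by (simp add: powr_mult powr_divide)
    also have "\<dots> = 4 * K * real d powr (q / 2) * m / eps"
      using q K m eps unfolding D_def by (simp add: powr_powr powr_half_sqrt[symmetric])
    finally show ?thesis by simp
  qed
  have tail: "measure P {p \<in> space P. T\<^sup>2 < sqn p} \<le> eps / (4 * m)"
  proof -
    have "measure P {p \<in> space P. T\<^sup>2 < sqn p} \<le> real d powr (q / 2) * K / T powr q" by (rule norm_tail[OF T])
    also have "\<dots> = eps / (4 * m)" unfolding Tq using K m d1 eps by (simp add: field_simps)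
    finally show ?thesis .
  qed
  have tail1: "measure P {p \<in> space P. T\<^sup>2 < sqn p} \<le> 1 / m"
  proof -
    have "eps / (4 * m) \<le> 1 / m" using eps m by (simp add: field_simps)
    then show ?thesis using tail by linarith
  qed
  have m0: "m > 0" using m by simp
  \<comment> \<open>The cap on lam gives (2 lam)^q <= (L / 2)^q / T^q. One factor
    \<open>exp (L / 2)\<close> comes from the large increments and another from bounding (L / 2)^q;
    together they are 2 / eps, which is cancelled by the eps in 1 / T^q. The total over all m
    observations is bounded by a constant.\<close>
  have big: "m * (exp (L / 2) * (2 * lam) powr q * (real d powr (q / 2) * K)) \<le> Cq"
  proof -
    have "(2 * lam) powr q \<le> (L / 2 / T) powr q" using lam T q by (intro powr_mono2) (auto simp: field_simps)
    also have "\<dots> = (L / 2) powr q / T powr q" by (subst powr_divide) (use L T in auto)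
    also have "\<dots> \<le> (Cq * exp (L / 2)) / T powr q"
      using powr_le_exp[of "L / 2" q] L q T unfolding Cq_def by (intro divide_right_mono) auto
    finally have "m * (exp (L / 2) * (2 * lam) powr q * (real d powr (q / 2) * K))
        \<le> m * (exp (L / 2) * ((Cq * exp (L / 2)) / T powr q) * (real d powr (q / 2) * K))"
      using m K by (intro mult_left_mono mult_right_mono) auto
    also have "\<dots> = Cq * (exp (L / 2) * exp (L / 2)) * (eps / 4)"
      unfolding Tq using K m d1 eps by (simp add: field_simps)
    also have "exp (L / 2) * exp (L / 2) = exp L" by (simp add: exp_add[symmetric])
    also have "exp L = 2 / eps" unfolding L_def using eps by simp
    also have "Cq * (2 / eps) * (eps / 4) \<le> Cq" using eps Cq by simp
    finally show ?thesis .
  qed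
  have inv_m: "1 / sqrt m \<le> a"
  proof -
    have "1 / sqrt m = sqrt (1 / m)" by (simp add: real_sqrt_divide)
    also have "\<dots> \<le> a" unfolding a_def using d1 L m by (intro real_sqrt_le_mono divide_right_mono) auto
    finally show ?thesis .
  qed
  have da: "sqrt (d / m) \<le> a" unfolding a_def using L m by (intro real_sqrt_le_mono divide_right_mono) auto
  have k1: "(2 + K) / (2 * sqrt m) \<le> (2 + K) * a"
  proof -
    have "(2 + K) / (2 * sqrt m) \<le> (2 + K) / sqrt m" using K m by (intro divide_left_mono) auto
    also have "\<dots> \<le> (2 + K) * a" using mult_left_mono[OF inv_m, of "2 + K"] K by simp
    finally show ?thesis .
  qed
  have k3: "d * (1 + K) / R \<le> (1 + K) * a"
  proof -
    have "d * (1 + K) / R \<le> d * (1 + K) / sqrt (m * d)"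
      using R(2) m d1 K by (intro divide_left_mono) (auto intro!: mult_pos_pos intro: less_le_trans[OF T R(1)])
    also have "\<dots> = (1 + K) * (d / sqrt (m * d))" by simp
    also have "d / sqrt (m * d) = sqrt (d / m)"
      using m d1 by (simp add: real_sqrt_mult real_sqrt_divide field_simps)
    also have "(1 + K) * sqrt (d / m) \<le> (1 + K) * a" using da K by (intro mult_left_mono) auto
    finally show ?thesis .
  qed
  have kap: "m * ?kap / lam \<le> m * ((2 + K) * a + 2 * a * (1 + K) + (1 + K) * a) + Cq / lam"
  proof -
    have "m * ?kap / lam = m * ((2 + K) / (2 * sqrt m) + 2 * lam * (1 + K) + d * (1 + K) / R)
       + m * (exp (L / 2) * (2 * lam) powr q * (real d powr (q / 2) * K)) / lam"
      unfolding drift_def using lam(1) by (simp add: add_divide_distrib distrib_left power2_eq_square)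
    also have "\<dots> \<le> m * ((2 + K) * a + 2 * a * (1 + K) + (1 + K) * a) + Cq / lam"
      using k1 k3 big lam m K
      by (intro add_mono mult_left_mono divide_right_mono mult_right_mono) auto
    finally show ?thesis .
  qed
  have inv_lam: "L / lam \<le> m * a + 4 * T"
  proof (cases "a \<le> L / (4 * T)")
    case True
    then have "lam = a" by (simp add: lam_def)
    have "L \<le> m * a * a"
    proof -
      have "m * a * a = d + L" using a_def m d1 L by (simp add: mult.assoc flip: power2_eq_square)
      then show ?thesis by simp
    qed
    then have "L / a \<le> m * a" using a by (simp add: field_simps)
    then show ?thesis using \<open>lam = a\<close> T by simp
  next
    case False
    then have "lam = L / (4 * T)" by (simp add: lam_def)
    then show ?thesis using L T m a by simp
  qed
  have "r \<le> m * (C * (a + b))"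
  proof -
    have "sqrt (m * d) = m * sqrt (d / m)"
      using m by (simp add: real_sqrt_mult real_sqrt_divide field_simps)
    also have "\<dots> \<le> m * a" using da m by (intro mult_left_mono) auto
    finally have R_le: "R \<le> m * a + T" unfolding R_def by simp
    have "r = R + m * ?kap / lam + 2 * (L / lam)" unfolding r_def by (simp add: add_divide_distrib)
    also have "\<dots> \<le> (m * a + T) + (m * ((2 + K) * a + 2 * a * (1 + K) + (1 + K) * a) + Cq / lam) + 2 * (L / lam)"
      using R_le kap by (intro add_mono) auto
    also have "\<dots> \<le> (m * a + T) + (m * ((2 + K) * a + 2 * a * (1 + K) + (1 + K) * a) + 2 * Cq * (L / lam)) + 2 * (L / lam)"
    proof -
      \<comment> \<open>L > 1/2 holds for every eps below 1, so a constant divided by lam is of the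
        order L / lam.\<close>
      have "Cq / lam \<le> 2 * Cq * (L / lam)" using L Cq lam by (simp add: field_simps)
      then show ?thesis by simp
    qed
    also have "(m * a + T) + (m * ((2 + K) * a + 2 * a * (1 + K) + (1 + K) * a) + 2 * Cq * (L / lam)) + 2 * (L / lam)
        = m * a * (6 + 4 * K) + T + (2 * Cq + 2) * (L / lam)" by (simp add: algebra_simps)
    also have "\<dots> \<le> m * a * (6 + 4 * K) + T + (2 * Cq + 2) * (m * a + 4 * T)"
      using mult_left_mono[OF inv_lam, of "2 * Cq + 2"] Cq by simp
    also have "\<dots> = m * ((8 + 4 * K + 2 * Cq) * a + (9 + 8 * Cq) * D * b)"
      unfolding T_def by (simp add: algebra_simps)
    also have "\<dots> \<le> m * (C * (a + b))"
    proof (intro mult_left_mono)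
      have "(8 + 4 * K + 2 * Cq) * a \<le> C * a" "(9 + 8 * Cq) * D * b \<le> C * b"
        unfolding C_def fuk_nagaev_const_def Cq_def[symmetric] D_def[symmetric] using Cq D K a b
        by (auto intro!: mult_right_mono)
      then show "(8 + 4 * K + 2 * Cq) * a + (9 + 8 * Cq) * D * b \<le> C * (a + b)" by (simp add: distrib_left)
    qed (use m in auto)
    finally show ?thesis .
  qed
  note r_le = this
  let ?Q = "PiM I (\<lambda>_. P)"
  interpret Q: prob_space ?Q by (intro prob_space_PiM) unfold_locales
  have "measure ?Q {x \<in> space ?Q. m * (C * (a + b)) < sqrt (\<Sum>j<d. (\<Sum>i\<in>I. z (x i) j)\<^sup>2)}
      \<le> measure ?Q {x \<in> space ?Q. r < sqrt (\<Sum>j<d. (\<Sum>i\<in>I. z (x i) j)\<^sup>2)}"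
  proof (rule Q.finite_measure_mono)
    show "{x \<in> space ?Q. r < sqrt (\<Sum>j<d. (\<Sum>i\<in>I. z (x i) j)\<^sup>2)} \<in> sets ?Q" by measurable
  qed (use r_le in auto)
  also have "\<dots> \<le> exp (lam * R + m * ?kap - lam * r) + m * measure P {p \<in> space P. T\<^sup>2 < sqn p}"
    unfolding m_def by (rule sum_norm_tail[OF T R(1) lam(1) lamT m0[unfolded m_def] tail1[unfolded m_def] I(1)])
  also have "\<dots> \<le> eps / 4 + eps / 4"
  proof (rule add_mono)
    have "lam * r = lam * R + (m * ?kap + 2 * L)"
      unfolding r_def distrib_left[of lam R] using lam(1) by simp
    then have "lam * R + m * ?kap - lam * r = - (2 * L)" by simp
    then have "exp (lam * R + m * ?kap - lam * r) = (exp (- L))\<^sup>2" by (simp add: exp_double[symmetric])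
    also have "\<dots> = eps / 4 * eps" unfolding expL by (simp add: power2_eq_square)
    also have "\<dots> \<le> eps / 4 * 1" using eps by (intro mult_left_mono) auto
    finally show "exp (lam * R + m * ?kap - lam * r) \<le> eps / 4" by simp
    have "m * measure P {p \<in> space P. T\<^sup>2 < sqn p} \<le> m * (eps / (4 * m))"
      using tail m by (intro mult_left_mono) auto
    then show "m * measure P {p \<in> space P. T\<^sup>2 < sqn p} \<le> eps / 4" using m by simp
  qed
  finally show ?thesis unfolding a_def b_def L_def by simp
qed

section \<open>Rounding to a lattice\<close>

text \<open>The two lattice neighbours of t are weighted by 1 - p and p, so that their mean is t.
  The slope g then drops out of the average, and the curvature contributes K / 2 times the variance
  p (1 - p) h^2 <= h^2 / 4. At least one neighbour does no worse than the average.\<close>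

lemma coordinate_rounding:
  fixes F :: "real \<Rightarrow> real"
  assumes smooth: "\<And>s. F (t + s) \<le> F t + g * s + K * s\<^sup>2 / 2" and K: "K \<ge> 0" and h: "h > 0"
  shows "\<exists>n::int. F (of_int n * h) \<le> F t + K * h\<^sup>2 / 8 \<and> \<bar>of_int n * h - t\<bar> \<le> h"
proof -
  define n where "n = \<lfloor>t / h\<rfloor>"
  define p where "p = t / h - of_int n"
  have p: "0 \<le> p" "p < 1" unfolding p_def n_def by linarith+
  have t: "t = (of_int n + p) * h" using h by (simp add: p_def)
  have lo: "F (of_int n * h) \<le> F t - g * (p * h) + K * (p * h)\<^sup>2 / 2"
    using smooth[of "- (p * h)"] by (simp add: t algebra_simps)
  have hi: "F ((of_int n + 1) * h) \<le> F t + g * ((1 - p) * h) + K * ((1 - p) * h)\<^sup>2 / 2"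
    using smooth[of "(1 - p) * h"] by (simp add: t algebra_simps)
  have "(1 - p) * F (of_int n * h) + p * F ((of_int n + 1) * h)
      \<le> (1 - p) * (F t - g * (p * h) + K * (p * h)\<^sup>2 / 2) + p * (F t + g * ((1 - p) * h) + K * ((1 - p) * h)\<^sup>2 / 2)"
    using lo hi p by (intro add_mono mult_left_mono) auto
  also have "\<dots> = F t + K * h\<^sup>2 / 2 * (p * (1 - p))"
    by (simp add: power2_eq_square field_simps)
  also have "\<dots> \<le> F t + K * h\<^sup>2 / 2 * (1 / 4)"
  proof -
    have "p * (1 - p) \<le> 1 / 4" using zero_le_power2[of "p - 1 / 2"] by (simp add: power2_eq_square algebra_simps)
    then show ?thesis using K by (intro add_left_mono mult_left_mono) auto
  qed
  finally have avg: "(1 - p) * F (of_int n * h) + p * F ((of_int n + 1) * h) \<le> F t + K * h\<^sup>2 / 8" by simp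
  have "F (of_int n * h) \<le> F t + K * h\<^sup>2 / 8 \<or> F ((of_int n + 1) * h) \<le> F t + K * h\<^sup>2 / 8"
  proof (rule ccontr)
    assume "\<not> ?thesis"
    then have 1: "F t + K * h\<^sup>2 / 8 < F (of_int n * h)" "F t + K * h\<^sup>2 / 8 < F ((of_int n + 1) * h)" by auto
    have "(1 - p) * (F t + K * h\<^sup>2 / 8) + p * (F t + K * h\<^sup>2 / 8)
        < (1 - p) * F (of_int n * h) + p * F ((of_int n + 1) * h)"
      using 1 p by (intro add_less_le_mono mult_strict_left_mono mult_left_mono) auto
    moreover have "(1 - p) * G + p * G = G" for G by (simp add: algebra_simps)
    ultimately show False using avg by simp
  qed
  moreover have "\<bar>of_int n * h - t\<bar> \<le> h"
  proof -
    have "of_int n * h - t = - (p * h)" by (simp add: t algebra_simps)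
    moreover have "\<bar>p * h\<bar> \<le> 1 * h" unfolding abs_mult using p h by (intro mult_mono) auto
    ultimately show ?thesis by simp
  qed
  moreover have "\<bar>of_int (n + 1) * h - t\<bar> \<le> h"
  proof -
    have "of_int (n + 1) * h - t = (1 - p) * h" by (simp add: t algebra_simps)
    moreover have "\<bar>(1 - p) * h\<bar> \<le> 1 * h" unfolding abs_mult using p h by (intro mult_mono) auto
    ultimately show ?thesis by simp
  qed
  ultimately show ?thesis by (metis of_int_1 of_int_add)
qed

(* Rounding a coordinate up or down at random, with the right mean, costs only the variance h^2 / 4;
   derandomized one coordinate at a time. *)
lemma lattice_rounding:
  fixes f f' :: "'i \<Rightarrow> real \<Rightarrow> real" and x :: "'i \<Rightarrow> nat \<Rightarrow> real"
  assumes smooth: "\<And>i t s. i \<in> I \<Longrightarrow> f i (t + s) \<le> f i t + f' i t * s + B * s\<^sup>2 / 2"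
    and w: "\<And>i. i \<in> I \<Longrightarrow> w i \<ge> 0" and B: "B \<ge> 0" and h: "h > 0" and k: "k \<le> d"
  shows "\<exists>\<gamma>. (\<forall>j<k. \<exists>n::int. \<gamma> j = of_int n * h) \<and> (\<forall>j<k. \<bar>\<gamma> j - u j\<bar> \<le> h) \<and> (\<forall>j\<ge>k. \<gamma> j = u j) \<and>
    (\<Sum>i\<in>I. w i * f i (\<Sum>j<d. \<gamma> j * x i j)) \<le> (\<Sum>i\<in>I. w i * f i (\<Sum>j<d. u j * x i j))
      + B * h\<^sup>2 / 8 * (\<Sum>j<k. \<Sum>i\<in>I. w i * (x i j)\<^sup>2)"
  using k
proof (induction k)
  case 0
  show ?case by (rule exI[of _ u]) simp
next
  case (Suc k)
  then obtain \<gamma> where g1: "\<And>j. j < k \<Longrightarrow> \<exists>n::int. \<gamma> j = of_int n * h"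
    and g2: "\<And>j. j < k \<Longrightarrow> \<bar>\<gamma> j - u j\<bar> \<le> h" and g3: "\<And>j. j \<ge> k \<Longrightarrow> \<gamma> j = u j"
    and g4: "(\<Sum>i\<in>I. w i * f i (\<Sum>j<d. \<gamma> j * x i j)) \<le> (\<Sum>i\<in>I. w i * f i (\<Sum>j<d. u j * x i j))
      + B * h\<^sup>2 / 8 * (\<Sum>j<k. \<Sum>i\<in>I. w i * (x i j)\<^sup>2)" by auto
  have kd: "k < d" using Suc.prems by simp
  have upd: "(\<Sum>j<d. (\<gamma>(k := s)) j * y j) = (\<Sum>j<d. \<gamma> j * y j) + (s - u k) * y k" for s and y :: "nat \<Rightarrow> real"
  proof -
    have "(\<Sum>j<d. (\<gamma>(k := s)) j * y j) = (\<Sum>j<d. \<gamma> j * y j + (if j = k then (s - u k) * y k else 0))"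
      by (intro sum.cong) (auto simp: g3 algebra_simps)
    also have "\<dots> = (\<Sum>j<d. \<gamma> j * y j) + (s - u k) * y k" using kd by (simp add: sum.distrib)
    finally show ?thesis .
  qed
  define F where "F s = (\<Sum>i\<in>I. w i * f i (\<Sum>j<d. (\<gamma>(k := s)) j * x i j))" for s
  define V where "V = (\<Sum>i\<in>I. w i * (x i k)\<^sup>2)"
  have Fu: "F (u k) = (\<Sum>i\<in>I. w i * f i (\<Sum>j<d. \<gamma> j * x i j))" unfolding F_def upd by simp
  \<comment> \<open>As a function of coordinate k alone the objective again has a quadratic upper
    bound, with curvature B V. It is expanded at \<open>u k\<close> because that coordinate has not
    been rounded yet.\<close>
  have "F (u k + s) \<le> F (u k) + (\<Sum>i\<in>I. w i * (f' i (\<Sum>j<d. \<gamma> j * x i j) * x i k)) * s + (B * V) * s\<^sup>2 / 2" for s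
  proof -
    have "F (u k + s) = (\<Sum>i\<in>I. w i * f i ((\<Sum>j<d. \<gamma> j * x i j) + s * x i k))"
      unfolding F_def upd by simp
    also have "\<dots> \<le> (\<Sum>i\<in>I. w i * (f i (\<Sum>j<d. \<gamma> j * x i j) + f' i (\<Sum>j<d. \<gamma> j * x i j) * (s * x i k)
        + B * (s * x i k)\<^sup>2 / 2))"
      using smooth w by (intro sum_mono mult_left_mono) auto
    also have "\<dots> = F (u k) + (\<Sum>i\<in>I. w i * (f' i (\<Sum>j<d. \<gamma> j * x i j) * x i k)) * s + (B * V) * s\<^sup>2 / 2"
      unfolding Fu V_def
      by (simp add: sum.distrib sum_distrib_left sum_distrib_right sum_divide_distrib power_mult_distrib algebra_simps)
    finally show ?thesis .
  qed
  moreover have "B * V \<ge> 0" unfolding V_def using B w by (intro mult_nonneg_nonneg sum_nonneg) auto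
  ultimately obtain n :: int where n: "F (of_int n * h) \<le> F (u k) + (B * V) * h\<^sup>2 / 8" "\<bar>of_int n * h - u k\<bar> \<le> h"
    using coordinate_rounding[OF _ _ h, of F "u k"] by blast
  let ?\<gamma> = "\<gamma>(k := of_int n * h)"
  have "(\<Sum>i\<in>I. w i * f i (\<Sum>j<d. ?\<gamma> j * x i j)) \<le> (\<Sum>i\<in>I. w i * f i (\<Sum>j<d. u j * x i j))
      + B * h\<^sup>2 / 8 * (\<Sum>j<Suc k. \<Sum>i\<in>I. w i * (x i j)\<^sup>2)"
    using n(1) g4 unfolding Fu unfolding F_def V_def[symmetric] sum.lessThan_Suc by (simp add: algebra_simps)
  moreover have "\<forall>j<Suc k. \<exists>n::int. ?\<gamma> j = of_int n * h" using g1 by (auto simp: less_Suc_eq)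
  moreover have "\<forall>j<Suc k. \<bar>?\<gamma> j - u j\<bar> \<le> h" using g2 n(2) by (auto simp: less_Suc_eq)
  moreover have "\<forall>j\<ge>Suc k. ?\<gamma> j = u j" using g3 by auto
  ultimately show ?case by blast
qed

section \<open>Counting lattice points\<close>

lemma sum_half_power_abs: "(\<Sum>n\<in>{- int s..int s}. (1 / 2 :: real) ^ nat \<bar>n\<bar>) = 3 - 2 * (1 / 2) ^ s"
proof (induction s)
  case (Suc s)
  have "{- int (Suc s)..int (Suc s)} = insert (- int (Suc s)) (insert (int (Suc s)) {- int s..int s})" by auto
  then have "(\<Sum>n\<in>{- int (Suc s)..int (Suc s)}. (1 / 2 :: real) ^ nat \<bar>n\<bar>)
      = 2 * (1 / 2) ^ Suc s + (\<Sum>n\<in>{- int s..int s}. (1 / 2 :: real) ^ nat \<bar>n\<bar>)"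
    by (simp add: nat_add_distrib)
  then show ?case using Suc by simp
qed simp

text \<open>Each k in S has weight 2^s times the product of 2^(-|k j|), which is at least 1. The sum
  of these weights over the whole box factorizes over the coordinates, and each factor is a
  truncated two-sided geometric series with sum at most 3.\<close>

lemma card_lattice_points_le:
  fixes d s :: nat
  defines "S \<equiv> {k \<in> {..<d} \<rightarrow>\<^sub>E {- int s..int s}. (\<Sum>j<d. \<bar>k j\<bar>) \<le> int s}"
  shows "finite S" "real (card S) \<le> 2 ^ s * 3 ^ d"
proof -
  let ?A = "{..<d} \<rightarrow>\<^sub>E {- int s..int s}"
  have A: "finite ?A" by (intro finite_PiE) auto
  then show S: "finite S" by (simp add: S_def)
  have ge: "(1 :: real) \<le> 2 ^ s * (\<Prod>j<d. (1 / 2) ^ nat \<bar>k j\<bar>)" if "k \<in> S" for k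
  proof -
    have "int (\<Sum>j<d. nat \<bar>k j\<bar>) \<le> int s" using that by (simp add: S_def)
    then have le: "(\<Sum>j<d. nat \<bar>k j\<bar>) \<le> s" by (simp only: of_nat_le_iff)
    have "(\<Prod>j<d. (1 / 2 :: real) ^ nat \<bar>k j\<bar>) = (1 / 2) ^ (\<Sum>j<d. nat \<bar>k j\<bar>)" by (simp add: power_sum)
    also have "\<dots> \<ge> (1 / 2) ^ s" using le by (intro power_decreasing) auto
    finally have "2 ^ s * (1 / 2 :: real) ^ s \<le> 2 ^ s * (\<Prod>j<d. (1 / 2) ^ nat \<bar>k j\<bar>)" by (intro mult_left_mono) auto
    then show ?thesis by (simp add: power_one_over)
  qed
  have "real (card S) = (\<Sum>k\<in>S. 1)" by simp
  also have "\<dots> \<le> (\<Sum>k\<in>S. 2 ^ s * (\<Prod>j<d. (1 / 2) ^ nat \<bar>k j\<bar>))" using ge by (intro sum_mono) auto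
  also have "\<dots> \<le> (\<Sum>k\<in>?A. 2 ^ s * (\<Prod>j<d. (1 / 2) ^ nat \<bar>k j\<bar>))"
  proof (rule sum_mono2[OF A])
    show "S \<subseteq> ?A" unfolding S_def by blast
    show "0 \<le> 2 ^ s * (\<Prod>j<d. (1 / 2 :: real) ^ nat \<bar>k j\<bar>)" for k :: "nat \<Rightarrow> int"
      by (intro mult_nonneg_nonneg prod_nonneg ballI zero_le_power) simp_all
  qed
  also have "\<dots> = 2 ^ s * (\<Prod>j<d. \<Sum>n\<in>{- int s..int s}. (1 / 2) ^ nat \<bar>n\<bar>)"
    by (subst prod_sum_PiE) (simp_all add: sum_distrib_left)
  also have "\<dots> \<le> 2 ^ s * (\<Prod>j<d. 3)"
    by (intro mult_left_mono prod_mono conjI sum_nonneg) (simp_all add: sum_half_power_abs)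
  finally show "real (card S) \<le> 2 ^ s * 3 ^ d" by simp
qed

text \<open>The data x, the functions f and the weights w are quantified after the net N: a single
  net fixed in advance works for every realization of the sample, which makes the later union bound
  legitimate. The bounds on the norm keep the rounded directions comparable to unit vectors.\<close>

definition rounding_net :: "'i set \<Rightarrow> nat \<Rightarrow> real \<Rightarrow> (nat \<Rightarrow> real) set \<Rightarrow> bool" where
  "rounding_net I d \<eta> N \<longleftrightarrow> finite N \<and>
    (\<forall>\<gamma>\<in>N. 1 / 4 \<le> (\<Sum>j<d. (\<gamma> j)\<^sup>2) \<and> (\<Sum>j<d. (\<gamma> j)\<^sup>2) \<le> 4) \<and>
    (\<forall>u f f' B w (x :: 'i \<Rightarrow> nat \<Rightarrow> real). (\<Sum>j<d. (u j)\<^sup>2) = 1 \<longrightarrow> B \<ge> 0 \<longrightarrow> (\<forall>i\<in>I. w i \<ge> 0) \<longrightarrow>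
      (\<forall>i\<in>I. \<forall>t s. f i (t + s) \<le> f i t + f' i t * s + B * s\<^sup>2 / 2) \<longrightarrow>
      (\<exists>\<gamma>\<in>N. (\<Sum>i\<in>I. w i * f i (\<Sum>j<d. \<gamma> j * x i j)) \<le> (\<Sum>i\<in>I. w i * f i (\<Sum>j<d. u j * x i j))
        + B * \<eta>\<^sup>2 / (8 * d) * (\<Sum>i\<in>I. w i * (\<Sum>j<d. (x i j)\<^sup>2))))"

text \<open>With mesh \<eta> / sqrt d the rounding displaces a unit vector by at most \<eta> <= 1/2,
  so the rounded point has norm at most 2 and its integer coordinates have square sum at most 4 d /
  \<eta>^2. This is linear in d, and by \<open>card_lattice_points_le\<close> the number of such
  points is exponential in d with a base depending on \<eta> only.\<close>

lemma sphere_rounding_net: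
  fixes \<eta> :: real
  assumes \<eta>: "0 < \<eta>" "\<eta> \<le> 1 / 2"
  shows "\<exists>C0\<ge>1. \<forall>d>0. \<exists>N. real (card N) \<le> C0 ^ d \<and> (\<forall>I :: 'i set. rounding_net I d \<eta> N)"
proof -
  define Q where "Q = nat \<lceil>4 / \<eta>\<^sup>2\<rceil>"
  show ?thesis
  proof (intro exI[of _ "2 ^ Q * 3"] conjI allI impI)
    show "1 \<le> 2 ^ Q * (3 :: real)" using one_le_power[of "2 :: real" Q] by linarith
    fix d :: nat assume d: "d > 0"
    define h where "h = \<eta> / sqrt d"
    define s where "s = d * Q"
    have h: "h > 0" using \<eta> d by (simp add: h_def)
    have h2: "h\<^sup>2 = \<eta>\<^sup>2 / d" using d by (simp add: h_def power_divide)
    define S where "S = {k \<in> {..<d} \<rightarrow>\<^sub>E {- int s..int s}. (\<Sum>j<d. \<bar>k j\<bar>) \<le> int s}"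
    have S: "finite S" "real (card S) \<le> 2 ^ s * 3 ^ d" unfolding S_def by (rule card_lattice_points_le)+
    define \<phi> where "\<phi> = (\<lambda>k j. if j < d then of_int (k j) * h else (0 :: real))"
    define N where "N = {\<gamma> \<in> \<phi> ` S. 1 / 4 \<le> (\<Sum>j<d. (\<gamma> j)\<^sup>2) \<and> (\<Sum>j<d. (\<gamma> j)\<^sup>2) \<le> 4}"
    have finN: "finite N" using S by (simp add: N_def)
    have "card N \<le> card (\<phi> ` S)" using S by (intro card_mono) (auto simp: N_def)
    also have "\<dots> \<le> card S" using S by (intro card_image_le)
    finally have "real (card N) \<le> 2 ^ s * 3 ^ d" using S by linarith
    also have "\<dots> = (2 ^ Q * 3) ^ d" by (simp add: s_def power_mult_distrib power_mult mult.commute flip: power_mult)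
    finally have cardN: "real (card N) \<le> (2 ^ Q * 3) ^ d" .
    have round: "\<exists>\<gamma>\<in>N. (\<Sum>i\<in>I. w i * f i (\<Sum>j<d. \<gamma> j * x i j)) \<le> (\<Sum>i\<in>I. w i * f i (\<Sum>j<d. u j * x i j))
        + B * \<eta>\<^sup>2 / (8 * d) * (\<Sum>i\<in>I. w i * (\<Sum>j<d. (x i j)\<^sup>2))"
      if u: "(\<Sum>j<d. (u j)\<^sup>2) = 1" and B: "B \<ge> 0" and w: "\<forall>i\<in>I. w i \<ge> 0"
        and smooth: "\<forall>i\<in>I. \<forall>t s. f i (t + s) \<le> f i t + f' i t * s + B * s\<^sup>2 / 2"
      for u and I :: "'i set" and f f' B w and x :: "'i \<Rightarrow> nat \<Rightarrow> real"
    proof -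
      obtain \<gamma> where g1: "\<And>j. j < d \<Longrightarrow> \<exists>n::int. \<gamma> j = of_int n * h"
        and g2: "\<And>j. j < d \<Longrightarrow> \<bar>\<gamma> j - u j\<bar> \<le> h"
        and g4: "(\<Sum>i\<in>I. w i * f i (\<Sum>j<d. \<gamma> j * x i j)) \<le> (\<Sum>i\<in>I. w i * f i (\<Sum>j<d. u j * x i j))
          + B * h\<^sup>2 / 8 * (\<Sum>j<d. \<Sum>i\<in>I. w i * (x i j)\<^sup>2)"
        using lattice_rounding[of I f f' B w h d d u x] smooth w B h by auto
      obtain k :: "nat \<Rightarrow> int" where k: "\<And>j. j < d \<Longrightarrow> \<gamma> j = of_int (k j) * h" using g1 by metis
      have dist: "(\<Sum>j<d. (\<gamma> j - u j)\<^sup>2) \<le> 1 / 4"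
      proof -
        have "(\<Sum>j<d. (\<gamma> j - u j)\<^sup>2) \<le> (\<Sum>j<d. h\<^sup>2)"
          using g2 h by (intro sum_mono) (metis abs_le_square_iff abs_of_pos lessThan_iff)
        also have "\<dots> = \<eta>\<^sup>2" using d by (simp add: h2)
        also have "\<dots> \<le> (1 / 2)\<^sup>2" using \<eta> by (intro power_mono) auto
        finally show ?thesis by (simp add: power2_eq_square)
      qed
      have "(\<Sum>j<d. (\<gamma> j)\<^sup>2) \<le> (\<Sum>j<d. 2 * (u j)\<^sup>2 + 2 * (\<gamma> j - u j)\<^sup>2)"
      proof (rule sum_mono)
        fix j show "(\<gamma> j)\<^sup>2 \<le> 2 * (u j)\<^sup>2 + 2 * (\<gamma> j - u j)\<^sup>2"
          using zero_le_power2[of "\<gamma> j - 2 * u j"] by (simp add: power2_eq_square algebra_simps)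
      qed
      also have "\<dots> = 2 * (\<Sum>j<d. (u j)\<^sup>2) + 2 * (\<Sum>j<d. (\<gamma> j - u j)\<^sup>2)" by (simp add: sum.distrib sum_distrib_left)
      finally have up: "(\<Sum>j<d. (\<gamma> j)\<^sup>2) \<le> 4" using dist u by linarith
      have "(\<Sum>j<d. (u j)\<^sup>2) \<le> (\<Sum>j<d. 2 * (\<gamma> j)\<^sup>2 + 2 * (\<gamma> j - u j)\<^sup>2)"
      proof (rule sum_mono)
        fix j show "(u j)\<^sup>2 \<le> 2 * (\<gamma> j)\<^sup>2 + 2 * (\<gamma> j - u j)\<^sup>2"
          using zero_le_power2[of "u j - 2 * \<gamma> j"] by (simp add: power2_eq_square algebra_simps)
      qed
      also have "\<dots> = 2 * (\<Sum>j<d. (\<gamma> j)\<^sup>2) + 2 * (\<Sum>j<d. (\<gamma> j - u j)\<^sup>2)" by (simp add: sum.distrib sum_distrib_left)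
      finally have low: "1 / 4 \<le> (\<Sum>j<d. (\<gamma> j)\<^sup>2)" using dist u by linarith
      have ksum: "(\<Sum>j<d. \<bar>k j\<bar>) \<le> int s"
      proof -
        \<comment> \<open>Integers satisfy |k| <= k^2, so the Euclidean bound on
          \<open>\<gamma>\<close> controls the l1 norm of k, which is the quantity in the counting
          lemma.\<close>
        have "real_of_int (\<Sum>j<d. \<bar>k j\<bar>) \<le> (\<Sum>j<d. real_of_int ((k j)\<^sup>2))"
          unfolding of_int_sum
        proof (intro sum_mono)
          fix j
          have "\<bar>k j\<bar> \<le> (k j)\<^sup>2"
          proof (cases "k j = 0")
            case False
            then have "\<bar>k j\<bar> * 1 \<le> \<bar>k j\<bar> * \<bar>k j\<bar>" by (intro mult_left_mono) auto
            then show ?thesis by (simp add: power2_eq_square)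
          qed simp
          then show "real_of_int \<bar>k j\<bar> \<le> real_of_int ((k j)\<^sup>2)" by (simp only: of_int_le_iff)
        qed
        also have "\<dots> = (\<Sum>j<d. (\<gamma> j)\<^sup>2 / h\<^sup>2)" using k h by (intro sum.cong) (auto simp: power_mult_distrib)
        also have "\<dots> = (\<Sum>j<d. (\<gamma> j)\<^sup>2) / h\<^sup>2" by (simp add: sum_divide_distrib)
        also have "\<dots> \<le> 4 / h\<^sup>2" using up h by (intro divide_right_mono) auto
        also have "\<dots> = d * (4 / \<eta>\<^sup>2)" by (simp add: h2)
        also have "\<dots> \<le> d * real Q" unfolding Q_def by (intro mult_left_mono) linarith+
        finally have "real_of_int (\<Sum>j<d. \<bar>k j\<bar>) \<le> real_of_int (int s)" by (simp add: s_def)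
        then show ?thesis by (simp only: of_int_le_iff)
      qed
      have kj: "\<bar>k j\<bar> \<le> int s" if "j < d" for j
      proof -
        have "\<bar>k j\<bar> \<le> (\<Sum>j<d. \<bar>k j\<bar>)" using that by (intro member_le_sum) auto
        then show ?thesis using ksum by linarith
      qed
      \<comment> \<open>Beyond d the rounded \<open>\<gamma>\<close> may keep arbitrary values of u;
        \<open>\<gamma>'\<close> is its representative in the finite set N, equal to 0
        there.\<close>
      have "restrict k {..<d} \<in> S" unfolding S_def using ksum kj by (auto simp: abs_le_iff minus_le_iff)
      moreover define \<gamma>' where "\<gamma>' = \<phi> (restrict k {..<d})"
      moreover have eq: "\<gamma>' j = \<gamma> j" if "j < d" for j using that k by (simp add: \<gamma>'_def \<phi>_def)
      moreover have "(\<Sum>j<d. (\<gamma>' j)\<^sup>2) = (\<Sum>j<d. (\<gamma> j)\<^sup>2)" using eq by (intro sum.cong) auto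
      ultimately have mem: "\<gamma>' \<in> N" unfolding N_def using up low by auto
      have sums: "(\<Sum>j<d. \<gamma>' j * x i j) = (\<Sum>j<d. \<gamma> j * x i j)" for i using eq by (intro sum.cong) auto
      have "(\<Sum>j<d. \<Sum>i\<in>I. w i * (x i j)\<^sup>2) = (\<Sum>i\<in>I. w i * (\<Sum>j<d. (x i j)\<^sup>2))"
        by (subst sum.swap) (simp add: sum_distrib_left)
      then have "(\<Sum>i\<in>I. w i * f i (\<Sum>j<d. \<gamma>' j * x i j)) \<le> (\<Sum>i\<in>I. w i * f i (\<Sum>j<d. u j * x i j))
        + B * \<eta>\<^sup>2 / (8 * d) * (\<Sum>i\<in>I. w i * (\<Sum>j<d. (x i j)\<^sup>2))"
        unfolding sums using g4 h2 by (simp add: mult.commute)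
      then show ?thesis using mem by blast
    qed
    show "\<exists>N. real (card N) \<le> (2 ^ Q * 3) ^ d \<and> (\<forall>I :: 'i set. rounding_net I d \<eta> N)"
    proof (intro exI[of _ N] conjI allI cardN)
      fix I :: "'i set"
      have norm: "\<forall>\<gamma>\<in>N. 1 / 4 \<le> (\<Sum>j<d. (\<gamma> j)\<^sup>2) \<and> (\<Sum>j<d. (\<gamma> j)\<^sup>2) \<le> 4" by (simp add: N_def)
      show "rounding_net I d \<eta> N"
        unfolding rounding_net_def by (intro conjI finN norm allI impI) (rule round)
    qed
  qed
qed

section \<open>Localization of Z-estimators\<close>

locale smooth_convex =
  fixes l l1 l2 l3 :: "real \<Rightarrow> real" and b1 :: real
  assumes l_deriv: "\<And>t. (l has_real_derivative l1 t) (at t)"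
    and l1_deriv: "\<And>t. (l1 has_real_derivative l2 t) (at t)"
    and l2_deriv: "\<And>t. (l2 has_real_derivative l3 t) (at t)"
    and l2_bound: "\<And>t. \<bar>l2 t\<bar> \<le> b1" and l3_bound: "\<And>t. \<bar>l3 t\<bar> \<le> b1" and b1: "b1 > 0"
    and tangent: "\<And>s t. l t + l1 t * (s - t) \<le> l s"
begin

text \<open>The Bregman divergence of l between t + s and t.\<close>

definition excess :: "real \<Rightarrow> real \<Rightarrow> real" where
  "excess t s = l (t + s) - l t - l1 t * s"

lemma excess_nonneg: "excess t s \<ge> 0"
  using tangent[of t "t + s"] by (simp add: excess_def)

text \<open>Taylor's formula with Lagrange remainder, of order two for the upper and of order three
  for the lower bound.\<close>

lemma excess_bounds: "excess t s \<le> b1 * s\<^sup>2 / 2" "l2 t * s\<^sup>2 / 2 - b1 * \<bar>s\<bar> ^ 3 / 6 \<le> excess t s"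
proof -
  define diff where "diff = (\<lambda>(m :: nat) s. if m = 0 then l (t + s) else if m = 1 then l1 (t + s)
    else if m = 2 then l2 (t + s) else l3 (t + s) :: real)"
  have shift: "((\<lambda>s. f (t + s)) has_real_derivative f' (t + s)) (at s)"
    if "\<And>t. (f has_real_derivative f' t) (at t)" for f f' s
    using DERIV_shift[of f "f' (t + s)" s t] that by (simp add: add.commute)
  have D: "DERIV (diff m) s :> diff (Suc m) s" if "m < 3" for m s
    using that shift[OF l_deriv] shift[OF l1_deriv] shift[OF l2_deriv]
    by (auto simp: diff_def less_Suc_eq numeral_3_eq_3 numeral_2_eq_2)
  obtain v where "diff 0 s = (\<Sum>m<2. diff m 0 / fact m * s ^ m) + diff 2 v / fact 2 * s ^ 2"
    using Maclaurin_bi_le[of diff "diff 0" 2 s] D by auto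
  then have "excess t s = l2 (t + v) * s\<^sup>2 / 2"
    by (simp add: diff_def excess_def numeral_2_eq_2)
  also have "\<dots> \<le> b1 * s\<^sup>2 / 2"
    using l2_bound[of "t + v"] by (intro divide_right_mono mult_right_mono) auto
  finally show "excess t s \<le> b1 * s\<^sup>2 / 2" .
  obtain v where "diff 0 s = (\<Sum>m<3. diff m 0 / fact m * s ^ m) + diff 3 v / fact 3 * s ^ 3"
    using Maclaurin_bi_le[of diff "diff 0" 3 s] D by auto
  then have e: "excess t s = l2 t * s\<^sup>2 / 2 + l3 (t + v) * s ^ 3 / 6"
    by (simp add: diff_def excess_def eval_nat_numeral)
  have "\<bar>l3 (t + v) * s ^ 3\<bar> \<le> b1 * \<bar>s\<bar> ^ 3"
    unfolding abs_mult power_abs[symmetric] using l3_bound[of "t + v"] by (intro mult_right_mono) auto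
  then show "l2 t * s\<^sup>2 / 2 - b1 * \<bar>s\<bar> ^ 3 / 6 \<le> excess t s" unfolding e by linarith
qed

text \<open>This is the quadratic upper bound required of f by \<open>rounding_net\<close>, with
  slope \<open>l1 (t + s) - l1 t\<close>.\<close>

lemma excess_add: "excess t (s + h) \<le> excess t s + (l1 (t + s) - l1 t) * h + b1 * h\<^sup>2 / 2"
  using excess_bounds(1)[of "t + s" h] by (simp add: excess_def algebra_simps)

lemma continuous_l: "continuous_on UNIV l" "continuous_on UNIV l1" "continuous_on UNIV l2"
  using l_deriv l1_deriv l2_deriv by (blast intro: DERIV_continuous_on has_field_derivative_at_within)+

lemma measurable_l [measurable]:
  "l \<in> borel_measurable borel" "l1 \<in> borel_measurable borel" "l2 \<in> borel_measurable borel"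
  using continuous_l by (auto intro: borel_measurable_continuous_onI)

end

text \<open>Parameters are functions on all natural numbers. Freezing the coordinates from d on puts
  the ball inside a product of compact intervals, and Tychonoff's theorem applies.\<close>

lemma compact_restricted_ball:
  fixes c :: "nat \<Rightarrow> real"
  shows "compact {\<theta>. (\<forall>j\<ge>d. \<theta> j = c j) \<and> (\<Sum>j<d. (\<theta> j - c j)\<^sup>2) \<le> r\<^sup>2}" (is "compact ?K")
proof -
  let ?B = "PiE UNIV (\<lambda>j. {c j - \<bar>r\<bar>..c j + \<bar>r\<bar>})"
  have "compactin (product_topology (\<lambda>i. euclidean) UNIV) ?B" by (simp add: compactin_PiE)
  then have cB: "compact ?B" by (simp add: euclidean_product_topology)
  have coord: "continuous_on UNIV (\<lambda>\<theta>::nat \<Rightarrow> real. \<theta> j)" for j by simp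
  have "closed ((\<Inter>j\<in>{d..}. {\<theta>. \<theta> j = c j}) \<inter> {\<theta>. (\<Sum>j<d. (\<theta> j - c j)\<^sup>2) \<le> r\<^sup>2})"
    by (intro closed_Int closed_INT ballI closed_Collect_eq closed_Collect_le continuous_intros coord)
  then have "closed ?K" by (rule back_subst[of closed]) auto
  moreover have "?K \<subseteq> ?B"
  proof
    fix \<theta> assume \<theta>: "\<theta> \<in> ?K"
    have "\<bar>\<theta> j - c j\<bar> \<le> \<bar>r\<bar>" for j
    proof (cases "j < d")
      case True
      then have "(\<theta> j - c j)\<^sup>2 \<le> (\<Sum>j<d. (\<theta> j - c j)\<^sup>2)" by (intro member_le_sum) auto
      then have "(\<theta> j - c j)\<^sup>2 \<le> r\<^sup>2" using \<theta> by auto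
      then show ?thesis by (simp add: abs_le_square_iff)
    qed (use \<theta> in auto)
    then have "\<theta> j \<in> {c j - \<bar>r\<bar>..c j + \<bar>r\<bar>}" for j by (simp add: abs_diff_le_iff)
    then show "\<theta> \<in> ?B" by (simp add: PiE_iff)
  qed
  ultimately show ?thesis using cB compact_Int_closed[of ?B ?K] by (simp add: Int_absorb1)
qed

text \<open>G is the gradient of the convex empirical loss F, and \<open>sphere\<close> states that
  F is larger on the sphere of radius r than at its centre. A minimizer over the closed ball is then
  interior, which yields a root. A root outside the ball would minimize F globally, and convexity
  along the segment from the centre would bound F on the sphere by its value at the centre.\<close>

lemma (in smooth_convex) z_estimator_localization:
  fixes d :: nat and I :: "'i set" and x :: "'i \<Rightarrow> nat \<Rightarrow> real" and y :: "'i \<Rightarrow> real" and \<theta>0 :: "nat \<Rightarrow> real"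
  defines "lin \<equiv> \<lambda>i \<theta>. \<Sum>j<d. x i j * \<theta> j"
  defines "G \<equiv> \<lambda>j \<theta>. \<Sum>i\<in>I. (l1 (lin i \<theta>) - y i) * x i j"
  assumes I: "finite I" and r: "r > 0"
    and sphere: "\<And>u. (\<Sum>j<d. (u j)\<^sup>2) = 1 \<Longrightarrow>
      0 < r * (\<Sum>j<d. G j \<theta>0 * u j) + (\<Sum>i\<in>I. excess (lin i \<theta>0) (r * lin i u))"
  shows "\<exists>\<theta>. \<forall>j<d. G j \<theta> = 0"
    and "(\<And>j. j < d \<Longrightarrow> G j \<theta> = 0) \<Longrightarrow> (\<Sum>j<d. (\<theta> j - \<theta>0 j)\<^sup>2) \<le> r\<^sup>2"
proof -
  define F where "F = (\<lambda>\<theta>. \<Sum>i\<in>I. l (lin i \<theta>) - y i * lin i \<theta>)"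
  have lin_diff: "lin i \<theta>' = lin i \<theta> + lin i (\<lambda>j. \<theta>' j - \<theta> j)" for i \<theta> \<theta>'
    by (simp add: lin_def sum.distrib[symmetric] algebra_simps)
  have expand: "F \<theta>' = F \<theta> + (\<Sum>j<d. G j \<theta> * (\<theta>' j - \<theta> j)) + (\<Sum>i\<in>I. excess (lin i \<theta>) (lin i (\<lambda>j. \<theta>' j - \<theta> j)))"
    for \<theta> \<theta>'
  proof -
    have "(\<Sum>j<d. G j \<theta> * (\<theta>' j - \<theta> j)) = (\<Sum>i\<in>I. (l1 (lin i \<theta>) - y i) * lin i (\<lambda>j. \<theta>' j - \<theta> j))"
      unfolding G_def lin_def sum_distrib_right sum_distrib_left
      by (subst sum.swap) (simp add: mult.assoc)
    then show ?thesis
      unfolding F_def sum.distrib[symmetric] by (simp add: lin_diff[of _ \<theta>' \<theta>] excess_def sum.distrib[symmetric] algebra_simps)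
  qed
  have lin_scale: "lin i (\<lambda>j. a * v j) = a * lin i v" for i a v
    by (simp add: lin_def sum_distrib_left algebra_simps)
  have F_sphere: "F \<theta>0 < F p" if p: "(\<Sum>j<d. (p j - \<theta>0 j)\<^sup>2) = r\<^sup>2" for p
  proof -
    define u where "u = (\<lambda>j. (p j - \<theta>0 j) / r)"
    have u: "(\<Sum>j<d. (u j)\<^sup>2) = 1"
      using p r by (simp add: u_def power_divide sum_divide_distrib[symmetric])
    have ru: "(\<lambda>j. p j - \<theta>0 j) = (\<lambda>j. r * u j)" using r by (simp add: u_def)
    have "(\<Sum>j<d. G j \<theta>0 * (p j - \<theta>0 j)) = r * (\<Sum>j<d. G j \<theta>0 * u j)"
      using r by (simp add: u_def sum_distrib_left)
    moreover have "lin i (\<lambda>j. p j - \<theta>0 j) = r * lin i u" for i unfolding ru lin_scale ..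
    ultimately show ?thesis using sphere[OF u] expand[of p \<theta>0] by simp
  qed
  show "(\<Sum>j<d. (\<theta> j - \<theta>0 j)\<^sup>2) \<le> r\<^sup>2" if G: "\<And>j. j < d \<Longrightarrow> G j \<theta> = 0"
  proof (rule ccontr)
    assume neg: "\<not> ?thesis"
    define R where "R = sqrt (\<Sum>j<d. (\<theta> j - \<theta>0 j)\<^sup>2)"
    have R2: "R\<^sup>2 = (\<Sum>j<d. (\<theta> j - \<theta>0 j)\<^sup>2)" by (simp add: R_def sum_nonneg)
    have R: "R > r" using neg r unfolding R_def by (intro real_less_rsqrt) auto
    define \<tau> where "\<tau> = r / R"
    have \<tau>: "0 < \<tau>" "\<tau> < 1" using R r by (auto simp: \<tau>_def)
    \<comment> \<open>The point where the segment from \<open>\<theta>0\<close> to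
      \<open>\<theta>\<close> meets the sphere.\<close>
    define p where "p = (\<lambda>j. \<theta>0 j + \<tau> * (\<theta> j - \<theta>0 j))"
    have "(\<Sum>j<d. (p j - \<theta>0 j)\<^sup>2) = \<tau>\<^sup>2 * R\<^sup>2" unfolding R2 by (simp add: p_def power_mult_distrib sum_distrib_left)
    also have "\<dots> = r\<^sup>2" using R r by (simp add: \<tau>_def power_divide)
    finally have *: "F \<theta>0 < F p" by (rule F_sphere)
    have "F \<theta> \<le> F \<theta>0"
      using expand[of \<theta>0 \<theta>] G by (simp add: sum_nonneg excess_nonneg)
    \<comment> \<open>Convexity between the endpoints is obtained from the tangent at p: with
      weights 1 - \<tau> and \<tau> the two linear terms cancel.\<close>
    moreover have "F p + (\<Sum>j<d. G j p * (\<theta>0 j - p j)) \<le> F \<theta>0" "F p + (\<Sum>j<d. G j p * (\<theta> j - p j)) \<le> F \<theta>"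
      using expand[of \<theta>0 p] expand[of \<theta> p] by (simp_all add: sum_nonneg excess_nonneg)
    then have "(1 - \<tau>) * (F p + (\<Sum>j<d. G j p * (\<theta>0 j - p j))) + \<tau> * (F p + (\<Sum>j<d. G j p * (\<theta> j - p j)))
        \<le> (1 - \<tau>) * F \<theta>0 + \<tau> * F \<theta>"
      using \<tau> by (intro add_mono mult_left_mono) auto
    moreover have "(1 - \<tau>) * (\<Sum>j<d. G j p * (\<theta>0 j - p j)) + \<tau> * (\<Sum>j<d. G j p * (\<theta> j - p j)) = 0"
    proof -
      have "(1 - \<tau>) * (\<Sum>j<d. G j p * (\<theta>0 j - p j)) + \<tau> * (\<Sum>j<d. G j p * (\<theta> j - p j))
        = (\<Sum>j<d. G j p * ((1 - \<tau>) * (\<theta>0 j - p j) + \<tau> * (\<theta> j - p j)))"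
        by (simp add: sum_distrib_left sum.distrib[symmetric] algebra_simps)
      also have "\<dots> = 0" by (intro sum.neutral) (simp add: p_def algebra_simps)
      finally show ?thesis .
    qed
    ultimately have "F p \<le> (1 - \<tau>) * F \<theta>0 + \<tau> * F \<theta>" "\<tau> * F \<theta> \<le> \<tau> * F \<theta>0"
      using \<tau> by (simp_all add: algebra_simps)
    then have "F p \<le> F \<theta>0" by (simp add: algebra_simps)
    then show False using * by simp
  qed
  let ?K = "{\<theta>. (\<forall>j\<ge>d. \<theta> j = \<theta>0 j) \<and> (\<Sum>j<d. (\<theta> j - \<theta>0 j)\<^sup>2) \<le> r\<^sup>2}"
  have coord: "continuous_on S (\<lambda>\<theta>::nat \<Rightarrow> real. \<theta> j)" for j S
    by (rule continuous_on_subset[OF continuous_on_product_coordinates]) simp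
  have lin_cont: "continuous_on S (lin i)" for i S
    unfolding lin_def by (intro continuous_intros coord)
  have F_cont: "continuous_on ?K F"
    unfolding F_def
    by (intro continuous_intros lin_cont continuous_on_compose2[OF continuous_l(1) lin_cont]) auto
  have c0: "\<theta>0 \<in> ?K" by simp
  then have "?K \<noteq> {}" by (metis empty_iff)
  from continuous_attains_inf[OF compact_restricted_ball this F_cont]
  obtain \<theta> where \<theta>: "\<theta> \<in> ?K" and min0: "\<forall>\<theta>'\<in>?K. F \<theta> \<le> F \<theta>'" by (rule bexE)
  have min: "F \<theta> \<le> F \<theta>'" if "\<theta>' \<in> ?K" for \<theta>' by (rule bspec[OF min0 that])
  have S: "(\<Sum>j<d. (\<theta> j - \<theta>0 j)\<^sup>2) < r\<^sup>2"
  proof (rule ccontr)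
    assume "\<not> ?thesis"
    then have "(\<Sum>j<d. (\<theta> j - \<theta>0 j)\<^sup>2) = r\<^sup>2" using \<theta> by simp
    then show False using F_sphere[of \<theta>] min[OF c0] by simp
  qed
  have "G j \<theta> = 0" if j: "j < d" for j
  proof -
    define \<phi> where "\<phi> = (\<lambda>t. F (\<theta>(j := t)))"
    define a where "a = \<theta> j - \<theta>0 j"
    \<comment> \<open>Moving coordinate j by s changes the squared distance from the centre by 2 a s
      + s^2, at most (1 + 2 |a|) |s| when |s| <= 1; within \<delta> the point stays in the
      ball.\<close>
    define \<delta> where "\<delta> = min 1 ((r\<^sup>2 - (\<Sum>j<d. (\<theta> j - \<theta>0 j)\<^sup>2)) / (1 + 2 * \<bar>a\<bar>))"
    have \<delta>: "\<delta> > 0" using S by (simp add: \<delta>_def)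
    have lin_upd: "lin i (\<theta>(j := t)) = lin i \<theta> + (t - \<theta> j) * x i j" for i t
    proof -
      have "lin i (\<theta>(j := t)) = (\<Sum>k<d. x i k * \<theta> k + (if k = j then (t - \<theta> j) * x i j else 0))"
        unfolding lin_def by (intro sum.cong) (auto simp: algebra_simps)
      then show ?thesis using j by (simp add: sum.distrib lin_def)
    qed
    have "DERIV \<phi> (\<theta> j) :> G j \<theta>"
    proof -
      have eq: "\<phi> = (\<lambda>t. \<Sum>i\<in>I. l (lin i \<theta> + (t - \<theta> j) * x i j) - y i * (lin i \<theta> + (t - \<theta> j) * x i j))"
        by (simp add: \<phi>_def F_def lin_upd)
      show ?thesis
        unfolding eq G_def
      proof (rule DERIV_sum)
        fix i
        let ?h = "\<lambda>t. lin i \<theta> + (t - \<theta> j) * x i j"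
        have h: "(?h has_real_derivative x i j) (at (\<theta> j))" by (auto intro!: derivative_eq_intros)
        have "((\<lambda>t. l (?h t)) has_real_derivative l1 (lin i \<theta>) * x i j) (at (\<theta> j))"
          using DERIV_chain2[OF l_deriv h] by simp
        from DERIV_diff[OF this DERIV_cmult[OF h, of "y i"]]
        show "((\<lambda>t. l (?h t) - y i * ?h t) has_real_derivative (l1 (lin i \<theta>) - y i) * x i j) (at (\<theta> j))"
          by (simp add: left_diff_distrib)
      qed
    qed
    moreover have "\<forall>t. \<bar>\<theta> j - t\<bar> < \<delta> \<longrightarrow> \<phi> (\<theta> j) \<le> \<phi> t"
    proof (intro allI impI)
      fix t assume t: "\<bar>\<theta> j - t\<bar> < \<delta>"
      define s where "s = t - \<theta> j"
      have s: "\<bar>s\<bar> \<le> \<delta>" "\<bar>s\<bar> \<le> 1" using t by (auto simp: s_def \<delta>_def)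
      have "(\<Sum>k<d. ((\<theta>(j := t)) k - \<theta>0 k)\<^sup>2) = (\<Sum>k<d. (\<theta> k - \<theta>0 k)\<^sup>2 + (if k = j then 2 * a * s + s\<^sup>2 else 0))"
        by (intro sum.cong) (auto simp: a_def s_def power2_eq_square algebra_simps)
      also have "\<dots> = (\<Sum>k<d. (\<theta> k - \<theta>0 k)\<^sup>2) + (2 * a * s + s\<^sup>2)" using j by (simp add: sum.distrib)
      finally have eq: "(\<Sum>k<d. ((\<theta>(j := t)) k - \<theta>0 k)\<^sup>2) = (\<Sum>k<d. (\<theta> k - \<theta>0 k)\<^sup>2) + (2 * a * s + s\<^sup>2)" .
      have "s\<^sup>2 \<le> 1 * \<bar>s\<bar>" using mult_right_mono[OF s(2), of "\<bar>s\<bar>"] by (simp add: power2_eq_square)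
      moreover have "a * s \<le> \<bar>a\<bar> * \<bar>s\<bar>" by (simp add: abs_mult[symmetric])
      ultimately have "2 * a * s + s\<^sup>2 \<le> (1 + 2 * \<bar>a\<bar>) * \<bar>s\<bar>" by (simp add: algebra_simps)
      also have "\<dots> \<le> (1 + 2 * \<bar>a\<bar>) * ((r\<^sup>2 - (\<Sum>j<d. (\<theta> j - \<theta>0 j)\<^sup>2)) / (1 + 2 * \<bar>a\<bar>))"
        using s(1) unfolding \<delta>_def by (intro mult_left_mono) auto
      also have "\<dots> = r\<^sup>2 - (\<Sum>j<d. (\<theta> j - \<theta>0 j)\<^sup>2)" by (simp add: add_pos_nonneg less_imp_neq[symmetric])
      finally have "(\<Sum>k<d. ((\<theta>(j := t)) k - \<theta>0 k)\<^sup>2) \<le> r\<^sup>2" using eq by linarith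
      then have "\<theta>(j := t) \<in> ?K" using \<theta> j by auto
      then show "\<phi> (\<theta> j) \<le> \<phi> t" unfolding \<phi>_def using min by simp
    qed
    ultimately show ?thesis using DERIV_local_min[OF _ \<delta>] by blast
  qed
  then show "\<exists>\<theta>. \<forall>j<d. G j \<theta> = 0" by blast
qed

section \<open>Uniform curvature of the loss\<close>

text \<open>For an observation p, \<open>x p\<close> will be its covariate and \<open>z0 p\<close>
  the linear index X . \<theta>0. The hypothesis \<open>curvature\<close> is the eigenvalue bound
  for E[X X^T l''(X . \<theta>0)] in the form of a quadratic form.\<close>

locale glm_moments = weak_moments P d x q K + smooth_convex l l1 l2 l3 b1
  for P :: "'b measure" and d x q K l l1 l2 l3 b1 +
  fixes z0 :: "'b \<Rightarrow> real" and lamV :: real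
  assumes z0_measurable [measurable]: "z0 \<in> borel_measurable P"
    and lamV: "lamV > 0"
    and curvature: "\<And>u. lamV * (\<Sum>j<d. (u j)\<^sup>2) \<le> (\<integral>p. l2 (z0 p) * (\<Sum>j<d. u j * x p j)\<^sup>2 \<partial>P)"
begin

text \<open>The two truncations have different purposes. The norm is bounded to keep the trace paid
  in the rounding of order d per observation; the linear form is bounded so that Hoeffding's
  inequality applies and the cubic remainder is dominated by the quadratic term. Division by
  \<rho>^2 makes the range independent of \<rho>.\<close>

definition truncated_excess :: "real \<Rightarrow> real \<Rightarrow> real \<Rightarrow> (nat \<Rightarrow> real) \<Rightarrow> 'b \<Rightarrow> real" where
  "truncated_excess Mr B \<rho> \<gamma> p = (if sqn p \<le> Mr\<^sup>2 * d \<and> \<bar>\<Sum>j<d. \<gamma> j * x p j\<bar> \<le> B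
     then excess (z0 p) (\<rho> * (\<Sum>j<d. \<gamma> j * x p j)) / \<rho>\<^sup>2 else 0)"

lemma truncated_excess_measurable [measurable]: "truncated_excess Mr B \<rho> \<gamma> \<in> borel_measurable P"
  unfolding truncated_excess_def excess_def by measurable

lemma truncated_excess_nonneg: "truncated_excess Mr B \<rho> \<gamma> p \<ge> 0"
  by (simp add: truncated_excess_def excess_nonneg)

lemma truncated_excess_le:
  assumes "\<rho> > 0" "B \<ge> 0"
  shows "truncated_excess Mr B \<rho> \<gamma> p \<le> b1 * B\<^sup>2 / 2"
proof (cases "sqn p \<le> Mr\<^sup>2 * d \<and> \<bar>\<Sum>j<d. \<gamma> j * x p j\<bar> \<le> B")
  case True
  let ?t = "\<Sum>j<d. \<gamma> j * x p j"
  have "?t\<^sup>2 \<le> B\<^sup>2" using True assms by (simp add: abs_le_square_iff[symmetric])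
  have "excess (z0 p) (\<rho> * ?t) \<le> b1 * ?t\<^sup>2 / 2 * \<rho>\<^sup>2"
    using excess_bounds(1)[of "z0 p" "\<rho> * ?t"] by (simp add: power_mult_distrib algebra_simps)
  then have "excess (z0 p) (\<rho> * ?t) / \<rho>\<^sup>2 \<le> b1 * ?t\<^sup>2 / 2" using assms by (simp add: pos_divide_le_eq)
  also have "\<dots> \<le> b1 * B\<^sup>2 / 2" using \<open>?t\<^sup>2 \<le> B\<^sup>2\<close> b1 by simp
  finally show ?thesis using True by (simp add: truncated_excess_def)
next
  case False
  then have "truncated_excess Mr B \<rho> \<gamma> p = 0" unfolding truncated_excess_def by (rule if_not_P)
  then show ?thesis using b1 by simp
qed

text \<open>Half of the curvature lamV / 4 available at |\<gamma>|^2 >= 1/4 remains after three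
  losses: observations of large norm, large values of the linear form, and the cubic Taylor
  remainder. The factors 2^q and 4 come from |\<gamma>| <= 2.\<close>

lemma expectation_truncated_excess_ge:
  assumes \<gamma>: "1 / 4 \<le> (\<Sum>j<d. (\<gamma> j)\<^sup>2)" "(\<Sum>j<d. (\<gamma> j)\<^sup>2) \<le> 4"
    and B: "B \<ge> 1" and Mr: "Mr \<ge> 1" and \<rho>: "\<rho> > 0"
  shows "lamV / 8 - b1 / 2 * (B\<^sup>2 * (K / Mr powr q) + 2 powr q * K / B powr (q - 2))
    - b1 * \<rho> * B / 6 * (4 * (1 + K)) \<le> (\<integral>p. truncated_excess Mr B \<rho> \<gamma> p \<partial>P)"
proof -
  define t where "t = (\<lambda>p. \<Sum>j<d. \<gamma> j * x p j)"
  have [measurable]: "t \<in> borel_measurable P" unfolding t_def by measurable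
  define u where "u = (\<lambda>j. \<gamma> j / 2)"
  have u: "(\<Sum>j<d. (u j)\<^sup>2) \<le> 1"
    using \<gamma>(2) by (simp add: u_def power_divide sum_divide_distrib[symmetric])
  have tu: "t p = 2 * (\<Sum>j<d. u j * x p j)" for p
    by (simp add: t_def u_def sum_divide_distrib[symmetric])
  have t2: "integrable P (\<lambda>p. (t p)\<^sup>2)" "(\<integral>p. (t p)\<^sup>2 \<partial>P) \<le> 4 * (1 + K)"
    using square_integrable[OF u] square_le[OF u] by (auto simp: tu power_mult_distrib)
  have tq: "integrable P (\<lambda>p. \<bar>t p\<bar> powr q)" "(\<integral>p. \<bar>t p\<bar> powr q \<partial>P) \<le> 2 powr q * K"
    using moment_integrable[OF u] moment_le[OF u] by (auto simp: tu abs_mult powr_mult)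
  have a: "integrable P (\<lambda>p. l2 (z0 p) * (t p)\<^sup>2)"
  proof (rule Bochner_Integration.integrable_bound)
    show "integrable P (\<lambda>p. b1 * (t p)\<^sup>2)" using t2 by simp
    show "AE p in P. norm (l2 (z0 p) * (t p)\<^sup>2) \<le> norm (b1 * (t p)\<^sup>2)"
      using l2_bound b1 by (intro AE_I2) (auto simp: abs_mult intro!: mult_right_mono)
  qed measurable
  have a_ge: "lamV / 4 \<le> (\<integral>p. l2 (z0 p) * (t p)\<^sup>2 \<partial>P)"
  proof -
    have "lamV / 4 \<le> lamV * (\<Sum>j<d. (\<gamma> j)\<^sup>2)" using \<gamma>(1) lamV mult_left_mono[OF \<gamma>(1), of lamV] by simp
    then show ?thesis using curvature[of \<gamma>] unfolding t_def by linarith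
  qed
  define T where "T = Mr * sqrt d"
  have T: "T > 0" using Mr d by (simp add: T_def)
  have T2: "T\<^sup>2 = Mr\<^sup>2 * d" by (simp add: T_def power_mult_distrib)
  let ?big = "{p \<in> space P. T\<^sup>2 < sqn p}"
  have big: "?big \<in> sets P" by measurable
  have ind: "integrable P (indicator ?big :: _ \<Rightarrow> real)" using big by (simp add: emeasure_eq_measure)
  have tail: "measure P ?big \<le> K / Mr powr q"
  proof -
    have "measure P ?big \<le> real d powr (q / 2) * K / T powr q" by (rule norm_tail[OF T])
    also have "T powr q = Mr powr q * real d powr (q / 2)"
      using Mr unfolding T_def by (simp add: powr_mult powr_powr powr_half_sqrt[symmetric])
    finally show ?thesis using d by simp
  qed
  \<comment> \<open>A pointwise minorant: on the retained observations it is Taylor's lower bound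
    less a nonnegative term; on the discarded ones the bracket is at least t^2, which makes
    \<open>G\<close> nonpositive.\<close>
  define G where "G = (\<lambda>p. l2 (z0 p) * (t p)\<^sup>2 / 2 - b1 / 2 * (B\<^sup>2 * indicator ?big p + \<bar>t p\<bar> powr q / B powr (q - 2))
      - b1 * \<rho> * B / 6 * (t p)\<^sup>2)"
  have pw: "G p \<le> truncated_excess Mr B \<rho> \<gamma> p" if p: "p \<in> space P" for p
  proof (cases "sqn p \<le> Mr\<^sup>2 * d \<and> \<bar>t p\<bar> \<le> B")
    case True
    have "l2 (z0 p) * (\<rho> * t p)\<^sup>2 / 2 - b1 * \<bar>\<rho> * t p\<bar> ^ 3 / 6 \<le> excess (z0 p) (\<rho> * t p)" by (rule excess_bounds)
    moreover have "\<bar>\<rho> * t p\<bar> ^ 3 \<le> \<rho> * B * (t p)\<^sup>2 * \<rho>\<^sup>2"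
    proof -
      have "\<bar>\<rho> * t p\<bar> ^ 3 = (\<rho> * \<rho>\<^sup>2 * (t p)\<^sup>2) * \<bar>t p\<bar>"
        using \<rho> by (simp add: abs_mult power3_eq_cube power2_eq_square algebra_simps)
      also have "\<dots> \<le> (\<rho> * \<rho>\<^sup>2 * (t p)\<^sup>2) * B" using True \<rho> by (intro mult_left_mono) auto
      finally show ?thesis by (simp add: algebra_simps)
    qed
    then have "b1 * \<bar>\<rho> * t p\<bar> ^ 3 \<le> b1 * (\<rho> * B * (t p)\<^sup>2 * \<rho>\<^sup>2)" using b1 by (intro mult_left_mono) auto
    ultimately have *: "(l2 (z0 p) * (t p)\<^sup>2 / 2 - b1 * \<rho> * B / 6 * (t p)\<^sup>2) * \<rho>\<^sup>2 \<le> excess (z0 p) (\<rho> * t p)"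
      by (simp add: power_mult_distrib algebra_simps)
    have "l2 (z0 p) * (t p)\<^sup>2 / 2 - b1 * \<rho> * B / 6 * (t p)\<^sup>2 \<le> truncated_excess Mr B \<rho> \<gamma> p"
    proof -
      have "truncated_excess Mr B \<rho> \<gamma> p = excess (z0 p) (\<rho> * t p) / \<rho>\<^sup>2"
        using True unfolding truncated_excess_def t_def by (rule if_P)
      then show ?thesis using * \<rho> by (simp add: pos_le_divide_eq)
    qed
    moreover have "0 \<le> b1 / 2 * (B\<^sup>2 * indicator ?big p + \<bar>t p\<bar> powr q / B powr (q - 2))" using b1 by simp
    ultimately show ?thesis unfolding G_def by linarith
  next
    case False
    \<comment> \<open>A discarded observation either has |t| <= B and a large norm, so that the
      indicator is 1, or |t| > B, and then t^2 <= |t|^q / B^(q-2).\<close>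
    have "(t p)\<^sup>2 \<le> B\<^sup>2 * indicator ?big p + \<bar>t p\<bar> powr q / B powr (q - 2)"
    proof (cases "\<bar>t p\<bar> \<le> B")
      case True
      then have "p \<in> ?big" using False p T2 by simp
      moreover have "(t p)\<^sup>2 \<le> B\<^sup>2" using True B by (simp add: abs_le_square_iff[symmetric])
      ultimately show ?thesis by (simp add: add_increasing2)
    next
      case F: False
      have "(t p)\<^sup>2 * B powr (q - 2) \<le> (t p)\<^sup>2 * \<bar>t p\<bar> powr (q - 2)"
        using F B q by (intro mult_left_mono powr_mono2) auto
      also have "(t p)\<^sup>2 = \<bar>t p\<bar> powr 2" by (simp add: powr_numeral)
      also have "\<bar>t p\<bar> powr 2 * \<bar>t p\<bar> powr (q - 2) = \<bar>t p\<bar> powr q" by (simp only: powr_add[symmetric]) simp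
      finally have "(t p)\<^sup>2 \<le> \<bar>t p\<bar> powr q / B powr (q - 2)" using B by (simp add: pos_le_divide_eq powr_numeral)
      then show ?thesis by (simp add: add_increasing)
    qed
    then have "b1 / 2 * (t p)\<^sup>2 \<le> b1 / 2 * (B\<^sup>2 * indicator ?big p + \<bar>t p\<bar> powr q / B powr (q - 2))"
      using b1 by (intro mult_left_mono) auto
    moreover have "l2 (z0 p) * (t p)\<^sup>2 \<le> b1 * (t p)\<^sup>2" using l2_bound[of "z0 p"] by (intro mult_right_mono) auto
    moreover have "0 \<le> b1 * \<rho> * B / 6 * (t p)\<^sup>2" using b1 \<rho> B by simp
    ultimately have "G p \<le> 0" unfolding G_def by linarith
    then show ?thesis using truncated_excess_nonneg[of Mr B \<rho> \<gamma> p] by linarith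
  qed
  have G_int: "integrable P G" unfolding G_def using a t2 tq ind by auto
  have W_int: "integrable P (truncated_excess Mr B \<rho> \<gamma>)"
    using truncated_excess_le[OF \<rho>, of B Mr \<gamma>] truncated_excess_nonneg B by (intro integrable_const_bound[of _ "b1 * B\<^sup>2 / 2"]) (auto intro!: AE_I2)
  have "(\<integral>p. G p \<partial>P) = (\<integral>p. l2 (z0 p) * (t p)\<^sup>2 \<partial>P) / 2
      - b1 / 2 * (B\<^sup>2 * measure P ?big + (\<integral>p. \<bar>t p\<bar> powr q \<partial>P) / B powr (q - 2))
      - b1 * \<rho> * B / 6 * (\<integral>p. (t p)\<^sup>2 \<partial>P)"
    unfolding G_def using a t2 tq ind big by simp
  moreover have "b1 / 2 * (B\<^sup>2 * measure P ?big + (\<integral>p. \<bar>t p\<bar> powr q \<partial>P) / B powr (q - 2))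
      \<le> b1 / 2 * (B\<^sup>2 * (K / Mr powr q) + 2 powr q * K / B powr (q - 2))"
    using tail tq b1 by (intro mult_left_mono add_mono divide_right_mono) auto
  moreover have "b1 * \<rho> * B / 6 * (\<integral>p. (t p)\<^sup>2 \<partial>P) \<le> b1 * \<rho> * B / 6 * (4 * (1 + K))"
    using t2 b1 \<rho> B by (intro mult_left_mono) auto
  moreover have "(\<integral>p. G p \<partial>P) \<le> (\<integral>p. truncated_excess Mr B \<rho> \<gamma> p \<partial>P)"
    by (intro integral_mono G_int W_int pw)
  ultimately show ?thesis using a_ge by linarith
qed

text \<open>Hoeffding's inequality for variables in [0, b] with b = b1 B^2 / 2, at deviation c below
  a mean of at least 2 c; the exponent 2 c^2 / b^2 per observation equals 8 c^2 / (b1^2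
  B^4).\<close>

lemma truncated_excess_average_tail:
  fixes c :: real
  assumes M: "prob_space M" and I: "finite I" "I \<noteq> {}"
    and indep: "prob_space.indep_vars M (\<lambda>_. N) D I" and distr: "\<And>i. i \<in> I \<Longrightarrow> distr M N (D i) = P"
    and \<rho>: "\<rho> > 0" and B: "B \<ge> 1" and c: "c > 0" "2 * c \<le> (\<integral>p. truncated_excess Mr B \<rho> \<gamma> p \<partial>P)"
  shows "measure M {\<omega> \<in> space M. (\<Sum>i\<in>I. truncated_excess Mr B \<rho> \<gamma> (D i \<omega>)) \<le> card I * c}
    \<le> exp (- (8 * c\<^sup>2 / (b1\<^sup>2 * B ^ 4) * card I))"
proof -
  interpret M: prob_space M by (rule M)
  obtain i0 where i0: "i0 \<in> I" using I by auto
  have setsP: "sets P = sets N" using distr[OF i0] by (metis sets_distr)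
  have WN: "truncated_excess Mr B \<rho> \<gamma> \<in> borel_measurable N" using truncated_excess_measurable measurable_cong_sets[OF setsP refl] by blast
  have D: "D i \<in> measurable M N" if "i \<in> I" for i using indep that unfolding M.indep_vars_def by auto
  define b where "b = b1 * B\<^sup>2 / 2"
  have b: "b > 0" using b1 B by (simp add: b_def)
  let ?X = "\<lambda>i \<omega>. truncated_excess Mr B \<rho> \<gamma> (D i \<omega>)"
  have dd: "distr M borel (?X i) = distr P borel (truncated_excess Mr B \<rho> \<gamma>)" if "i \<in> I" for i
    using distr_distr[OF WN D[OF that]] distr[OF that] by (simp add: comp_def)
  interpret H: Hoeffding_ineq_iid M I ?X "?X i0" 0 b "M.expectation (?X i0)"
  proof unfold_locales
    show "finite I" by (rule I)
    show "M.indep_vars (\<lambda>_. borel) ?X I"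
      using M.indep_vars_compose2[OF indep, of "\<lambda>_. truncated_excess Mr B \<rho> \<gamma>" "\<lambda>_. borel"] WN by simp
    show "distr M borel (?X i) = distr M borel (?X i0)" if "i \<in> I" for i
      using dd[OF that] dd[OF i0] by simp
    show "M.random_variable borel (?X i0)" using measurable_compose[OF D[OF i0] WN] .
    show "AE \<omega> in M. ?X i0 \<omega> \<in> {0..b}"
      using truncated_excess_nonneg truncated_excess_le[OF \<rho>, of B] B unfolding b_def by (intro AE_I2) auto
  qed simp
  have \<mu>: "M.expectation (?X i0) = (\<integral>p. truncated_excess Mr B \<rho> \<gamma> p \<partial>P)"
    using integral_distr[OF D[OF i0] WN] distr[OF i0] by simp
  have m: "card I > 0" using I by (simp add: card_gt_0_iff)
  have "measure M {\<omega> \<in> space M. (\<Sum>i\<in>I. ?X i \<omega>) / card I \<le> M.expectation (?X i0) - c}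
      \<le> exp (- 2 * card I * c\<^sup>2 / (b - 0)\<^sup>2)"
    using H.Hoeffding_ineq_le'[of c] c b I by simp
  also have "- 2 * card I * c\<^sup>2 / (b - 0)\<^sup>2 = - (8 * c\<^sup>2 / (b1\<^sup>2 * B ^ 4) * card I)"
    using b1 B by (simp add: b_def power_divide power_mult_distrib field_simps power_mult[symmetric])
  finally have le: "measure M {\<omega> \<in> space M. (\<Sum>i\<in>I. ?X i \<omega>) / card I \<le> M.expectation (?X i0) - c}
      \<le> exp (- (8 * c\<^sup>2 / (b1\<^sup>2 * B ^ 4) * card I))" .
  have meas: "?X i \<in> borel_measurable M" if "i \<in> I" for i using measurable_compose[OF D[OF that] WN] .
  have "{\<omega> \<in> space M. (\<Sum>i\<in>I. ?X i \<omega>) \<le> card I * c} \<subseteq> {\<omega> \<in> space M. (\<Sum>i\<in>I. ?X i \<omega>) / card I \<le> M.expectation (?X i0) - c}"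
  proof safe
    fix \<omega> assume "(\<Sum>i\<in>I. ?X i \<omega>) \<le> card I * c"
    then have "(\<Sum>i\<in>I. ?X i \<omega>) / card I \<le> c" using m by (simp add: pos_divide_le_eq mult.commute)
    then show "(\<Sum>i\<in>I. ?X i \<omega>) / card I \<le> M.expectation (?X i0) - c" using c(2) \<mu> by linarith
  qed
  moreover have "{\<omega> \<in> space M. (\<Sum>i\<in>I. ?X i \<omega>) / card I \<le> M.expectation (?X i0) - c} \<in> sets M"
  proof -
    have "(\<lambda>\<omega>. \<Sum>i\<in>I. ?X i \<omega>) \<in> borel_measurable M" using meas by (rule borel_measurable_sum)
    then show ?thesis by measurable
  qed
  ultimately have "measure M {\<omega> \<in> space M. (\<Sum>i\<in>I. ?X i \<omega>) \<le> card I * c}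
      \<le> measure M {\<omega> \<in> space M. (\<Sum>i\<in>I. ?X i \<omega>) / card I \<le> M.expectation (?X i0) - c}"
    by (rule M.finite_measure_mono)
  then show ?thesis using le by linarith
qed

end

text \<open>The exceptional event is a union over the finite net, while the conclusion concerns all
  directions at once. Of the mean 2 c, Hoeffding's inequality costs c and the rounding c / 2,
  leaving c / 2.\<close>

lemma (in glm_moments) curvature_on_sphere:
  fixes c \<eta> :: real and Nt :: "(nat \<Rightarrow> real) set"
  assumes M: "prob_space M" and I: "finite (I :: 'i set)" "I \<noteq> {}"
    and indep: "prob_space.indep_vars M (\<lambda>_. N) D I" and distr: "\<And>i. i \<in> I \<Longrightarrow> distr M N (D i) = P"
    and B: "B \<ge> 1" and Mr: "Mr \<ge> 1" and \<rho>: "\<rho> > 0" and c: "c > 0"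
    and const: "2 * c \<le> lamV / 8 - b1 / 2 * (B\<^sup>2 * (K / Mr powr q) + 2 powr q * K / B powr (q - 2))
      - b1 * \<rho> * B / 6 * (4 * (1 + K))"
    and \<eta>: "b1 * \<eta>\<^sup>2 * Mr\<^sup>2 / 8 \<le> c / 2"
    and net: "rounding_net I d \<eta> Nt"
  shows "\<exists>E\<in>sets M. measure M E \<le> card Nt * exp (- (8 * c\<^sup>2 / (b1\<^sup>2 * B ^ 4) * card I)) \<and>
    (\<forall>\<omega>\<in>space M - E. \<forall>u. (\<Sum>j<d. (u j)\<^sup>2) = 1 \<longrightarrow>
      card I * (c / 2) * \<rho>\<^sup>2 < (\<Sum>i\<in>I. excess (z0 (D i \<omega>)) (\<rho> * (\<Sum>j<d. x (D i \<omega>) j * u j))))"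
proof -
  interpret M: prob_space M by (rule M)
  note Nt_fin = net[unfolded rounding_net_def, THEN conjunct1]
    and Nt_norm = net[unfolded rounding_net_def, THEN conjunct2, THEN conjunct1, THEN bspec]
    and net_round = net[unfolded rounding_net_def, THEN conjunct2, THEN conjunct2]
  obtain i0 where i0: "i0 \<in> I" using I by auto
  have setsP: "sets P = sets N" using distr[OF i0] by (metis sets_distr)
  have WN: "truncated_excess Mr B \<rho> \<gamma> \<in> borel_measurable N" for \<gamma> using truncated_excess_measurable measurable_cong_sets[OF setsP refl] by blast
  have D: "D i \<in> measurable M N" if "i \<in> I" for i using indep that unfolding M.indep_vars_def by auto
  define bad where "bad = (\<lambda>\<gamma>. {\<omega> \<in> space M. (\<Sum>i\<in>I. truncated_excess Mr B \<rho> \<gamma> (D i \<omega>)) \<le> card I * c})"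
  have bad_meas: "bad \<gamma> \<in> sets M" for \<gamma>
  proof -
    have "(\<lambda>\<omega>. \<Sum>i\<in>I. truncated_excess Mr B \<rho> \<gamma> (D i \<omega>)) \<in> borel_measurable M"
      using measurable_compose[OF D WN] by (rule borel_measurable_sum)
    then show ?thesis unfolding bad_def by measurable
  qed
  have bad_le: "measure M (bad \<gamma>) \<le> exp (- (8 * c\<^sup>2 / (b1\<^sup>2 * B ^ 4) * card I))" if "\<gamma> \<in> Nt" for \<gamma>
  proof -
    have "2 * c \<le> (\<integral>p. truncated_excess Mr B \<rho> \<gamma> p \<partial>P)"
      using expectation_truncated_excess_ge[of \<gamma> B Mr \<rho>] Nt_norm[OF that] B Mr \<rho> const by linarith
    then show ?thesis unfolding bad_def by (intro truncated_excess_average_tail[OF M I indep distr \<rho> B c]) auto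
  qed
  define E where "E = (\<Union>\<gamma>\<in>Nt. bad \<gamma>)"
  have E: "E \<in> sets M" unfolding E_def using Nt_fin bad_meas by (intro sets.finite_UN) auto
  have "measure M E \<le> (\<Sum>\<gamma>\<in>Nt. measure M (bad \<gamma>))" unfolding E_def by (rule measure_UNION_le[OF Nt_fin bad_meas])
  also have "\<dots> \<le> (\<Sum>\<gamma>\<in>Nt. exp (- (8 * c\<^sup>2 / (b1\<^sup>2 * B ^ 4) * card I)))" using bad_le by (intro sum_mono) auto
  also have "\<dots> = card Nt * exp (- (8 * c\<^sup>2 / (b1\<^sup>2 * B ^ 4) * card I))" by simp
  finally have mE: "measure M E \<le> card Nt * exp (- (8 * c\<^sup>2 / (b1\<^sup>2 * B ^ 4) * card I))" .
  have main: "card I * (c / 2) * \<rho>\<^sup>2 < (\<Sum>i\<in>I. excess (z0 (D i \<omega>)) (\<rho> * (\<Sum>j<d. x (D i \<omega>) j * u j)))"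
    if \<omega>: "\<omega> \<in> space M - E" and u: "(\<Sum>j<d. (u j)\<^sup>2) = 1" for \<omega> u
  proof -
    define f where "f = (\<lambda>i s. excess (z0 (D i \<omega>)) (\<rho> * s))"
    define f' where "f' = (\<lambda>i s. (l1 (z0 (D i \<omega>) + \<rho> * s) - l1 (z0 (D i \<omega>))) * \<rho>)"
    \<comment> \<open>Only the truncation of the norm, which does not involve the direction, enters
      the weights. A cutoff of the linear form would destroy the quadratic upper bound on f; it is
      dropped by nonnegativity of the excess before the rounding is applied.\<close>
    define w where "w = (\<lambda>i. if sqn (D i \<omega>) \<le> Mr\<^sup>2 * d then 1 else 0 :: real)"
    let ?x = "\<lambda>i. x (D i \<omega>)"
    have smooth: "\<forall>i\<in>I. \<forall>t s. f i (t + s) \<le> f i t + f' i t * s + (b1 * \<rho>\<^sup>2) * s\<^sup>2 / 2"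
    proof (intro ballI allI)
      fix i t s
      show "f i (t + s) \<le> f i t + f' i t * s + (b1 * \<rho>\<^sup>2) * s\<^sup>2 / 2"
        using excess_add[of "z0 (D i \<omega>)" "\<rho> * t" "\<rho> * s"]
        by (simp add: f_def f'_def distrib_left power_mult_distrib mult.assoc)
    qed
    have w: "\<forall>i\<in>I. w i \<ge> 0" by (simp add: w_def)
    have b\<rho>: "b1 * \<rho>\<^sup>2 \<ge> 0" using b1 by simp
    obtain \<gamma> where g: "\<gamma> \<in> Nt" and le: "(\<Sum>i\<in>I. w i * f i (\<Sum>j<d. \<gamma> j * ?x i j)) \<le> (\<Sum>i\<in>I. w i * f i (\<Sum>j<d. u j * ?x i j))
        + (b1 * \<rho>\<^sup>2) * \<eta>\<^sup>2 / (8 * d) * (\<Sum>i\<in>I. w i * (\<Sum>j<d. (?x i j)\<^sup>2))"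
      using net_round[THEN spec, THEN spec, THEN spec,
        THEN spec, THEN spec, THEN spec[of _ ?x], THEN mp, THEN mp, THEN mp, THEN mp, OF u b\<rho> w smooth] by blast
    have m: "real (card I) > 0" using I by (simp add: card_gt_0_iff)
    have "card I * c < (\<Sum>i\<in>I. truncated_excess Mr B \<rho> \<gamma> (D i \<omega>))"
      using \<omega> g by (auto simp: E_def bad_def not_le)
    also have "\<dots> \<le> (\<Sum>i\<in>I. w i * f i (\<Sum>j<d. \<gamma> j * ?x i j) / \<rho>\<^sup>2)"
      using \<rho> by (intro sum_mono) (auto simp: truncated_excess_def w_def f_def excess_nonneg)
    also have "\<dots> = (\<Sum>i\<in>I. w i * f i (\<Sum>j<d. \<gamma> j * ?x i j)) / \<rho>\<^sup>2" by (simp add: sum_divide_distrib)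
    finally have 1: "card I * c * \<rho>\<^sup>2 < (\<Sum>i\<in>I. w i * f i (\<Sum>j<d. \<gamma> j * ?x i j))"
      using \<rho> by (simp add: pos_less_divide_eq)
    have "(\<Sum>i\<in>I. w i * (\<Sum>j<d. (?x i j)\<^sup>2)) \<le> (\<Sum>i\<in>I. Mr\<^sup>2 * d)"
      by (intro sum_mono) (auto simp: w_def sqn_def)
    then have "(b1 * \<rho>\<^sup>2) * \<eta>\<^sup>2 / (8 * d) * (\<Sum>i\<in>I. w i * (\<Sum>j<d. (?x i j)\<^sup>2))
        \<le> (b1 * \<rho>\<^sup>2) * \<eta>\<^sup>2 / (8 * d) * (card I * (Mr\<^sup>2 * d))"
      using b\<rho> by (intro mult_left_mono) auto
    also have "\<dots> = (b1 * \<eta>\<^sup>2 * Mr\<^sup>2 / 8) * (card I * \<rho>\<^sup>2)" using d by (simp add: field_simps)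
    also have "\<dots> \<le> c / 2 * (card I * \<rho>\<^sup>2)" using \<eta> by (intro mult_right_mono) auto
    finally have 2: "(b1 * \<rho>\<^sup>2) * \<eta>\<^sup>2 / (8 * d) * (\<Sum>i\<in>I. w i * (\<Sum>j<d. (?x i j)\<^sup>2)) \<le> c / 2 * (card I * \<rho>\<^sup>2)" .
    have "(\<Sum>i\<in>I. w i * f i (\<Sum>j<d. u j * ?x i j)) \<le> (\<Sum>i\<in>I. f i (\<Sum>j<d. u j * ?x i j))"
      by (intro sum_mono) (auto simp: w_def f_def excess_nonneg)
    moreover have "card I * (c / 2) * \<rho>\<^sup>2 = card I * c * \<rho>\<^sup>2 - c / 2 * (card I * \<rho>\<^sup>2)" by simp
    ultimately have "card I * (c / 2) * \<rho>\<^sup>2 < (\<Sum>i\<in>I. f i (\<Sum>j<d. u j * ?x i j))"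
      using 1 2 le by linarith
    then show ?thesis by (simp add: f_def mult.commute)
  qed
  show ?thesis using E mE main by blast
qed

section \<open>Choice of the truncation levels\<close>

lemma exists_powr_large:
  fixes X Y p :: real
  assumes "X \<ge> 0" "Y > 0" "p > 0"
  shows "\<exists>B\<ge>1. X / B powr p \<le> Y"
proof -
  define B where "B = (X / Y + 1) powr (1 / p)"
  have 1: "X / Y + 1 \<ge> 1" using assms by simp
  have B: "B \<ge> 1" unfolding B_def using 1 assms by (intro ge_one_powr_ge_zero) auto
  have "B powr p = X / Y + 1" unfolding B_def using assms 1 by (simp add: powr_powr)
  then have "X \<le> Y * B powr p" using assms by (simp add: field_simps)
  then have "X / B powr p \<le> Y" using B by (simp add: pos_divide_le_eq)
  then show ?thesis using B by blast
qed

text \<open>The order of the choices matters: B first, then Mr depending on B, then the radius. The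
  three losses are allotted lamV / 64, lamV / 64 and lamV / 32, together half of lamV / 8.\<close>

lemma truncation_constants:
  fixes b1 K q lamV :: real
  assumes "b1 > 0" "K \<ge> 1" "q > 2" "lamV > 0"
  shows "\<exists>B\<ge>1. \<exists>Mr\<ge>1. \<exists>\<rho>0>0. \<forall>\<rho>. 0 < \<rho> \<longrightarrow> \<rho> \<le> \<rho>0 \<longrightarrow>
    lamV / 16 \<le> lamV / 8 - b1 / 2 * (B\<^sup>2 * (K / Mr powr q) + 2 powr q * K / B powr (q - 2))
      - b1 * \<rho> * B / 6 * (4 * (1 + K))"
proof -
  obtain B where B: "B \<ge> 1" "(b1 / 2 * (2 powr q * K)) / B powr (q - 2) \<le> lamV / 64"
    using exists_powr_large[of "b1 / 2 * (2 powr q * K)" "lamV / 64" "q - 2"] assms by auto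
  obtain Mr where Mr: "Mr \<ge> 1" "(b1 / 2 * (B\<^sup>2 * K)) / Mr powr q \<le> lamV / 64"
    using exists_powr_large[of "b1 / 2 * (B\<^sup>2 * K)" "lamV / 64" q] assms by auto
  define X where "X = b1 * B / 6 * (4 * (1 + K))"
  have X: "X > 0" using assms B by (simp add: X_def)
  have "lamV / 16 \<le> lamV / 8 - b1 / 2 * (B\<^sup>2 * (K / Mr powr q) + 2 powr q * K / B powr (q - 2))
      - b1 * \<rho> * B / 6 * (4 * (1 + K))" if "0 < \<rho>" "\<rho> \<le> lamV / 32 / X" for \<rho>
  proof -
    have "b1 * \<rho> * B / 6 * (4 * (1 + K)) = \<rho> * X" by (simp add: X_def)
    also have "\<dots> \<le> lamV / 32" using that X by (simp add: pos_le_divide_eq)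
    finally have 1: "b1 * \<rho> * B / 6 * (4 * (1 + K)) \<le> lamV / 32" .
    have "b1 / 2 * (B\<^sup>2 * (K / Mr powr q) + 2 powr q * K / B powr (q - 2))
      = (b1 / 2 * (B\<^sup>2 * K)) / Mr powr q + (b1 / 2 * (2 powr q * K)) / B powr (q - 2)"
      by (simp add: distrib_left)
    then show ?thesis using 1 B(2) Mr(2) by linarith
  qed
  moreover have "lamV / 32 / X > 0" using assms X by simp
  ultimately show ?thesis using B(1) Mr(1) by blast
qed

section \<open>Generalized linear regression\<close>

text \<open>Independence with common law P means that the joint law of the sample is the product
  measure, on which \<open>fuk_nagaev\<close> was proved.\<close>

lemma (in centered_weak_moments) fuk_nagaev_indep:
  fixes I :: "'i set"
  assumes M: "prob_space M" and I: "finite I" "I \<noteq> {}"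
    and indep: "prob_space.indep_vars M (\<lambda>_. N) D I" and distr: "\<And>i. i \<in> I \<Longrightarrow> distr M N (D i) = P"
    and eps: "0 < eps" "eps < 1"
  defines "m \<equiv> real (card I)"
  defines "C \<equiv> fuk_nagaev_const q K"
  defines "E \<equiv> {\<omega> \<in> space M.
      m * (C * (sqrt ((d + ln (2 / eps)) / m) + sqrt d / (m powr (1 - 1 / q) * eps powr (1 / q))))
        < sqrt (\<Sum>j<d. (\<Sum>i\<in>I. z (D i \<omega>) j)\<^sup>2)}"
  shows "E \<in> sets M" "measure M E \<le> eps / 2"
proof -
  interpret M: prob_space M by (rule M)
  let ?Q = "PiM I (\<lambda>_. P)" and ?D = "\<lambda>\<omega>. \<lambda>i\<in>I. D i \<omega>"
  have D: "D i \<in> measurable M N" if "i \<in> I" for i using indep that unfolding M.indep_vars_def by auto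
  have "M.indep_vars (\<lambda>_. N) D I \<longleftrightarrow> distr M (PiM I (\<lambda>_. N)) ?D = PiM I (\<lambda>i. distr M N (D i))"
    by (rule M.indep_vars_iff_distr_eq_PiM'[OF I(2) D])
  with indep have "distr M (PiM I (\<lambda>_. N)) ?D = PiM I (\<lambda>i. distr M N (D i))" by blast
  also have "\<dots> = ?Q" by (intro PiM_cong distr) auto
  finally have DQ: "distr M (PiM I (\<lambda>_. N)) ?D = ?Q" .
  have Dm: "?D \<in> measurable M (PiM I (\<lambda>_. N))" using D by (intro measurable_restrict) auto
  have sets_eq: "sets ?Q = sets (PiM I (\<lambda>_. N))" using DQ by (metis sets_distr)
  then have space_eq: "space ?Q = space (PiM I (\<lambda>_. N))" by (rule sets_eq_imp_space_eq)
  let ?r = "m * (C * (sqrt ((d + ln (2 / eps)) / m) + sqrt d / (m powr (1 - 1 / q) * eps powr (1 / q))))"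
  let ?A = "{x \<in> space ?Q. ?r < sqrt (\<Sum>j<d. (\<Sum>i\<in>I. z (x i) j)\<^sup>2)}"
  have "?A \<in> sets ?Q" by measurable
  then have A: "?A \<in> sets (PiM I (\<lambda>_. N))" unfolding sets_eq .
  have E: "E = ?D -` ?A \<inter> space M"
    unfolding E_def using measurable_space[OF Dm] space_eq by auto
  show "E \<in> sets M" unfolding E by (rule measurable_sets[OF Dm A])
  have "measure M E = measure (distr M (PiM I (\<lambda>_. N)) ?D) ?A"
    unfolding E by (rule measure_distr[OF Dm A, symmetric])
  also have "\<dots> \<le> eps / 2"
    unfolding DQ using fuk_nagaev[OF I eps] unfolding m_def C_def .
  finally show "measure M E \<le> eps / 2" .
qed

lemma borel_vec_coordinate_measurable:
  assumes "j < d"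
  shows "(\<lambda>v. v $ j) \<in> borel_measurable (borel_vec d)"
proof -
  have "(\<lambda>v. \<lambda>i\<in>{..<d}. v $ i) \<in> borel_vec d \<rightarrow>\<^sub>M (\<Pi>\<^sub>M i\<in>{..<d}. borel :: real measure)"
    unfolding borel_vec_def by (rule measurable_vimage_algebra1) (auto simp: space_PiM)
  from measurable_compose[OF this measurable_component_singleton[of j]] assms
  show ?thesis by simp
qed

lemma space_borel_vec: "space (borel_vec d) = carrier_vec d"
  by (simp add: borel_vec_def space_vimage_algebra)

lemma scalar_prod_vec:
  fixes v :: "real vec"
  assumes "v \<in> carrier_vec d"
  shows "vec d u \<bullet> v = (\<Sum>j<d. u j * v $ j)"
    "w \<bullet> v = (\<Sum>j<d. w $ j * v $ j)"
  using assms by (auto simp: scalar_prod_def lessThan_atLeast0)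

lemma l2_norm_minus:
  assumes "v \<in> carrier_vec d" "w \<in> carrier_vec d"
  shows "l2_norm (v - w) = sqrt (\<Sum>j<d. (v $ j - w $ j)\<^sup>2)"
  using assms by (simp add: l2_norm_def scalar_prod_def lessThan_atLeast0 power2_eq_square)

lemma weighted_second_moment_carrier: "weighted_second_moment M d x w \<in> carrier_mat d d"
  by (simp add: weighted_second_moment_def)

lemma weighted_second_moment_symmetric:
  "transpose_mat (weighted_second_moment M d x w) = weighted_second_moment M d x w"
  by (rule eq_matI) (auto simp: weighted_second_moment_def mult.commute)

lemma weighted_second_moment_form:
  assumes int: "\<And>i j. i < d \<Longrightarrow> j < d \<Longrightarrow> integrable M (\<lambda>\<omega>. x \<omega> $ i * x \<omega> $ j * w \<omega>)"
  shows "vec d u \<bullet> (weighted_second_moment M d x w *\<^sub>v vec d u) = (\<integral>\<omega>. w \<omega> * (\<Sum>j<d. u j * x \<omega> $ j)\<^sup>2 \<partial>M)"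
proof -
  have "(\<integral>\<omega>. w \<omega> * (\<Sum>j<d. u j * x \<omega> $ j)\<^sup>2 \<partial>M)
      = (\<integral>\<omega>. (\<Sum>i<d. \<Sum>j<d. u i * u j * (x \<omega> $ i * x \<omega> $ j * w \<omega>)) \<partial>M)"
    by (simp add: power2_eq_square sum_product sum_distrib_left mult_ac)
  also have "\<dots> = (\<Sum>i<d. \<integral>\<omega>. (\<Sum>j<d. u i * u j * (x \<omega> $ i * x \<omega> $ j * w \<omega>)) \<partial>M)"
    using int by (intro Bochner_Integration.integral_sum Bochner_Integration.integrable_sum integrable_mult_right) auto
  also have "\<dots> = (\<Sum>i<d. \<Sum>j<d. u i * u j * (\<integral>\<omega>. x \<omega> $ i * x \<omega> $ j * w \<omega> \<partial>M))"
    using int by (intro sum.cong refl, subst Bochner_Integration.integral_sum) (auto intro!: integrable_mult_right)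
  also have "\<dots> = vec d u \<bullet> (weighted_second_moment M d x w *\<^sub>v vec d u)"
    by (simp add: weighted_second_moment_def scalar_prod_def lessThan_atLeast0 sum_distrib_left mult_ac)
  finally show ?thesis ..
qed

text \<open>qx / q and qy / q are conjugate exponents, so Young's inequality applies to |a|^q and
  |b|^q; the factors q / qx and q / qy are below 1 and are dropped.\<close>

lemma young_powr:
  fixes a b :: real
  assumes q: "1 / q = 1 / qx + 1 / qy" and pos: "q > 0" "qx > 0" "qy > 0"
  shows "\<bar>a * b\<bar> powr q \<le> \<bar>a\<bar> powr qx + \<bar>b\<bar> powr qy"
proof -
  have sum1: "1 / (qx / q) + 1 / (qy / q) = 1"
  proof -
    have "1 / (qx / q) + 1 / (qy / q) = q * (1 / qx + 1 / qy)" by (simp add: distrib_left)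
    also have "\<dots> = 1" using pos unfolding q[symmetric] by simp
    finally show ?thesis .
  qed
  have gt: "qx / q > 1" "qy / q > 1"
  proof -
    have "1 / qx < 1 / q" "1 / qy < 1 / q" using q pos by simp_all
    then show "qx / q > 1" "qy / q > 1" using pos by (simp_all add: field_simps)
  qed
  have "\<bar>a\<bar> powr q * \<bar>b\<bar> powr q \<le> (\<bar>a\<bar> powr q) powr (qx / q) / (qx / q) + (\<bar>b\<bar> powr q) powr (qy / q) / (qy / q)"
    using gt sum1 by (intro Youngs_inequality) auto
  also have "\<dots> = \<bar>a\<bar> powr qx / (qx / q) + \<bar>b\<bar> powr qy / (qy / q)" using pos by (simp add: powr_powr)
  also have "\<dots> \<le> \<bar>a\<bar> powr qx / 1 + \<bar>b\<bar> powr qy / 1"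
    using gt by (intro add_mono divide_left_mono) auto
  finally show ?thesis by (simp add: abs_mult powr_mult)
qed

text \<open>The moment hypotheses of the theorem are bounds on nonnegative integrals, which include
  integrability; this converts them to Bochner integrals.\<close>

lemma integral_le_of_nn_integral:
  fixes f :: "'a \<Rightarrow> real"
  assumes f: "f \<in> borel_measurable M" "\<And>x. f x \<ge> 0" and K: "K \<ge> 0" "(\<integral>\<^sup>+x. ennreal (f x) \<partial>M) \<le> ennreal K"
  shows "integrable M f" "(\<integral>x. f x \<partial>M) \<le> K"
proof -
  have fin: "(\<integral>\<^sup>+x. ennreal (f x) \<partial>M) < \<infinity>" using K(2) by (rule le_less_trans) simp
  show int: "integrable M f" using fin f by (intro integrableI_nonneg) auto
  have "ennreal (\<integral>x. f x \<partial>M) = (\<integral>\<^sup>+x. ennreal (f x) \<partial>M)"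
    using int f by (intro nn_integral_eq_integral[symmetric]) auto
  then have "ennreal (\<integral>x. f x \<partial>M) \<le> ennreal K" using K(2) by simp
  then show "(\<integral>x. f x \<partial>M) \<le> K" by (simp only: ennreal_le_iff[OF K(1)])
qed

section \<open>The law of one observation and its moments\<close>

context misspecified_glm
begin

definition obs :: "nat \<Rightarrow> 'a \<Rightarrow> real vec \<times> real" where
  "obs i \<omega> = (X i \<omega>, Y i \<omega>)"

definition obs_space :: "(real vec \<times> real) measure" where
  "obs_space = borel_vec d \<Otimes>\<^sub>M borel"

definition obs_law :: "(real vec \<times> real) measure" where
  "obs_law = distr M obs_space (obs 0)"

lemma obs_indep: "indep_vars (\<lambda>_. obs_space) obs {0..n}"
  using indep by (simp add: obs_def[abs_def] obs_space_def)

lemma obs_measurable: "i \<in> {0..n} \<Longrightarrow> obs i \<in> M \<rightarrow>\<^sub>M obs_space"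
  using obs_indep unfolding indep_vars_def by auto

lemma obs_distr: "i \<in> {0..n} \<Longrightarrow> distr M obs_space (obs i) = obs_law"
  unfolding obs_law_def obs_space_def obs_def[abs_def] by (rule identically_distributed)

lemma X_carrier: "i \<in> {0..n} \<Longrightarrow> \<omega> \<in> space M \<Longrightarrow> X i \<omega> \<in> carrier_vec d"
  using measurable_space[OF obs_measurable, of i \<omega>]
  by (simp add: obs_def obs_space_def space_pair_measure space_borel_vec)

lemma fst_coordinate_measurable: "j < d \<Longrightarrow> (\<lambda>p. fst p $ j) \<in> borel_measurable obs_space"
  unfolding obs_space_def using measurable_compose[OF measurable_fst borel_vec_coordinate_measurable] .

lemma snd_measurable: "snd \<in> borel_measurable obs_space"
  unfolding obs_space_def by simp

lemma index_measurable: "(\<lambda>p. fst p \<bullet> \<theta>0) \<in> borel_measurable obs_space"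
  using fst_coordinate_measurable scalar_prod_vec(2)[OF target_carrier] by simp

lemma obs_law_prob_space: "prob_space obs_law"
  unfolding obs_law_def by (rule prob_space_distr[OF obs_measurable]) simp

lemma obs_law_measurable_eq: "borel_measurable obs_law = borel_measurable obs_space"
  unfolding obs_law_def by simp

lemma obs_law_integral:
  fixes f :: "real vec \<times> real \<Rightarrow> real"
  assumes "f \<in> borel_measurable obs_space"
  shows "integrable obs_law f \<longleftrightarrow> integrable M (\<lambda>\<omega>. f (X 0 \<omega>, Y 0 \<omega>))"
    "(\<integral>p. f p \<partial>obs_law) = (\<integral>\<omega>. f (X 0 \<omega>, Y 0 \<omega>) \<partial>M)"
  unfolding obs_law_def using integrable_distr_eq[OF obs_measurable assms, of 0] integral_distr[OF obs_measurable assms, of 0]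
  by (simp_all add: obs_def)

lemma smooth_convex_link:
  assumes "b1 > 0" "\<And>t. \<bar>(deriv ^^ 2) l t\<bar> \<le> b1" "\<And>t. \<bar>(deriv ^^ 3) l t\<bar> \<le> b1"
  shows "smooth_convex l (deriv l) ((deriv ^^ 2) l) ((deriv ^^ 3) l) b1"
proof
  have D: "((deriv ^^ k) l has_real_derivative (deriv ^^ Suc k) l t) (at t)" if "k < 3" for k t
    using l_thrice_differentiable[OF that, of t] by (simp add: DERIV_deriv_iff_field_differentiable)
  show d1: "(l has_real_derivative deriv l t) (at t)" for t using D[of 0 t] by simp
  show "(deriv l has_real_derivative (deriv ^^ 2) l t) (at t)" for t using D[of 1 t] by (simp add: numeral_2_eq_2)
  show "((deriv ^^ 2) l has_real_derivative (deriv ^^ 3) l t) (at t)" for t using D[of 2 t] by (simp add: numeral_3_eq_3 numeral_2_eq_2)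
  show "l t + deriv l t * (s - t) \<le> l s" for s t
    using convex_on_imp_above_tangent[OF l_convex, of t s "deriv l t"] d1[of t] by simp
qed (use assms in auto)

text \<open>For |u| <= 1, u . X equals w . \<Sigma>^(-1/2) X with |w| <= sqrt Lam_Sigma. Normalizing
  w brings the hypothesis on the unit sphere into play; w = 0 is treated apart.\<close>

lemma covariate_moment:
  assumes lam: "lam_Sigma > 0" "Lam_Sigma > 0"
    and qx: "qx > 0" and Kx: "Kx \<ge> 0"
    and moment: "\<forall>u\<in>unit_sphere d.
       (\<integral>\<^sup>+\<omega>. ennreal (\<bar>u \<bullet> (inv_sqrt_mat d (second_moment M d (X 0)) *\<^sub>v X 0 \<omega>)\<bar> powr qx) \<partial>M)
         \<le> ennreal (Kx powr qx)"
    and lmin: "lam_Sigma \<le> lambda_min (second_moment M d (X 0))"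
    and lmax: "lambda_max (second_moment M d (X 0)) \<le> Lam_Sigma"
    and u: "(\<Sum>j<d. (u j)\<^sup>2) \<le> 1"
  shows "integrable M (\<lambda>\<omega>. \<bar>\<Sum>j<d. u j * X 0 \<omega> $ j\<bar> powr qx)"
    "(\<integral>\<omega>. \<bar>\<Sum>j<d. u j * X 0 \<omega> $ j\<bar> powr qx \<partial>M) \<le> (sqrt Lam_Sigma * Kx) powr qx"
proof -
  let ?S = "second_moment M d (X 0)"
  note S = weighted_second_moment_carrier[of M d "X 0" "\<lambda>_. 1"] weighted_second_moment_symmetric[of M d "X 0" "\<lambda>_. 1"]
  have lower: "lam_Sigma * (v \<bullet> v) \<le> v \<bullet> (?S *\<^sub>v v)" if "v \<in> carrier_vec d" for v
    using lambda_min_le_quadratic_form[OF S d_pos that] mult_right_mono[OF lmin scalar_prod_self_nonneg[of v]] by linarith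
  have upper: "v \<bullet> (?S *\<^sub>v v) \<le> Lam_Sigma * (v \<bullet> v)" if "v \<in> carrier_vec d" for v
    using quadratic_form_le_lambda_max[OF S d_pos that] mult_right_mono[OF lmax scalar_prod_self_nonneg[of v]] by linarith
  \<comment> \<open>Testing both form bounds on a unit vector, which exists because d > 0.\<close>
  have le: "lam_Sigma \<le> Lam_Sigma"
    using lower[of "unit_vec d 0"] upper[of "unit_vec d 0"] d_pos by simp
  obtain w where w: "w \<in> carrier_vec d" and ww: "w \<bullet> w \<le> Lam_Sigma * (vec d u \<bullet> vec d u)"
    and wx: "\<And>x. x \<in> carrier_vec d \<Longrightarrow> w \<bullet> (inv_sqrt_mat d ?S *\<^sub>v x) = vec d u \<bullet> x"
    using inv_sqrt_mat_preimage[OF S d_pos lower upper lam(1) le, of "vec d u"] by auto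
  let ?f = "\<lambda>\<omega>. \<bar>\<Sum>j<d. u j * X 0 \<omega> $ j\<bar> powr qx"
  have Xc: "X 0 \<omega> \<in> carrier_vec d" if "\<omega> \<in> space M" for \<omega> using X_carrier[OF _ that, of 0] by simp
  have f_eq: "?f \<omega> = \<bar>w \<bullet> (inv_sqrt_mat d ?S *\<^sub>v X 0 \<omega>)\<bar> powr qx" if "\<omega> \<in> space M" for \<omega>
    using wx[OF Xc[OF that]] scalar_prod_vec(1)[OF Xc[OF that]] by simp
  have "(\<lambda>p. \<bar>\<Sum>j<d. u j * fst p $ j\<bar> powr qx) \<in> borel_measurable obs_space"
    using fst_coordinate_measurable by measurable
  from measurable_compose[OF obs_measurable this, of 0]
  have f_meas: "?f \<in> borel_measurable M" by (simp add: obs_def)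
  define W where "W = sqrt (w \<bullet> w)"
  have "vec d u \<bullet> vec d u \<le> 1" using u scalar_prod_vec(1)[of "vec d u" d u] by (simp add: power2_eq_square)
  then have "w \<bullet> w \<le> Lam_Sigma" using ww mult_left_mono[of "vec d u \<bullet> vec d u" 1 Lam_Sigma] lam by linarith
  then have W: "0 \<le> W" "W \<le> sqrt Lam_Sigma" "W\<^sup>2 = w \<bullet> w"
    by (auto simp: W_def scalar_prod_self_nonneg)
  have invc: "inv_sqrt_mat d ?S \<in> carrier_mat d d"
    using inv_sqrt_mat(1)[OF S d_pos lower upper lam(1) le] by (auto simp: pos_def_def)
  have "(\<integral>\<^sup>+\<omega>. ennreal (?f \<omega>) \<partial>M) \<le> ennreal ((sqrt Lam_Sigma * Kx) powr qx)"
  proof (cases "W = 0")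
    case True
    then have "w = 0\<^sub>v d" using W(3) scalar_prod_self_pos[OF w] by force
    then have f0: "?f \<omega> = 0" if "\<omega> \<in> space M" for \<omega>
      using f_eq[OF that] invc Xc[OF that] by (simp add: mult_mat_vec_carrier[of _ d d])
    then have "(\<integral>\<^sup>+\<omega>. ennreal (?f \<omega>) \<partial>M) = (\<integral>\<^sup>+\<omega>. 0 \<partial>M)" by (intro nn_integral_cong) auto
    then show ?thesis by simp
  next
    case False
    then have Wp: "W > 0" using W by simp
    define v where "v = (1 / W) \<cdot>\<^sub>v w"
    have "w \<bullet> w = W * W" using W(3) by (simp add: power2_eq_square)
    then have vv: "v \<bullet> v = 1" unfolding v_def using w Wp by simp
    moreover have "v \<in> carrier_vec d" using w by (simp add: v_def)
    ultimately have v: "v \<in> unit_sphere d" by (simp add: unit_sphere_def l2_norm_def)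
    have f_scaled: "?f \<omega> = W powr qx * \<bar>v \<bullet> (inv_sqrt_mat d ?S *\<^sub>v X 0 \<omega>)\<bar> powr qx" if "\<omega> \<in> space M" for \<omega>
    proof -
      have c: "inv_sqrt_mat d ?S *\<^sub>v X 0 \<omega> \<in> carrier_vec d" using mult_mat_vec_carrier[OF invc Xc[OF that]] .
      have "w \<bullet> (inv_sqrt_mat d ?S *\<^sub>v X 0 \<omega>) = W * (v \<bullet> (inv_sqrt_mat d ?S *\<^sub>v X 0 \<omega>))"
        unfolding v_def using smult_scalar_prod_distrib[OF w c] Wp by simp
      then show ?thesis unfolding f_eq[OF that] using Wp by (simp add: abs_mult powr_mult)
    qed
    from f_scaled have "(\<integral>\<^sup>+\<omega>. ennreal (?f \<omega>) \<partial>M)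
        = (\<integral>\<^sup>+\<omega>. ennreal (W powr qx) * ennreal (\<bar>v \<bullet> (inv_sqrt_mat d ?S *\<^sub>v X 0 \<omega>)\<bar> powr qx) \<partial>M)"
      by (intro nn_integral_cong) (simp add: ennreal_mult)
    also have "\<dots> = ennreal (W powr qx) * (\<integral>\<^sup>+\<omega>. ennreal (\<bar>v \<bullet> (inv_sqrt_mat d ?S *\<^sub>v X 0 \<omega>)\<bar> powr qx) \<partial>M)"
    proof (rule nn_integral_cmult)
      \<comment> \<open>Measurability of the integrand is read off from \<open>?f\<close>, of which
        it is a positive multiple on the sample space, without unfolding the inverse square root
        into entries.\<close>
      have mg: "(\<lambda>\<omega>. ennreal (inverse (W powr qx)) * ennreal (?f \<omega>)) \<in> borel_measurable M"
        using f_meas by measurable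
      have eq: "ennreal (inverse (W powr qx)) * ennreal (?f \<omega>) = ennreal (\<bar>v \<bullet> (inv_sqrt_mat d ?S *\<^sub>v X 0 \<omega>)\<bar> powr qx)"
        if "\<omega> \<in> space M" for \<omega>
        using f_scaled[OF that] Wp by (simp add: ennreal_mult[symmetric])
      show "(\<lambda>\<omega>. ennreal (\<bar>v \<bullet> (inv_sqrt_mat d ?S *\<^sub>v X 0 \<omega>)\<bar> powr qx)) \<in> borel_measurable M"
        by (rule iffD1[OF measurable_cong mg]) (rule eq)
    qed
    also have "\<dots> \<le> ennreal (W powr qx) * ennreal (Kx powr qx)"
      using moment v by (intro mult_left_mono) auto
    also have "\<dots> = ennreal ((W * Kx) powr qx)" using W Kx by (simp add: ennreal_mult[symmetric] powr_mult)
    also have "\<dots> \<le> ennreal ((sqrt Lam_Sigma * Kx) powr qx)"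
      using W Kx qx by (intro ennreal_leI powr_mono2 mult_right_mono) auto
    finally show ?thesis .
  qed
  from integral_le_of_nn_integral[OF f_meas _ _ this]
  show "integrable M ?f" "(\<integral>\<omega>. ?f \<omega> \<partial>M) \<le> (sqrt Lam_Sigma * Kx) powr qx" by auto
qed

end

context misspecified_glm
begin

text \<open>The residual factors out of u . X (Y - l'(X . \<theta>0)), so \<open>young_powr\<close>
  bounds the q-th power of this product by the sum of the two given moments.\<close>

lemma noise_moment:
  assumes q: "1 / q = 1 / qx + 1 / qy" and pos: "q > 0" "qx > 0" "qy > 0"
    and X_int: "integrable M (\<lambda>\<omega>. \<bar>\<Sum>j<d. u j * X 0 \<omega> $ j\<bar> powr qx)"
    and X_le: "(\<integral>\<omega>. \<bar>\<Sum>j<d. u j * X 0 \<omega> $ j\<bar> powr qx \<partial>M) \<le> Kx'"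
    and Y_le: "(\<integral>\<^sup>+\<omega>. ennreal (\<bar>Y 0 \<omega> - deriv l (X 0 \<omega> \<bullet> \<theta>0)\<bar> powr qy) \<partial>M) \<le> ennreal Ky'" and Ky': "Ky' \<ge> 0"
    and l1: "deriv l \<in> borel_measurable borel"
  shows "integrable M (\<lambda>\<omega>. \<bar>\<Sum>j<d. u j * (X 0 \<omega> $ j * (Y 0 \<omega> - deriv l (X 0 \<omega> \<bullet> \<theta>0)))\<bar> powr q)"
    "(\<integral>\<omega>. \<bar>\<Sum>j<d. u j * (X 0 \<omega> $ j * (Y 0 \<omega> - deriv l (X 0 \<omega> \<bullet> \<theta>0)))\<bar> powr q \<partial>M) \<le> Kx' + Ky'"
proof -
  let ?xi = "\<lambda>\<omega>. Y 0 \<omega> - deriv l (X 0 \<omega> \<bullet> \<theta>0)"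
  note [measurable] = fst_coordinate_measurable snd_measurable measurable_compose[OF index_measurable l1]
  have "(\<lambda>p. snd p - deriv l (fst p \<bullet> \<theta>0)) \<in> borel_measurable obs_space" by measurable
  from measurable_compose[OF obs_measurable this, of 0] have xi [measurable]: "?xi \<in> borel_measurable M"
    by (simp add: obs_def)
  have "(\<lambda>p. \<Sum>j<d. u j * fst p $ j) \<in> borel_measurable obs_space" by measurable
  from measurable_compose[OF obs_measurable this, of 0] have uX [measurable]: "(\<lambda>\<omega>. \<Sum>j<d. u j * X 0 \<omega> $ j) \<in> borel_measurable M"
    by (simp add: obs_def)
  have Y: "integrable M (\<lambda>\<omega>. \<bar>?xi \<omega>\<bar> powr qy)" "(\<integral>\<omega>. \<bar>?xi \<omega>\<bar> powr qy \<partial>M) \<le> Ky'"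
    by (rule integral_le_of_nn_integral[OF _ _ Ky' Y_le]; measurable)+
  have eq: "(\<Sum>j<d. u j * (X 0 \<omega> $ j * ?xi \<omega>)) = (\<Sum>j<d. u j * X 0 \<omega> $ j) * ?xi \<omega>" for \<omega>
    by (simp add: sum_distrib_right mult.assoc)
  have le: "\<bar>(\<Sum>j<d. u j * X 0 \<omega> $ j) * ?xi \<omega>\<bar> powr q \<le> \<bar>\<Sum>j<d. u j * X 0 \<omega> $ j\<bar> powr qx + \<bar>?xi \<omega>\<bar> powr qy" for \<omega>
    by (rule young_powr[OF q pos])
  have int: "integrable M (\<lambda>\<omega>. \<bar>\<Sum>j<d. u j * X 0 \<omega> $ j\<bar> powr qx + \<bar>?xi \<omega>\<bar> powr qy)"
    using X_int Y(1) by simp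
  have I: "integrable M (\<lambda>\<omega>. \<bar>(\<Sum>j<d. u j * X 0 \<omega> $ j) * ?xi \<omega>\<bar> powr q)"
  proof (rule Bochner_Integration.integrable_bound[OF int])
    show "(\<lambda>\<omega>. \<bar>(\<Sum>j<d. u j * X 0 \<omega> $ j) * ?xi \<omega>\<bar> powr q) \<in> borel_measurable M" by measurable
    show "AE \<omega> in M. norm (\<bar>(\<Sum>j<d. u j * X 0 \<omega> $ j) * ?xi \<omega>\<bar> powr q)
        \<le> norm (\<bar>\<Sum>j<d. u j * X 0 \<omega> $ j\<bar> powr qx + \<bar>?xi \<omega>\<bar> powr qy)"
    proof (rule AE_I2)
      fix \<omega>
      show "norm (\<bar>(\<Sum>j<d. u j * X 0 \<omega> $ j) * ?xi \<omega>\<bar> powr q)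
        \<le> norm (\<bar>\<Sum>j<d. u j * X 0 \<omega> $ j\<bar> powr qx + \<bar>?xi \<omega>\<bar> powr qy)"
        using le[of \<omega>] by (simp only: real_norm_def abs_of_nonneg powr_ge_zero add_nonneg_nonneg)
    qed
  qed
  then show "integrable M (\<lambda>\<omega>. \<bar>\<Sum>j<d. u j * (X 0 \<omega> $ j * ?xi \<omega>)\<bar> powr q)" unfolding eq .
  have "(\<integral>\<omega>. \<bar>(\<Sum>j<d. u j * X 0 \<omega> $ j) * ?xi \<omega>\<bar> powr q \<partial>M)
      \<le> (\<integral>\<omega>. \<bar>\<Sum>j<d. u j * X 0 \<omega> $ j\<bar> powr qx + \<bar>?xi \<omega>\<bar> powr qy \<partial>M)"
    by (rule integral_mono[OF I int le])
  also have "\<dots> = (\<integral>\<omega>. \<bar>\<Sum>j<d. u j * X 0 \<omega> $ j\<bar> powr qx \<partial>M) + (\<integral>\<omega>. \<bar>?xi \<omega>\<bar> powr qy \<partial>M)"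
    by (rule Bochner_Integration.integral_add[OF X_int Y(1)])
  also have "\<dots> \<le> Kx' + Ky'" using X_le Y(2) by (rule add_mono)
  finally show "(\<integral>\<omega>. \<bar>\<Sum>j<d. u j * (X 0 \<omega> $ j * ?xi \<omega>)\<bar> powr q \<partial>M) \<le> Kx' + Ky'" unfolding eq .
qed

lemma curvature_form:
  assumes l2: "(deriv ^^ 2) l \<in> borel_measurable borel" and b: "\<And>t. \<bar>(deriv ^^ 2) l t\<bar> \<le> b1"
    and lamV: "lam_V \<le> lambda_min (weighted_second_moment M d (X 0) (\<lambda>\<omega>. (deriv ^^ 2) l (X 0 \<omega> \<bullet> \<theta>0)))"
  shows "lam_V * (\<Sum>j<d. (u j)\<^sup>2) \<le> (\<integral>\<omega>. (deriv ^^ 2) l (X 0 \<omega> \<bullet> \<theta>0) * (\<Sum>j<d. u j * X 0 \<omega> $ j)\<^sup>2 \<partial>M)"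
proof -
  let ?w = "\<lambda>\<omega>. (deriv ^^ 2) l (X 0 \<omega> \<bullet> \<theta>0)"
  let ?V = "weighted_second_moment M d (X 0) ?w"
  from measurable_compose[OF obs_measurable measurable_compose[OF index_measurable l2], of 0]
  have w [measurable]: "?w \<in> borel_measurable M" by (simp add: obs_def)
  have int: "integrable M (\<lambda>\<omega>. X 0 \<omega> $ i * X 0 \<omega> $ j * ?w \<omega>)" if ij: "i < d" "j < d" for i j
  proof (rule Bochner_Integration.integrable_bound)
    show "integrable M (\<lambda>\<omega>. b1 * (X 0 \<omega> $ i * X 0 \<omega> $ j))" using second_moment_exists[OF ij] by simp
    show "(\<lambda>\<omega>. X 0 \<omega> $ i * X 0 \<omega> $ j * ?w \<omega>) \<in> borel_measurable M"
      using borel_measurable_integrable[OF second_moment_exists[OF ij]] by measurable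
    show "AE \<omega> in M. norm (X 0 \<omega> $ i * X 0 \<omega> $ j * ?w \<omega>) \<le> norm (b1 * (X 0 \<omega> $ i * X 0 \<omega> $ j))"
    proof (rule AE_I2)
      fix \<omega>
      have "\<bar>?w \<omega>\<bar> \<le> \<bar>b1\<bar>" using b[of "X 0 \<omega> \<bullet> \<theta>0"] by linarith
      then show "norm (X 0 \<omega> $ i * X 0 \<omega> $ j * ?w \<omega>) \<le> norm (b1 * (X 0 \<omega> $ i * X 0 \<omega> $ j))"
        unfolding real_norm_def abs_mult by (subst mult.commute) (intro mult_right_mono, auto)
    qed
  qed
  have "lam_V * (vec d u \<bullet> vec d u) \<le> lambda_min ?V * (vec d u \<bullet> vec d u)"
    using lamV by (intro mult_right_mono scalar_prod_self_nonneg)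
  also have "\<dots> \<le> vec d u \<bullet> (?V *\<^sub>v vec d u)"
    by (rule lambda_min_le_quadratic_form[OF weighted_second_moment_carrier weighted_second_moment_symmetric d_pos]) simp
  also have "\<dots> = (\<integral>\<omega>. ?w \<omega> * (\<Sum>j<d. u j * X 0 \<omega> $ j)\<^sup>2 \<partial>M)"
    by (rule weighted_second_moment_form) (rule int)
  also have "vec d u \<bullet> vec d u = (\<Sum>j<d. (u j)\<^sup>2)" using scalar_prod_vec(1)[of "vec d u" d u] by (simp add: power2_eq_square)
  finally show ?thesis .
qed

lemma I1_subset: "I1 \<subseteq> {0..n}"
  using partition(1) by auto

lemma card_I1: "real (card I1) = real n / 2" "card I1 > 0"
proof -
  obtain k where k: "n = 2 * k" using n_even by (rule evenE)
  then show "real (card I1) = real n / 2" "card I1 > 0" using partition(3) n_pos by auto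
qed

lemma empirical_score_eq_0_iff:
  assumes \<omega>: "\<omega> \<in> space M"
  shows "empirical_score l d (\<lambda>i. Y i \<omega>) (\<lambda>i. X i \<omega>) I1 \<theta> = 0\<^sub>v d \<longleftrightarrow>
    (\<forall>j<d. (\<Sum>i\<in>I1. (deriv l (X i \<omega> \<bullet> \<theta>) - Y i \<omega>) * X i \<omega> $ j) = 0)" (is "?s = _ \<longleftrightarrow> (\<forall>j<d. ?g j = 0)")
proof -
  have nth: "?s $ j = ?g j / real (card I1)" if j: "j < d" for j
  proof -
    have "score l (Y i \<omega>) (X i \<omega>) \<theta> $ j = (deriv l (X i \<omega> \<bullet> \<theta>) - Y i \<omega>) * X i \<omega> $ j" if "i \<in> I1" for i
      using X_carrier[OF _ \<omega>, of i] that j I1_subset by (auto simp: score_def)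
    then show ?thesis using j by (simp add: empirical_score_def)
  qed
  have dim: "dim_vec ?s = d" by (simp add: empirical_score_def)
  show ?thesis
  proof
    assume "?s = 0\<^sub>v d"
    then show "\<forall>j<d. ?g j = 0" using nth card_I1(2) by auto
  next
    assume "\<forall>j<d. ?g j = 0"
    then show "?s = 0\<^sub>v d" using nth dim by (intro eq_vecI) auto
  qed
qed

end

context misspecified_glm
begin

text \<open>The radius \<open>\<rho>\<close> solves a balance. Outside E1 the gradient contributes
  at least - \<rho> m (2 Cn rate) on the sphere of radius \<rho>; outside E2 the remainder exceeds m
  (c / 2) \<rho>^2. The two quantities coincide for \<rho> = (4 Cn / c) rate, and strictness of the
  second bound decides the sign.\<close>

lemma estimation_bound:
  fixes b1 qx q Kx' Kz lam_V B Mr c C0 \<eta> \<epsilon> :: real and Nt :: "(nat \<Rightarrow> real) set"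
  defines "Cn \<equiv> fuk_nagaev_const q Kz"
  defines "rate \<equiv> estimation_rate q n d \<epsilon>"
  defines "\<rho> \<equiv> 4 * Cn / c * rate"
  assumes link: "b1 > 0" "\<And>t. \<bar>(deriv ^^ 2) l t\<bar> \<le> b1" "\<And>t. \<bar>(deriv ^^ 3) l t\<bar> \<le> b1"
    and q: "qx > 2" "q > 2" and K: "Kx' \<ge> 1" "Kz \<ge> 1" and lam_V: "lam_V > 0"
    and X_moment: "\<And>u. (\<Sum>j<d. (u j)\<^sup>2) \<le> 1 \<Longrightarrow> integrable M (\<lambda>\<omega>. \<bar>\<Sum>j<d. u j * X 0 \<omega> $ j\<bar> powr qx)"
      "\<And>u. (\<Sum>j<d. (u j)\<^sup>2) \<le> 1 \<Longrightarrow> (\<integral>\<omega>. \<bar>\<Sum>j<d. u j * X 0 \<omega> $ j\<bar> powr qx \<partial>M) \<le> Kx'"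
    and Z_moment: "\<And>u. (\<Sum>j<d. (u j)\<^sup>2) \<le> 1 \<Longrightarrow>
        integrable M (\<lambda>\<omega>. \<bar>\<Sum>j<d. u j * (X 0 \<omega> $ j * (Y 0 \<omega> - deriv l (X 0 \<omega> \<bullet> \<theta>0)))\<bar> powr q)"
      "\<And>u. (\<Sum>j<d. (u j)\<^sup>2) \<le> 1 \<Longrightarrow>
        (\<integral>\<omega>. \<bar>\<Sum>j<d. u j * (X 0 \<omega> $ j * (Y 0 \<omega> - deriv l (X 0 \<omega> \<bullet> \<theta>0)))\<bar> powr q \<partial>M) \<le> Kz"
    and V: "\<And>u. lam_V * (\<Sum>j<d. (u j)\<^sup>2) \<le> (\<integral>\<omega>. (deriv ^^ 2) l (X 0 \<omega> \<bullet> \<theta>0) * (\<Sum>j<d. u j * X 0 \<omega> $ j)\<^sup>2 \<partial>M)"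
    and const: "B \<ge> 1" "Mr \<ge> 1" "c > 0" "b1 * \<eta>\<^sup>2 * Mr\<^sup>2 / 8 \<le> c / 2"
      "2 * c \<le> lam_V / 8 - b1 / 2 * (B\<^sup>2 * (Kx' / Mr powr qx) + 2 powr qx * Kx' / B powr (qx - 2))
        - b1 * \<rho> * B / 6 * (4 * (1 + Kx'))"
    and Nt: "real (card Nt) \<le> C0 ^ d" "C0 \<ge> 1" "rounding_net I1 d \<eta> Nt"
    and \<epsilon>: "0 < \<epsilon>" "\<epsilon> < 1"
    and small: "2 * (ln C0 + 1) * rate\<^sup>2 \<le> 8 * c\<^sup>2 / (b1\<^sup>2 * B ^ 4)"
  shows "measure M {\<omega> \<in> space M. inverse (4 * Cn / c) * l2_norm (\<theta>hat \<omega> - \<theta>0) \<le> rate} \<ge> 1 - \<epsilon>"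
proof -
  define m where "m = real (card I1)"
  define L where "L = ln (2 / \<epsilon>)"
  have m: "m > 0" "m = real n / 2" using card_I1 by (auto simp: m_def)
  have L: "L > 0" unfolding L_def using \<epsilon> by simp
  have I1: "finite I1" "I1 \<noteq> {}" using I1_subset card_I1(2) finite_subset by auto
  have Cn: "Cn > 0" unfolding Cn_def using K(2) by (rule fuk_nagaev_const_pos)
  have rate_ge: "sqrt ((d + L) / n) \<le> rate"
    unfolding rate_def estimation_rate_def L_def[symmetric] by simp
  have "sqrt ((d + L) / n) > 0" using L d_pos n_pos by simp
  then have rate: "rate > 0" using rate_ge by linarith
  have \<rho>: "\<rho> > 0" unfolding \<rho>_def using Cn const(3) rate by simp
  define xi where "xi = (\<lambda>p::real vec \<times> real. snd p - deriv l (fst p \<bullet> \<theta>0))"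
  define x where "x = (\<lambda>(p::real vec \<times> real) j. fst p $ j)"
  define z where "z = (\<lambda>p j. x p j * xi p)"
  define z0 where "z0 = (\<lambda>p::real vec \<times> real. fst p \<bullet> \<theta>0)"
  interpret S: smooth_convex l "deriv l" "(deriv ^^ 2) l" "(deriv ^^ 3) l" b1
    by (rule smooth_convex_link[OF link])
  have x_meas: "j < d \<Longrightarrow> (\<lambda>p. x p j) \<in> borel_measurable obs_space" for j
    unfolding x_def by (rule fst_coordinate_measurable)
  have z0_meas: "z0 \<in> borel_measurable obs_space" unfolding z0_def by (rule index_measurable)
  have xi_meas: "xi \<in> borel_measurable obs_space"
    unfolding xi_def using snd_measurable measurable_compose[OF index_measurable S.measurable_l(2)]
    by (rule borel_measurable_diff)
  have z_meas: "j < d \<Longrightarrow> (\<lambda>p. z p j) \<in> borel_measurable obs_space" for j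
    unfolding z_def using x_meas xi_meas by (intro borel_measurable_times)
  have ux_meas: "(\<lambda>p. \<Sum>j<d. u j * x p j) \<in> borel_measurable obs_space" for u
    using x_meas by (intro borel_measurable_sum borel_measurable_times) auto
  have uz_meas: "(\<lambda>p. \<Sum>j<d. u j * z p j) \<in> borel_measurable obs_space" for u
    using z_meas by (intro borel_measurable_sum borel_measurable_times) auto
  have absq: "(\<lambda>p. \<bar>f p\<bar> powr a) \<in> borel_measurable obs_space" if "f \<in> borel_measurable obs_space" for f :: "real vec \<times> real \<Rightarrow> real" and a
    using that by measurable
  interpret P: prob_space obs_law by (rule obs_law_prob_space)
  interpret Z: centered_weak_moments obs_law d z q Kz
  proof unfold_locales
    show "\<And>j. j < d \<Longrightarrow> (\<lambda>p. z p j) \<in> borel_measurable obs_law" using z_meas by (simp add: obs_law_measurable_eq)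
    show "integrable obs_law (\<lambda>p. \<bar>\<Sum>j<d. u j * z p j\<bar> powr q)" if "(\<Sum>j<d. (u j)\<^sup>2) \<le> 1" for u
      using Z_moment(1)[OF that] obs_law_integral(1)[OF absq[OF uz_meas]] by (simp add: z_def x_def xi_def)
    show "(\<integral>p. \<bar>\<Sum>j<d. u j * z p j\<bar> powr q \<partial>obs_law) \<le> Kz" if "(\<Sum>j<d. (u j)\<^sup>2) \<le> 1" for u
      using Z_moment(2)[OF that] obs_law_integral(2)[OF absq[OF uz_meas]] by (simp add: z_def x_def xi_def)
    show "(\<integral>p. z p j \<partial>obs_law) = 0" if j: "j < d" for j
    proof -
      have "(\<integral>p. z p j \<partial>obs_law) = vec d (\<lambda>j. expectation (\<lambda>\<omega>. X 0 \<omega> $ j * (Y 0 \<omega> - deriv l (X 0 \<omega> \<bullet> \<theta>0)))) $ j"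
        using obs_law_integral(2)[OF z_meas[OF j]] j by (simp add: z_def x_def xi_def)
      also have "\<dots> = 0" unfolding target using j by simp
      finally show ?thesis .
    qed
  qed (use d_pos q K in auto)
  interpret G: glm_moments obs_law d x qx Kx' l "deriv l" "(deriv ^^ 2) l" "(deriv ^^ 3) l" b1 z0 lam_V
  proof unfold_locales
    show "\<And>j. j < d \<Longrightarrow> (\<lambda>p. x p j) \<in> borel_measurable obs_law" using x_meas by (simp add: obs_law_measurable_eq)
    show "z0 \<in> borel_measurable obs_law" using z0_meas by (simp add: obs_law_measurable_eq)
    show "integrable obs_law (\<lambda>p. \<bar>\<Sum>j<d. u j * x p j\<bar> powr qx)" if "(\<Sum>j<d. (u j)\<^sup>2) \<le> 1" for u
      using X_moment(1)[OF that] obs_law_integral(1)[OF absq[OF ux_meas]] by (simp add: x_def)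
    show "(\<integral>p. \<bar>\<Sum>j<d. u j * x p j\<bar> powr qx \<partial>obs_law) \<le> Kx'" if "(\<Sum>j<d. (u j)\<^sup>2) \<le> 1" for u
      using X_moment(2)[OF that] obs_law_integral(2)[OF absq[OF ux_meas]] by (simp add: x_def)
    show "lam_V * (\<Sum>j<d. (u j)\<^sup>2) \<le> (\<integral>p. (deriv ^^ 2) l (z0 p) * (\<Sum>j<d. u j * x p j)\<^sup>2 \<partial>obs_law)" for u
    proof -
      have "(\<lambda>p. (deriv ^^ 2) l (z0 p) * (\<Sum>j<d. u j * x p j)\<^sup>2) \<in> borel_measurable obs_space"
        using measurable_compose[OF z0_meas S.measurable_l(3)] ux_meas[of u]
        by (intro borel_measurable_times borel_measurable_power)
      from obs_law_integral(2)[OF this] show ?thesis using V[of u] by (simp add: x_def z0_def)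
    qed
  qed (use d_pos q K lam_V in auto)
  have indepI: "indep_vars (\<lambda>_. obs_space) obs I1" using indep_vars_subset[OF obs_indep I1_subset] .
  have distrI: "distr M obs_space (obs i) = obs_law" if "i \<in> I1" for i using obs_distr that I1_subset by auto
  have psM: "prob_space M" by unfold_locales
  define E1 where "E1 = {\<omega> \<in> space M.
      m * (Cn * (sqrt ((d + ln (2 / \<epsilon>)) / m) + sqrt d / (m powr (1 - 1 / q) * \<epsilon> powr (1 / q))))
        < sqrt (\<Sum>j<d. (\<Sum>i\<in>I1. z (obs i \<omega>) j)\<^sup>2)}"
  have E1: "E1 \<in> sets M" "measure M E1 \<le> \<epsilon> / 2"
    unfolding E1_def m_def Cn_def
    by (rule Z.fuk_nagaev_indep[OF psM I1 indepI _ \<epsilon>], rule distrI, assumption)+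
  have "\<exists>E\<in>sets M. measure M E \<le> card Nt * exp (- (8 * c\<^sup>2 / (b1\<^sup>2 * B ^ 4) * card I1)) \<and>
    (\<forall>\<omega>\<in>space M - E. \<forall>u. (\<Sum>j<d. (u j)\<^sup>2) = 1 \<longrightarrow>
      card I1 * (c / 2) * \<rho>\<^sup>2 < (\<Sum>i\<in>I1. S.excess (z0 (obs i \<omega>)) (\<rho> * (\<Sum>j<d. x (obs i \<omega>) j * u j))))"
  proof (rule G.curvature_on_sphere[OF psM I1 indepI _ const(1) const(2) \<rho> const(3) const(5) const(4) Nt(3)])
    show "distr M obs_space (obs i) = obs_law" if "i \<in> I1" for i using that by (rule distrI)
  qed
  then obtain E2 where E2: "E2 \<in> sets M" "measure M E2 \<le> card Nt * exp (- (8 * c\<^sup>2 / (b1\<^sup>2 * B ^ 4) * card I1))"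
    and curv: "\<forall>\<omega>\<in>space M - E2. \<forall>u. (\<Sum>j<d. (u j)\<^sup>2) = 1 \<longrightarrow>
      card I1 * (c / 2) * \<rho>\<^sup>2 < (\<Sum>i\<in>I1. S.excess (z0 (obs i \<omega>)) (\<rho> * (\<Sum>j<d. x (obs i \<omega>) j * u j)))"
    by (elim bexE conjE)
  have E2_curv: "card I1 * (c / 2) * \<rho>\<^sup>2 < (\<Sum>i\<in>I1. S.excess (z0 (obs i \<omega>)) (\<rho> * (\<Sum>j<d. x (obs i \<omega>) j * u j)))"
    if "\<omega> \<in> space M - E2" "(\<Sum>j<d. (u j)\<^sup>2) = 1" for \<omega> u
    by (rule curv[rule_format, OF that])
  \<comment> \<open>The logarithmic part of the rate gives d + L <= n rate^2, so a small rate makes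
    the exponent c3 m exceed d ln C0 + L: the first part pays for the cardinality of the net, the
    second leaves exp (- L) = \<epsilon> / 2.\<close>
  have mE2: "measure M E2 \<le> \<epsilon> / 2"
  proof -
    define c3 where "c3 = 8 * c\<^sup>2 / (b1\<^sup>2 * B ^ 4)"
    have lnC: "ln C0 \<ge> 0" using Nt(2) by simp
    have "(d + L) / n \<le> rate\<^sup>2"
    proof -
      have "(sqrt ((d + L) / n))\<^sup>2 \<le> rate\<^sup>2" using rate_ge L by (intro power_mono) auto
      then show ?thesis using L by simp
    qed
    then have "d + L \<le> rate\<^sup>2 * n" using n_pos by (simp add: pos_divide_le_eq)
    then have "(ln C0 + 1) * (d + L) \<le> (ln C0 + 1) * (rate\<^sup>2 * n)" using lnC by (intro mult_left_mono) auto
    also have "\<dots> = (2 * (ln C0 + 1) * rate\<^sup>2) * m" unfolding m(2) by simp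
    also have "\<dots> \<le> c3 * m" using small m(1) unfolding c3_def by (intro mult_right_mono) auto
    finally have "d * ln C0 + L \<le> c3 * m"
    proof -
      assume *: "(ln C0 + 1) * (d + L) \<le> c3 * m"
      have "0 \<le> ln C0 * L + d" using lnC L by simp
      then have "d * ln C0 + L \<le> (ln C0 + 1) * (d + L)" by (simp add: algebra_simps)
      then show ?thesis using * by linarith
    qed
    have "card Nt * exp (- (c3 * m)) \<le> C0 ^ d * exp (- (c3 * m))" using Nt(1) by (intro mult_right_mono) auto
    also have "C0 ^ d = exp (d * ln C0)" using Nt(2) by (simp add: exp_of_nat_mult)
    also have "exp (d * ln C0) * exp (- (c3 * m)) \<le> exp (- L)"
      using \<open>d * ln C0 + L \<le> c3 * m\<close> by (simp add: exp_add[symmetric])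
    also have "exp (- L) = \<epsilon> / 2" unfolding L_def using \<epsilon> by (simp add: exp_minus)
    finally show ?thesis using E2(2) unfolding c3_def m_def by linarith
  qed
  have noise: "sqrt (\<Sum>j<d. (\<Sum>i\<in>I1. z (obs i \<omega>) j)\<^sup>2) \<le> m * (2 * Cn * rate)" if "\<omega> \<in> space M - E1" for \<omega>
  proof -
    \<comment> \<open>Passing from the half sample size m = n / 2 to n costs sqrt 2 here and 2^(1 -
      1/q) in the other term, both at most 2.\<close>
    have 1: "sqrt ((d + L) / m) \<le> 2 * sqrt ((d + L) / n)"
    proof -
      have "sqrt ((d + L) / m) = sqrt (2 * ((d + L) / n))" unfolding m(2) by (simp add: field_simps)
      also have "\<dots> \<le> sqrt (2\<^sup>2 * ((d + L) / n))" using L by (intro real_sqrt_le_mono mult_right_mono) auto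
      also have "\<dots> = 2 * sqrt ((d + L) / n)" unfolding real_sqrt_mult by simp
      finally show ?thesis .
    qed
    have 2: "sqrt d / (m powr (1 - 1 / q) * \<epsilon> powr (1 / q)) \<le> 2 * (sqrt d / (n powr (1 - 1 / q) * \<epsilon> powr (1 / q)))"
    proof -
      have q1: "1 - 1 / q \<le> 1" "0 \<le> 1 - 1 / q" using q by auto
      have "real n = 2 * m" using m(2) by simp
      then have "real n powr (1 - 1 / q) = (2 * m) powr (1 - 1 / q)" by (simp only:)
      also have "\<dots> = 2 powr (1 - 1 / q) * m powr (1 - 1 / q)" using m(1) by (simp add: powr_mult)
      also have "\<dots> \<le> 2 powr 1 * m powr (1 - 1 / q)" using q1 by (intro mult_right_mono powr_mono) auto
      finally have *: "real n powr (1 - 1 / q) \<le> 2 * m powr (1 - 1 / q)" by simp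
      have pos: "m powr (1 - 1 / q) > 0" "real n powr (1 - 1 / q) > 0" "\<epsilon> powr (1 / q) > 0" using m(1) n_pos \<epsilon> by auto
      have "sqrt d / (m powr (1 - 1 / q) * \<epsilon> powr (1 / q)) = 2 * sqrt d / (2 * m powr (1 - 1 / q) * \<epsilon> powr (1 / q))" by simp
      also have "\<dots> \<le> 2 * sqrt d / (n powr (1 - 1 / q) * \<epsilon> powr (1 / q))"
        using * pos by (intro divide_left_mono mult_right_mono mult_pos_pos) auto
      finally show ?thesis by simp
    qed
    have "sqrt ((d + L) / m) + sqrt d / (m powr (1 - 1 / q) * \<epsilon> powr (1 / q)) \<le> 2 * rate"
      unfolding rate_def estimation_rate_def L_def[symmetric] using 1 2 by simp
    then have "m * (Cn * (sqrt ((d + L) / m) + sqrt d / (m powr (1 - 1 / q) * \<epsilon> powr (1 / q)))) \<le> m * (Cn * (2 * rate))"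
      using m(1) Cn by (intro mult_left_mono) auto
    moreover have "sqrt (\<Sum>j<d. (\<Sum>i\<in>I1. z (obs i \<omega>) j)\<^sup>2)
        \<le> m * (Cn * (sqrt ((d + L) / m) + sqrt d / (m powr (1 - 1 / q) * \<epsilon> powr (1 / q))))"
      using that unfolding E1_def L_def by (auto simp: not_less)
    ultimately show ?thesis by (simp add: mult_ac)
  qed
  let ?A = "{\<omega> \<in> space M. inverse (4 * Cn / c) * l2_norm (\<theta>hat \<omega> - \<theta>0) \<le> rate}"
  have hat_carrier: "\<theta>hat \<omega> \<in> carrier_vec d" if "\<omega> \<in> space M" for \<omega>
    using measurable_space[OF estimator_measurable that] by (simp add: space_borel_vec)
  have good: "\<omega> \<in> ?A" if \<omega>: "\<omega> \<in> space M - (E1 \<union> E2)"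
    and est: "(\<exists>\<theta>\<in>carrier_vec d. empirical_score l d (\<lambda>i. Y i \<omega>) (\<lambda>i. X i \<omega>) I1 \<theta> = 0\<^sub>v d) \<longrightarrow>
          empirical_score l d (\<lambda>i. Y i \<omega>) (\<lambda>i. X i \<omega>) I1 (\<theta>hat \<omega>) = 0\<^sub>v d" for \<omega>
  proof -
    have \<omega>M: "\<omega> \<in> space M" using \<omega> by auto
    let ?x = "\<lambda>i j. X i \<omega> $ j" and ?y = "\<lambda>i. Y i \<omega>" and ?t0 = "\<lambda>j. \<theta>0 $ j"
    let ?G = "\<lambda>j \<theta>. \<Sum>i\<in>I1. (deriv l (\<Sum>j<d. ?x i j * \<theta> j) - ?y i) * ?x i j"
    have lin: "(\<Sum>j<d. ?x i j * \<theta> $ j) = X i \<omega> \<bullet> \<theta>" if "\<theta> \<in> carrier_vec d" for i \<theta>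
      using scalar_prod_vec(2)[OF that, of "X i \<omega>"] by simp
    have lin0: "(\<Sum>j<d. ?x i j * ?t0 j) = z0 (obs i \<omega>)" for i
      using lin[OF target_carrier] by (simp add: z0_def obs_def)
    have G0: "?G j ?t0 = - (\<Sum>i\<in>I1. z (obs i \<omega>) j)" for j
      unfolding lin0 sum_negf[symmetric] by (intro sum.cong) (auto simp: z_def x_def xi_def z0_def obs_def algebra_simps)
    have sphere: "0 < \<rho> * (\<Sum>j<d. ?G j ?t0 * u j)
        + (\<Sum>i\<in>I1. S.excess (\<Sum>j<d. ?x i j * ?t0 j) (\<rho> * (\<Sum>j<d. ?x i j * u j)))"
      if u: "(\<Sum>j<d. (u j)\<^sup>2) = 1" for u
    proof -
      have "(\<Sum>j<d. (\<Sum>i\<in>I1. z (obs i \<omega>) j) * u j)\<^sup>2 \<le> (\<Sum>j<d. (\<Sum>i\<in>I1. z (obs i \<omega>) j)\<^sup>2) * (\<Sum>j<d. (u j)\<^sup>2)"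
        by (rule Cauchy_Schwarz_ineq_sum)
      then have "\<bar>\<Sum>j<d. (\<Sum>i\<in>I1. z (obs i \<omega>) j) * u j\<bar> \<le> sqrt (\<Sum>j<d. (\<Sum>i\<in>I1. z (obs i \<omega>) j)\<^sup>2)"
        unfolding u by (intro real_le_rsqrt) simp
      also have "\<dots> \<le> m * (2 * Cn * rate)" using noise \<omega> by auto
      finally have "- (m * (2 * Cn * rate)) \<le> (\<Sum>j<d. ?G j ?t0 * u j)"
        unfolding G0 by (simp add: sum_negf abs_le_iff)
      then have "\<rho> * (- (m * (2 * Cn * rate))) \<le> \<rho> * (\<Sum>j<d. ?G j ?t0 * u j)"
        using \<rho> by (intro mult_left_mono) auto
      moreover have "\<rho> * (m * (2 * Cn * rate)) = m * (c / 2) * \<rho>\<^sup>2"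
        unfolding \<rho>_def using const(3) by (simp add: power2_eq_square field_simps)
      moreover have "m * (c / 2) * \<rho>\<^sup>2 < (\<Sum>i\<in>I1. S.excess (\<Sum>j<d. ?x i j * ?t0 j) (\<rho> * (\<Sum>j<d. ?x i j * u j)))"
        using E2_curv[of \<omega> u] \<omega> u unfolding lin0 m_def by (simp add: x_def obs_def)
      ultimately show ?thesis by linarith
    qed
    \<comment> \<open>A root has to be exhibited first: the estimator is known to solve the equation
      only where the equation is solvable.\<close>
    have "\<exists>\<theta>. \<forall>j<d. ?G j \<theta> = 0"
      by (rule S.z_estimator_localization(1)[OF I1(1) \<rho>, where d = d and x = ?x and y = ?y])
        (rule sphere)
    then obtain \<theta> where "\<forall>j<d. ?G j \<theta> = 0" by (rule exE)
    then have "\<forall>j<d. ?G j (\<lambda>j. vec d \<theta> $ j) = 0" by simp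
    then have "\<forall>j<d. (\<Sum>i\<in>I1. (deriv l (X i \<omega> \<bullet> vec d \<theta>) - Y i \<omega>) * X i \<omega> $ j) = 0"
      using lin[of "vec d \<theta>"] by simp
    then have "empirical_score l d (\<lambda>i. Y i \<omega>) (\<lambda>i. X i \<omega>) I1 (vec d \<theta>) = 0\<^sub>v d"
      unfolding empirical_score_eq_0_iff[OF \<omega>M] .
    then have "empirical_score l d (\<lambda>i. Y i \<omega>) (\<lambda>i. X i \<omega>) I1 (\<theta>hat \<omega>) = 0\<^sub>v d"
      using est vec_carrier by blast
    then have Ghat: "?G j (\<lambda>j. \<theta>hat \<omega> $ j) = 0" if "j < d" for j
      using that lin[OF hat_carrier[OF \<omega>M]] unfolding empirical_score_eq_0_iff[OF \<omega>M] by simp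
    have le: "(\<Sum>j<d. (\<theta>hat \<omega> $ j - \<theta>0 $ j)\<^sup>2) \<le> \<rho>\<^sup>2"
      by (rule S.z_estimator_localization(2)[OF I1(1) \<rho>, where d = d and x = ?x and y = ?y])
        (rule sphere, assumption, rule Ghat)
    have "l2_norm (\<theta>hat \<omega> - \<theta>0) \<le> \<rho>"
      unfolding l2_norm_minus[OF hat_carrier[OF \<omega>M] target_carrier] using le \<rho> by (intro real_le_lsqrt) auto
    then have "inverse (4 * Cn / c) * l2_norm (\<theta>hat \<omega> - \<theta>0) \<le> inverse (4 * Cn / c) * \<rho>"
      using Cn const(3) by (intro mult_left_mono) auto
    also have "\<dots> = rate" unfolding \<rho>_def using Cn const(3) by simp
    finally show ?thesis using \<omega>M by simp
  qed
  have A: "?A \<in> sets M"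
  proof -
    have coord: "(\<lambda>\<omega>. \<theta>hat \<omega> $ j) \<in> borel_measurable M" if "j < d" for j
      using measurable_compose[OF estimator_measurable borel_vec_coordinate_measurable[OF that]] .
    have "(\<lambda>\<omega>. sqrt (\<Sum>j<d. (\<theta>hat \<omega> $ j - \<theta>0 $ j)\<^sup>2)) \<in> borel_measurable M"
      using coord by measurable
    then have "{\<omega> \<in> space M. inverse (4 * Cn / c) * sqrt (\<Sum>j<d. (\<theta>hat \<omega> $ j - \<theta>0 $ j)\<^sup>2) \<le> rate} \<in> sets M"
      by measurable
    also have "{\<omega> \<in> space M. inverse (4 * Cn / c) * sqrt (\<Sum>j<d. (\<theta>hat \<omega> $ j - \<theta>0 $ j)\<^sup>2) \<le> rate} = ?A"
      using l2_norm_minus[OF hat_carrier target_carrier] by auto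
    finally show ?thesis .
  qed
  have E: "E1 \<union> E2 \<in> sets M" using E1 E2 by auto
  \<comment> \<open>The property of the estimator holds almost surely, so the good event is
    contained in \<open>?A\<close> up to a null set.\<close>
  have "AE \<omega> in M. \<omega> \<in> space M - (E1 \<union> E2) \<longrightarrow> \<omega> \<in> ?A"
    using estimator by eventually_elim (use good in blast)
  then have "measure M (space M - (E1 \<union> E2)) \<le> measure M ?A" by (rule finite_measure_mono_AE[OF _ A])
  moreover have "measure M (space M - (E1 \<union> E2)) = 1 - measure M (E1 \<union> E2)" by (rule prob_compl[OF E])
  moreover have "measure M (E1 \<union> E2) \<le> measure M E1 + measure M E2" by (rule measure_Un_le[OF E1(1) E2(1)])
  ultimately show ?thesis using E1(2) mE2 by linarith
qed

end

theorem theorem11: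
  fixes b1 qx qy qxy Kx Ky lam_Sigma Lam_Sigma lam_V :: real
  assumes "b1 > 0"
    and "qx \<ge> 1" "qy \<ge> 1" "Kx \<ge> 1" "Ky \<ge> 1"
    and "qxy = inverse (1 / qx + 1 / qy)" "qxy > 2"
    and "lam_Sigma > 0" "Lam_Sigma > 0" "lam_V > 0"
  shows "\<exists>c>0. \<exists>C>0. \<forall>(M :: 'a measure) d n l X Y I1 I2 \<theta>0 \<theta>hat.
    misspecified_glm M d n l X Y I1 I2 \<theta>0 \<theta>hat \<longrightarrow>
    (\<forall>t. \<bar>(deriv ^^ 2) l t\<bar> \<le> b1) \<longrightarrow>
    (\<forall>t. \<bar>(deriv ^^ 3) l t\<bar> \<le> b1) \<longrightarrow>
    (\<forall>u\<in>unit_sphere d.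
       (\<integral>\<^sup>+\<omega>. ennreal (\<bar>u \<bullet> (inv_sqrt_mat d (second_moment M d (X 0)) *\<^sub>v X 0 \<omega>)\<bar> powr qx) \<partial>M)
         \<le> ennreal (Kx powr qx)) \<longrightarrow>
    (\<integral>\<^sup>+\<omega>. ennreal (\<bar>Y 0 \<omega> - deriv l (X 0 \<omega> \<bullet> \<theta>0)\<bar> powr qy) \<partial>M) \<le> ennreal (Ky powr qy) \<longrightarrow>
    lam_Sigma \<le> lambda_min (second_moment M d (X 0)) \<longrightarrow>
    lambda_max (second_moment M d (X 0)) \<le> Lam_Sigma \<longrightarrow>
    lam_V \<le> lambda_min (weighted_second_moment M d (X 0) (\<lambda>\<omega>. (deriv ^^ 2) l (X 0 \<omega> \<bullet> \<theta>0))) \<longrightarrow>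
    (\<forall>\<epsilon>\<in>{0<..<1}. estimation_rate qxy n d \<epsilon> \<le> c \<longrightarrow>
       measure M {\<omega> \<in> space M. inverse C * l2_norm (\<theta>hat \<omega> - \<theta>0) \<le> estimation_rate qxy n d \<epsilon>}
         \<ge> 1 - \<epsilon>)"
proof -
  note b1 = assms(1) and qx = assms(2) and qy = assms(3) and Kx = assms(4) and Ky = assms(5)
    and qxy = assms(6) and q2 = assms(7) and lam = assms(8-10)
  have inv: "1 / qxy = 1 / qx + 1 / qy" unfolding qxy by (simp add: divide_inverse)
  \<comment> \<open>The curvature argument needs more than two moments of the covariates; this
    follows from qxy < qx.\<close>
  have qx2: "qx > 2"
  proof -
    have "1 / qx < 1 / qxy" using inv qy by simp
    then have "qxy < qx" using q2 qx by (simp add: field_simps)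
    then show ?thesis using q2 by simp
  qed
  \<comment> \<open>The locale requires a moment bound of at least 1, whereas sqrt Lam_Sigma * Kx
    may be smaller.\<close>
  define Kx' where "Kx' = max 1 ((sqrt Lam_Sigma * Kx) powr qx)"
  define Kz where "Kz = Kx' + Ky powr qy"
  have K: "Kx' \<ge> 1" "Kz \<ge> 1" by (auto simp: Kx'_def Kz_def intro: add_increasing2)
  obtain B Mr \<rho>0 where B: "B \<ge> 1" and Mr: "Mr \<ge> 1" and \<rho>0: "\<rho>0 > 0"
    and trunc: "\<And>\<rho>. 0 < \<rho> \<Longrightarrow> \<rho> \<le> \<rho>0 \<Longrightarrow>
      lam_V / 16 \<le> lam_V / 8 - b1 / 2 * (B\<^sup>2 * (Kx' / Mr powr qx) + 2 powr qx * Kx' / B powr (qx - 2))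
        - b1 * \<rho> * B / 6 * (4 * (1 + Kx'))"
    using truncation_constants[OF b1 K(1) qx2 lam(3)] by blast
  \<comment> \<open>Makes 2 c equal to the curvature lam_V / 16 that survives truncation.\<close>
  define c where "c = lam_V / 32"
  have c: "c > 0" using lam by (simp add: c_def)
  \<comment> \<open>The second argument solves b1 \<eta>^2 Mr^2 / 8 = c / 2, the loss allowed in the
    rounding; the cap 1/2 is the range of \<open>sphere_rounding_net\<close>.\<close>
  define \<eta> where "\<eta> = min (1 / 2) (sqrt (4 * c / (b1 * Mr\<^sup>2)))"
  have \<eta>: "0 < \<eta>" "\<eta> \<le> 1 / 2" using c b1 Mr by (auto simp: \<eta>_def)
  have \<eta>2: "b1 * \<eta>\<^sup>2 * Mr\<^sup>2 / 8 \<le> c / 2"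
  proof -
    have "\<eta>\<^sup>2 \<le> (sqrt (4 * c / (b1 * Mr\<^sup>2)))\<^sup>2" using \<eta> by (intro power_mono) (auto simp: \<eta>_def)
    also have "\<dots> = 4 * c / (b1 * Mr\<^sup>2)" using c b1 by simp
    finally show ?thesis using b1 Mr by (simp add: pos_le_divide_eq mult_ac)
  qed
  obtain C0 where C0: "C0 \<ge> 1"
    and net: "\<forall>d>0. \<exists>N. real (card N) \<le> C0 ^ d \<and> (\<forall>I :: nat set. rounding_net I d \<eta> N)"
    using sphere_rounding_net[OF \<eta>, where 'i = nat] by (elim exE conjE)
  define Cn where "Cn = fuk_nagaev_const qxy Kz"
  have Cn: "Cn > 0" unfolding Cn_def using K(2) by (rule fuk_nagaev_const_pos)
  define C where "C = 4 * Cn / c"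
  have C: "C > 0" using Cn c by (simp add: C_def)
  define c3 where "c3 = 8 * c\<^sup>2 / (b1\<^sup>2 * B ^ 4)"
  have c3: "c3 > 0" using c b1 B by (simp add: c3_def)
  have lnC: "ln C0 \<ge> 0" using C0 by simp
  \<comment> \<open>The first bound keeps \<rho> = C * rate below \<rho>0, so that the cubic term
    stays small; the second keeps the cardinality of the net below the gain from Hoeffding's
    inequality.\<close>
  define r0 where "r0 = min (\<rho>0 / C) (sqrt (c3 / (2 * (ln C0 + 1))))"
  have r0: "r0 > 0" unfolding r0_def using \<rho>0 C c3 lnC by simp
  show ?thesis
  proof (rule exI[of _ r0], intro conjI r0, rule exI[of _ C], intro conjI C allI impI ballI)
    fix M :: "'a measure" and d n l X Y I1 I2 \<theta>0 \<theta>hat \<epsilon>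
    assume glm: "misspecified_glm M d n l X Y I1 I2 \<theta>0 \<theta>hat"
      and l2: "\<forall>t. \<bar>(deriv ^^ 2) l t\<bar> \<le> b1" and l3: "\<forall>t. \<bar>(deriv ^^ 3) l t\<bar> \<le> b1"
      and X_moment: "\<forall>u\<in>unit_sphere d.
       (\<integral>\<^sup>+\<omega>. ennreal (\<bar>u \<bullet> (inv_sqrt_mat d (second_moment M d (X 0)) *\<^sub>v X 0 \<omega>)\<bar> powr qx) \<partial>M)
         \<le> ennreal (Kx powr qx)"
      and Y_moment: "(\<integral>\<^sup>+\<omega>. ennreal (\<bar>Y 0 \<omega> - deriv l (X 0 \<omega> \<bullet> \<theta>0)\<bar> powr qy) \<partial>M) \<le> ennreal (Ky powr qy)"
      and lmin: "lam_Sigma \<le> lambda_min (second_moment M d (X 0))"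
      and lmax: "lambda_max (second_moment M d (X 0)) \<le> Lam_Sigma"
      and lV: "lam_V \<le> lambda_min (weighted_second_moment M d (X 0) (\<lambda>\<omega>. (deriv ^^ 2) l (X 0 \<omega> \<bullet> \<theta>0)))"
      and \<epsilon>: "\<epsilon> \<in> {0<..<1}" and rate_le: "estimation_rate qxy n d \<epsilon> \<le> r0"
    interpret misspecified_glm M d n l X Y I1 I2 \<theta>0 \<theta>hat by (rule glm)
    interpret S: smooth_convex l "deriv l" "(deriv ^^ 2) l" "(deriv ^^ 3) l" b1
      using b1 l2 l3 by (intro smooth_convex_link) auto
    have Xm: "integrable M (\<lambda>\<omega>. \<bar>\<Sum>j<d. u j * X 0 \<omega> $ j\<bar> powr qx)"
      "(\<integral>\<omega>. \<bar>\<Sum>j<d. u j * X 0 \<omega> $ j\<bar> powr qx \<partial>M) \<le> Kx'" if "(\<Sum>j<d. (u j)\<^sup>2) \<le> 1" for u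
      using covariate_moment[OF lam(1,2) _ _ X_moment lmin lmax that] qx Kx unfolding Kx'_def by auto
    have Zm: "integrable M (\<lambda>\<omega>. \<bar>\<Sum>j<d. u j * (X 0 \<omega> $ j * (Y 0 \<omega> - deriv l (X 0 \<omega> \<bullet> \<theta>0)))\<bar> powr qxy)"
      "(\<integral>\<omega>. \<bar>\<Sum>j<d. u j * (X 0 \<omega> $ j * (Y 0 \<omega> - deriv l (X 0 \<omega> \<bullet> \<theta>0)))\<bar> powr qxy \<partial>M) \<le> Kz"
      if "(\<Sum>j<d. (u j)\<^sup>2) \<le> 1" for u
      using noise_moment[OF inv _ _ _ Xm[OF that] Y_moment _ S.measurable_l(2)] q2 qx qy unfolding Kz_def by auto
    have V: "lam_V * (\<Sum>j<d. (u j)\<^sup>2) \<le> (\<integral>\<omega>. (deriv ^^ 2) l (X 0 \<omega> \<bullet> \<theta>0) * (\<Sum>j<d. u j * X 0 \<omega> $ j)\<^sup>2 \<partial>M)" for u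
      by (rule curvature_form[OF S.measurable_l(3) _ lV]) (use l2 in auto)
    obtain Nt where Nt: "real (card Nt) \<le> C0 ^ d" "\<forall>I :: nat set. rounding_net I d \<eta> Nt"
      using net[THEN spec, THEN mp, OF d_pos] by (elim exE conjE)
    let ?rate = "estimation_rate qxy n d \<epsilon>"
    have e: "0 < \<epsilon>" "\<epsilon> < 1" using \<epsilon> by auto
    have rate: "?rate > 0"
      unfolding estimation_rate_def using e d_pos n_pos by (intro add_pos_nonneg) (auto intro!: divide_pos_pos add_pos_pos)
    have "C * ?rate \<le> \<rho>0" using rate_le C by (simp add: r0_def pos_le_divide_eq mult.commute)
    then have trunc': "2 * c \<le> lam_V / 8 - b1 / 2 * (B\<^sup>2 * (Kx' / Mr powr qx) + 2 powr qx * Kx' / B powr (qx - 2))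
        - b1 * (C * ?rate) * B / 6 * (4 * (1 + Kx'))"
      using trunc[of "C * ?rate"] rate C by (simp add: c_def)
    have small: "2 * (ln C0 + 1) * ?rate\<^sup>2 \<le> c3"
    proof -
      have "?rate\<^sup>2 \<le> (sqrt (c3 / (2 * (ln C0 + 1))))\<^sup>2"
        using rate_le rate by (intro power_mono) (auto simp: r0_def)
      also have "\<dots> = c3 / (2 * (ln C0 + 1))" using c3 lnC by simp
      finally show ?thesis using lnC by (simp add: pos_le_divide_eq mult.commute)
    qed
    show "1 - \<epsilon> \<le> measure M {\<omega> \<in> space M. inverse C * l2_norm (\<theta>hat \<omega> - \<theta>0) \<le> ?rate}"
      unfolding C_def Cn_def
    proof (rule estimation_bound[OF b1 _ _ qx2 q2 K lam(3) Xm Zm V B Mr c \<eta>2 _ Nt(1) C0 Nt(2)[THEN spec] e])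
      show "\<bar>(deriv ^^ 2) l t\<bar> \<le> b1" "\<bar>(deriv ^^ 3) l t\<bar> \<le> b1" for t using l2 l3 by simp_all
      show "2 * c \<le> lam_V / 8 - b1 / 2 * (B\<^sup>2 * (Kx' / Mr powr qx) + 2 powr qx * Kx' / B powr (qx - 2))
        - b1 * (4 * fuk_nagaev_const qxy Kz / c * ?rate) * B / 6 * (4 * (1 + Kx'))"
        using trunc' unfolding C_def Cn_def .
      show "2 * (ln C0 + 1) * ?rate\<^sup>2 \<le> 8 * c\<^sup>2 / (b1\<^sup>2 * B ^ 4)" using small unfolding c3_def .
    qed
  qed
qed

end
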